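(* Suppose that: (1) the undirected graph $\mathcal G$ is connected; (2) $\mathbb X^*\neq\emptyset$ and $f^*>-\infty$; (3) for every $i\in[n]$ and almost all $\xi_i$, $F_i(\cdot,\xi_i)$ is smooth with constant $L_f>0$, i.e., differentiable with $L_f$-Lipschitz gradient; (4) there exist constants $\sigma_0,\sigma_1$ such that $\mathbf E_{\xi_i}[\|\nabla_xF_i(x,\xi_i)-\nabla f_i(x)\|^2]\le\sigma_0^2\|\nabla f_i(x)\|^2+\sigma_1^2$ for all $i\in[n]$, $x\in\mathbb R^p$; (5) there exist constants $\tilde\sigma_0,\sigma_2$ such that $\|\nabla f_i(x)-\nabla f(x)\|^2\le\tilde\sigma_0^2\|\nabla f(x)\|^2+\sigma_2^2$ for all $i\in[n]$, $x\in\mathbb R^p$; (6) $f$ satisfies the Polyak–Łojasiewicz condition with constant $\nu>0$: $\frac12\|\nabla f(x)\|^2\ge\nu(f(x)-f^* )$ for all $x\in\mathbb R^p$; and that $\nu$ is known in advance. Let $\{x_{i,k}\}$ be the sequence generated by Algorithm 2 with $$\gamma\in(0,d_1),\quad\eta_k=\frac{\kappa_\eta}{k+t_1},\quad \delta_{i,k}\le\frac{\kappa_\delta\sqrt{p\eta_k}}{\sqrt{n+p}},\quad\forall k\in\mathbb N_0,$$ where $\kappa_\delta>0$, $\kappa_\eta\in(\frac8\nu,\frac{8d_3}\nu]$, $t_1>\hat d_2(\gamma)$ and $d_3>1$. Then, for any $T\in\mathbb N_+$, $$\mathbf E\Big[\frac1n\sum_{i=1}^n\|x_{i,T}-\bar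 x_T\|^2\Big]=\mathcal O\Big(\frac p{T^2}\Big),\qquad\mathbf E[f(\bar x_T)-f^*]=\mathcal O\Big(\frac p{nT}\Big)+\mathcal O\Big(\frac p{T^2}\Big),$$ where $\bar x_k=\frac1n\sum_{i=1}^nx_{i,k}$. Moreover, the omitted constants in the first term $\mathcal O(\frac p{nT})$ on the right-hand side of the second bound do not depend on any parameters related to the communication network.
   Context: Problem: $n$ agents, $[n]=\{1,\dots,n\}$. For each $i\in[n]$, $\xi_i$ is a random variable and $F_i(\cdot,\xi_i):\mathbb R^p\to\mathbb R$ a stochastic function (not necessarily convex); $f_i(x)=\mathbf E_{\xi_i}[F_i(x,\xi_i)]$, $f(x)=\frac1n\sum_{i=1}^nf_i(x)$, $f^*=\min_{x\in\mathbb R^p}f(x)$, $\mathbb X^*$ is the set of minimizers of $f$. Network: $\mathcal G=([n],\mathcal E)$ is an undirected graph with symmetric weights $a_{ij}>0$ if $(i,j)\in\mathcal E$, $a_{ij}=0$ otherwise, $a_{ii}=0$; $L=(L_{ij})$ is the weighted Laplacian, $L=\mathrm{diag}(\sum_ja_{1j},\dots,\sum_ja_{nj})-(a_{ij})$. $\rho(\cdot)$ is the spectral radius and $\rho_2(L)$ the minimum positive eigenvalue of $L$. $\|\cdot\|$ is the Euclidean norm. $\mathbb N_+$: positive integers; $\mathbb N_0$: nonnegative integers. Algorithm 2 (distributed zeroth-order primal algorithm): given a constant $\gamma>0$, positive sequences $\{\eta_k\},\{\delta_{i,k}\}$ and initial points $x_{i,0}\in\mathbb R^p$, at each iteration $k$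 each agent $i$ draws $u_{i,k}$ uniformly from the unit sphere $\mathbb S^p$ of $\mathbb R^p$ and $\xi_{i,k}$ from the distribution of $\xi_i$ (all $u_{i,k},\xi_{j,l}$ mutually independent), sets $$g^e_{i,k}=\frac{p\,(F_i(x_{i,k}+\delta_{i,k}u_{i,k},\xi_{i,k})-F_i(x_{i,k},\xi_{i,k}))}{\delta_{i,k}}u_{i,k},$$ and updates $x_{i,k+1}=x_{i,k}-\gamma\sum_{j=1}^nL_{ij}x_{j,k}-\eta_kg^e_{i,k}$. Constants: $d_1=\frac{\rho_2(L)}{2\rho(L^2)}$, $\epsilon_1=\frac12\gamma\rho_2(L)-\gamma^2\rho(L^2)$, $\epsilon_2=\frac{1+2\gamma\rho_2(L)}{2\gamma\rho_2(L)}$, $d_2(\gamma)=\min\{\frac{4\epsilon_1}{9L_f^2},\ \frac1{64p(1+\sigma_0^2)(1+\tilde\sigma_0^2)(2\epsilon_2+L_f)}\}$, $\hat d_2(\gamma)=\max\{\frac1{\epsilon_1},\frac{\kappa_\eta}{d_2(\gamma)}\}$. *)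

theory Defs
  imports
    "HOL-Probability.Probability"
    "HOL-Library.Poly_Mapping"
    "Jordan_Normal_Form.Spectral_Radius"
begin

text \<open>
  A constant that is uniform in the dimension \<open>p\<close> has to be chosen before \<open>p\<close>, so \<open>p\<close> cannot be the
  cardinality of a type. All the spaces \<open>\<real>\<^sup>p\<close> therefore live in one type, the finitely supported
  sequences \<open>nat \<Rightarrow>\<^sub>0 real\<close> with the \<open>\<ell>\<^sup>2\<close> inner product: \<open>\<real>\<^sup>p\<close> is the subspace of the sequences that are
  supported in \<open>{..<p}\<close>, on which norm and inner product are the Euclidean ones
  (\<open>norm_euclid\<close> and \<open>inner_euclid\<close> below).
\<close>

instantiation poly_mapping :: (type, real_inner) real_inner
begin

lift_definition scaleR_poly_mapping :: "real \<Rightarrow> ('a \<Rightarrow>\<^sub>0 'b) \<Rightarrow> ('a \<Rightarrow>\<^sub>0 'b)"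
  is "\<lambda>c f k. c *\<^sub>R f k"
  by (rule finite_subset[rotated]) auto

definition inner_poly_mapping :: "('a \<Rightarrow>\<^sub>0 'b) \<Rightarrow> ('a \<Rightarrow>\<^sub>0 'b) \<Rightarrow> real" where
  "inner_poly_mapping x y = (\<Sum>k\<in>Poly_Mapping.keys x. inner (Poly_Mapping.lookup x k) (Poly_Mapping.lookup y k))"

definition norm_poly_mapping :: "('a \<Rightarrow>\<^sub>0 'b) \<Rightarrow> real" where
  "norm_poly_mapping x = sqrt (inner x x)"

definition dist_poly_mapping :: "('a \<Rightarrow>\<^sub>0 'b) \<Rightarrow> ('a \<Rightarrow>\<^sub>0 'b) \<Rightarrow> real" where
  "dist_poly_mapping x y = norm (x - y)"

definition sgn_poly_mapping :: "('a \<Rightarrow>\<^sub>0 'b) \<Rightarrow> ('a \<Rightarrow>\<^sub>0 'b)" where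
  "sgn_poly_mapping x = inverse (norm x) *\<^sub>R x"

definition uniformity_poly_mapping :: "(('a \<Rightarrow>\<^sub>0 'b) \<times> ('a \<Rightarrow>\<^sub>0 'b)) filter" where
  "uniformity_poly_mapping = (INF e\<in>{0<..}. principal {(x, y). dist x y < e})"

definition open_poly_mapping :: "('a \<Rightarrow>\<^sub>0 'b) set \<Rightarrow> bool" where
  "open_poly_mapping U \<longleftrightarrow> (\<forall>x\<in>U. \<forall>\<^sub>F (x', y) in uniformity. x' = x \<longrightarrow> y \<in> U)"

lemma inner_poly_mapping_superset:
  fixes x y :: "'a \<Rightarrow>\<^sub>0 'b"
  assumes "finite A" "Poly_Mapping.keys x \<subseteq> A"
  shows "inner x y = (\<Sum>k\<in>A. inner (Poly_Mapping.lookup x k) (Poly_Mapping.lookup y k))"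
  unfolding inner_poly_mapping_def
  by (rule sum.mono_neutral_left) (use assms in \<open>auto simp: in_keys_iff\<close>)

instance
proof
  fix x y z :: "'a \<Rightarrow>\<^sub>0 'b" and a b :: real and U :: "('a \<Rightarrow>\<^sub>0 'b) set"
  show "a *\<^sub>R (x + y) = a *\<^sub>R x + a *\<^sub>R y"
    by (rule poly_mapping_eqI) (simp add: scaleR_poly_mapping.rep_eq lookup_add scaleR_add_right)
  show "(a + b) *\<^sub>R x = a *\<^sub>R x + b *\<^sub>R x"
    by (rule poly_mapping_eqI) (simp add: scaleR_poly_mapping.rep_eq lookup_add scaleR_add_left)
  show "a *\<^sub>R b *\<^sub>R x = (a * b) *\<^sub>R x"
    by (rule poly_mapping_eqI) (simp add: scaleR_poly_mapping.rep_eq)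
  show "1 *\<^sub>R x = x"
    by (rule poly_mapping_eqI) (simp add: scaleR_poly_mapping.rep_eq)
  show "dist x y = norm (x - y)" by (rule dist_poly_mapping_def)
  show "sgn x = inverse (norm x) *\<^sub>R x" by (rule sgn_poly_mapping_def)
  show "uniformity = (INF e\<in>{0<..}. principal {(x, y). dist (x :: 'a \<Rightarrow>\<^sub>0 'b) y < e})"
    by (rule uniformity_poly_mapping_def)
  show "open U \<longleftrightarrow> (\<forall>x\<in>U. \<forall>\<^sub>F (x', y) in uniformity. x' = x \<longrightarrow> y \<in> U)"
    by (rule open_poly_mapping_def)
  have "inner x y = (\<Sum>k\<in>Poly_Mapping.keys x \<union> Poly_Mapping.keys y. inner (Poly_Mapping.lookup x k) (Poly_Mapping.lookup y k))"
    by (rule inner_poly_mapping_superset) auto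
  moreover have "inner y x = (\<Sum>k\<in>Poly_Mapping.keys x \<union> Poly_Mapping.keys y. inner (Poly_Mapping.lookup y k) (Poly_Mapping.lookup x k))"
    by (rule inner_poly_mapping_superset) auto
  ultimately show "inner x y = inner y x" by (simp add: inner_commute)
  have "inner (x + y) z = (\<Sum>k\<in>Poly_Mapping.keys x \<union> Poly_Mapping.keys y. inner (Poly_Mapping.lookup (x + y) k) (Poly_Mapping.lookup z k))"
    by (rule inner_poly_mapping_superset) (use Poly_Mapping.keys_add[of x y] in auto)
  moreover have "inner x z = (\<Sum>k\<in>Poly_Mapping.keys x \<union> Poly_Mapping.keys y. inner (Poly_Mapping.lookup x k) (Poly_Mapping.lookup z k))"
    by (rule inner_poly_mapping_superset) auto
  moreover have "inner y z = (\<Sum>k\<in>Poly_Mapping.keys x \<union> Poly_Mapping.keys y. inner (Poly_Mapping.lookup y k) (Poly_Mapping.lookup z k))"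
    by (rule inner_poly_mapping_superset) auto
  ultimately show "inner (x + y) z = inner x z + inner y z"
    by (simp add: lookup_add inner_add_left sum.distrib)
  have "inner (a *\<^sub>R x) y = (\<Sum>k\<in>Poly_Mapping.keys x. inner (Poly_Mapping.lookup (a *\<^sub>R x) k) (Poly_Mapping.lookup y k))"
    by (rule inner_poly_mapping_superset) (auto simp: in_keys_iff scaleR_poly_mapping.rep_eq)
  then show "inner (a *\<^sub>R x) y = a * inner x y"
    by (simp add: scaleR_poly_mapping.rep_eq inner_poly_mapping_def sum_distrib_left)
  show "0 \<le> inner x x" by (simp add: inner_poly_mapping_def sum_nonneg)
  show "inner x x = 0 \<longleftrightarrow> x = 0"
  proof
    assume "inner x x = 0"
    then have "\<forall>k\<in>Poly_Mapping.keys x. inner (Poly_Mapping.lookup x k) (Poly_Mapping.lookup x k) = 0"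
      unfolding inner_poly_mapping_def by (subst (asm) sum_nonneg_eq_0_iff) auto
    then show "x = 0"
      by (intro poly_mapping_eqI) (auto simp: in_keys_iff)
  qed (simp add: inner_poly_mapping_def)
  show "norm x = sqrt (inner x x)" by (rule norm_poly_mapping_def)
qed

end

definition euclid :: "nat \<Rightarrow> (nat \<Rightarrow>\<^sub>0 real) set" where
  "euclid p = {x. Poly_Mapping.keys x \<subseteq> {..<p}}"

lemma inner_euclid: "x \<in> euclid p \<Longrightarrow> inner x y = (\<Sum>i<p. Poly_Mapping.lookup x i * Poly_Mapping.lookup y i)"
  by (simp add: euclid_def inner_poly_mapping_superset[of "{..<p}"])

lemma norm_euclid: "x \<in> euclid p \<Longrightarrow> norm x = L2_set (Poly_Mapping.lookup x) {..<p}"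
  by (simp add: norm_eq_sqrt_inner inner_euclid L2_set_def power2_eq_square)

definition euclid_borel :: "nat \<Rightarrow> (nat \<Rightarrow>\<^sub>0 real) measure" where
  "euclid_borel p = restrict_space borel (euclid p)"

definition of_coords :: "nat \<Rightarrow> (nat \<Rightarrow> real) \<Rightarrow> (nat \<Rightarrow>\<^sub>0 real)" where
  "of_coords p y = (\<Sum>i<p. Poly_Mapping.single i (y i))"

text \<open>
  The uniform distribution on the unit sphere of \<open>\<real>\<^sup>p\<close> (normalised surface measure) is the
  distribution of \<open>y / \<parallel>y\<parallel>\<close> for \<open>y\<close> uniform, with respect to Lebesgue measure, in the unit ball.
\<close>

definition uniform_sphere :: "nat \<Rightarrow> (nat \<Rightarrow>\<^sub>0 real) measure" where
  "uniform_sphere p =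
     distr
       (uniform_measure (PiM {..<p} (\<lambda>_. lborel))
          {y \<in> space (PiM {..<p} (\<lambda>_. lborel)). norm (of_coords p y) \<le> 1})
       (euclid_borel p)
       (\<lambda>y. sgn (of_coords p y))"

definition grad :: "nat \<Rightarrow> ((nat \<Rightarrow>\<^sub>0 real) \<Rightarrow> real) \<Rightarrow> (nat \<Rightarrow>\<^sub>0 real) \<Rightarrow> (nat \<Rightarrow>\<^sub>0 real)" where
  "grad p f x = (THE g. g \<in> euclid p \<and> (f has_derivative (\<lambda>h. inner g h)) (at x within euclid p))"

lemma subspace_euclid: "Real_Vector_Spaces.subspace (euclid p)"
proof (rule real_vector.subspaceI)
  fix x y :: "nat \<Rightarrow>\<^sub>0 real" and c :: real
  assume xy: "x \<in> euclid p" "y \<in> euclid p"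
  show "x + y \<in> euclid p"
    using xy Poly_Mapping.keys_add[of x y] by (auto simp: euclid_def)
next
  fix x :: "nat \<Rightarrow>\<^sub>0 real" and c :: real
  assume "x \<in> euclid p"
  then show "c *\<^sub>R x \<in> euclid p"
    by (auto simp: euclid_def in_keys_iff scaleR_poly_mapping.rep_eq)
qed (simp add: euclid_def)

lemma lookup_of_coords: "Poly_Mapping.lookup (of_coords p y) i = (if i < p then y i else 0)"
  by (induction p) (auto simp: of_coords_def lookup_add lookup_single when_def)

lemma of_coords_in_euclid: "of_coords p y \<in> euclid p"
  by (auto simp: euclid_def in_keys_iff lookup_of_coords split: if_splits)

text \<open>The gradient of a function that is differentiable on \<open>\<real>\<^sup>p\<close> exists and is unique.\<close>

lemma grad_unique:
  assumes x: "x \<in> euclid p" and g: "g \<in> euclid p" "g' \<in> euclid p"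
    and d: "(f has_derivative (\<lambda>h. inner g h)) (at x within euclid p)"
      "(f has_derivative (\<lambda>h. inner g' h)) (at x within euclid p)"
  shows "g = g'"
proof -
  define e where "e = g - g'"
  have e: "e \<in> euclid p"
    unfolding e_def by (intro real_vector.subspace_diff subspace_euclid g)
  have "((\<lambda>y. f y - f y) has_derivative (\<lambda>h. inner g h - inner g' h)) (at x within euclid p)"
    by (rule has_derivative_diff[OF d])
  then have "((\<lambda>y. 0::real) has_derivative (\<lambda>h. inner e h)) (at x within euclid p)"
    by (simp add: e_def inner_diff_left)
  moreover have "range (\<lambda>t. x + t *\<^sub>R e) \<subseteq> euclid p"
    by (intro image_subsetI real_vector.subspace_add real_vector.subspace_scale subspace_euclid x e)
  ultimately have "((\<lambda>y. 0::real) has_derivative (\<lambda>h. inner e h))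
      (at x within range (\<lambda>t. x + t *\<^sub>R e))"
    by (rule has_derivative_subset)
  then have "((\<lambda>y. 0::real) has_derivative (\<lambda>h. inner e h))
      (at (x + 0 *\<^sub>R e) within range (\<lambda>t. x + t *\<^sub>R e))"
    by (simp only: scaleR_zero_left add_0_right)
  moreover have "((\<lambda>t. x + t *\<^sub>R e) has_derivative (\<lambda>t. t *\<^sub>R e)) (at 0)"
    by (auto intro!: derivative_eq_intros)
  ultimately have "((\<lambda>t::real. 0::real) has_derivative (\<lambda>t. inner e (t *\<^sub>R e))) (at 0)"
    by (rule has_derivative_in_compose[rotated])
  moreover have "((\<lambda>t::real. 0::real) has_derivative (\<lambda>t. 0)) (at 0)"
    by (rule has_derivative_const)
  ultimately have "(\<lambda>t::real. inner e (t *\<^sub>R e)) = (\<lambda>t. 0)"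
    by (rule has_derivative_unique)
  from fun_cong[OF this, of 1] show ?thesis
    by (simp add: e_def)
qed

lemma grad_eqI:
  assumes "x \<in> euclid p" "g \<in> euclid p"
    and "(f has_derivative (\<lambda>h. inner g h)) (at x within euclid p)"
  shows "grad p f x = g"
  unfolding grad_def using assms by (intro the_equality) (auto intro: grad_unique)

lemma grad_exists:
  assumes x: "x \<in> euclid p" and "f differentiable (at x within euclid p)"
  shows "grad p f x \<in> euclid p"
    and "(f has_derivative (\<lambda>h. inner (grad p f x) h)) (at x within euclid p)"
proof -
  obtain f' where f': "(f has_derivative f') (at x within euclid p)"
    using assms by (auto simp: differentiable_def)
  then interpret bounded_linear f' by (rule has_derivative_bounded_linear)
  define g where "g = of_coords p (\<lambda>i. f' (Poly_Mapping.single i 1))"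
  have g: "g \<in> euclid p" by (simp add: g_def of_coords_in_euclid)
  have eq: "f' h = inner g h" if h: "h \<in> euclid p" for h
  proof -
    have "h = (\<Sum>i<p. Poly_Mapping.lookup h i *\<^sub>R Poly_Mapping.single i 1)" (is "h = ?r")
    proof -
      have "?r = of_coords p (Poly_Mapping.lookup h)"
        unfolding of_coords_def
        by (intro sum.cong refl poly_mapping_eqI)
          (auto simp: scaleR_poly_mapping.rep_eq lookup_single when_def)
      also have "\<dots> = h"
        using h by (intro poly_mapping_eqI) (auto simp: lookup_of_coords euclid_def in_keys_iff)
      finally show ?thesis ..
    qed
    then have "f' h = f' (\<Sum>i<p. Poly_Mapping.lookup h i *\<^sub>R Poly_Mapping.single i 1)"
      by (rule arg_cong)
    also have "\<dots> = (\<Sum>i<p. Poly_Mapping.lookup h i * f' (Poly_Mapping.single i 1))"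
      using sum[of "\<lambda>i. Poly_Mapping.lookup h i *\<^sub>R Poly_Mapping.single i 1" "{..<p}"]
      by (simp only: scaleR real_scaleR_def)
    finally have "f' h = (\<Sum>i<p. Poly_Mapping.lookup h i * f' (Poly_Mapping.single i 1))" .
    then show ?thesis
      using g by (simp add: inner_euclid g_def lookup_of_coords mult.commute)
  qed
  have "(f has_derivative (\<lambda>h. inner g h)) (at x within euclid p)"
    unfolding has_derivative_within
  proof (rule conjI)
    show "bounded_linear (inner g)" by (rule bounded_linear_inner_right)
    have "((\<lambda>y. (1 / norm (y - x)) *\<^sub>R (f y - (f x + f' (y - x)))) \<longlongrightarrow> 0) (at x within euclid p)"
      using f' by (simp only: has_derivative_within)
    moreover have "\<forall>\<^sub>F y in at x within euclid p.
        (1 / norm (y - x)) *\<^sub>R (f y - (f x + f' (y - x)))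
        = (1 / norm (y - x)) *\<^sub>R (f y - (f x + inner g (y - x)))"
      unfolding eventually_at_filter
      by (rule always_eventually) (intro allI impI, simp only: eq[OF real_vector.subspace_diff[OF subspace_euclid _ x]])
    ultimately show "((\<lambda>y. (1 / norm (y - x)) *\<^sub>R (f y - (f x + inner g (y - x)))) \<longlongrightarrow> 0)
        (at x within euclid p)"
      by (rule Lim_transform_eventually)
  qed
  with grad_eqI[OF x g this] g show "grad p f x \<in> euclid p"
    "(f has_derivative (\<lambda>h. inner (grad p f x) h)) (at x within euclid p)"
    by simp_all
qed

definition smooth :: "nat \<Rightarrow> real \<Rightarrow> ((nat \<Rightarrow>\<^sub>0 real) \<Rightarrow> real) \<Rightarrow> bool" where
  "smooth p l f \<longleftrightarrow> f differentiable_on euclid p \<and> l-lipschitz_on (euclid p) (grad p f)"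



section \<open>Network\<close>

definition weighted_graph :: "nat \<Rightarrow> (nat \<times> nat) set \<Rightarrow> (nat \<Rightarrow> nat \<Rightarrow> real) \<Rightarrow> bool" where
  "weighted_graph n E a \<longleftrightarrow>
     E \<subseteq> {..<n} \<times> {..<n} \<and> sym E \<and>
     (\<forall>i<n. \<forall>j<n. a i j = a j i \<and> ((i, j) \<in> E \<longrightarrow> a i j > 0) \<and> ((i, j) \<notin> E \<longrightarrow> a i j = 0)) \<and>
     (\<forall>i<n. a i i = 0)"

definition connected_graph :: "nat \<Rightarrow> (nat \<times> nat) set \<Rightarrow> bool" where
  "connected_graph n E \<longleftrightarrow> (\<forall>i<n. \<forall>j<n. (i, j) \<in> E\<^sup>*)"

definition laplacian :: "nat \<Rightarrow> (nat \<Rightarrow> nat \<Rightarrow> real) \<Rightarrow> real mat" where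
  "laplacian n a = mat n n (\<lambda>(i, j). (if i = j then \<Sum>k<n. a i k else 0) - a i j)"

definition rho :: "real mat \<Rightarrow> real" where
  "rho A = spectral_radius (map_mat complex_of_real A)"

definition rho2 :: "real mat \<Rightarrow> real" where
  "rho2 A = Min {\<mu>. eigenvalue A \<mu> \<and> 0 < \<mu>}"


section \<open>Stochastic objective\<close>

text \<open>
  The law of \<open>\<xi>\<^sub>i\<close> is the probability measure \<open>D i\<close>. Joint measurability of \<open>F\<^sub>i\<close> and integrability of
  \<open>F\<^sub>i(x, \<xi>\<^sub>i)\<close> are what the iterates need to be random variables and \<open>f\<^sub>i\<close> to be defined.
\<close>

definition stochastic_functions ::
  "nat \<Rightarrow> nat \<Rightarrow> (nat \<Rightarrow> 'z measure) \<Rightarrow> (nat \<Rightarrow> (nat \<Rightarrow>\<^sub>0 real) \<Rightarrow> 'z \<Rightarrow> real) \<Rightarrow> bool" where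
  "stochastic_functions p n D F \<longleftrightarrow>
     (\<forall>i<n. prob_space (D i) \<and>
        (\<lambda>(x, z). F i x z) \<in> borel_measurable (euclid_borel p \<Otimes>\<^sub>M D i) \<and>
        (\<forall>x\<in>euclid p. integrable (D i) (F i x)))"

definition local_obj ::
  "(nat \<Rightarrow> 'z measure) \<Rightarrow> (nat \<Rightarrow> (nat \<Rightarrow>\<^sub>0 real) \<Rightarrow> 'z \<Rightarrow> real) \<Rightarrow> nat \<Rightarrow> (nat \<Rightarrow>\<^sub>0 real) \<Rightarrow> real" where
  "local_obj D F i x = (\<integral>z. F i x z \<partial>D i)"

definition global_obj ::
  "nat \<Rightarrow> (nat \<Rightarrow> 'z measure) \<Rightarrow> (nat \<Rightarrow> (nat \<Rightarrow>\<^sub>0 real) \<Rightarrow> 'z \<Rightarrow> real) \<Rightarrow> (nat \<Rightarrow>\<^sub>0 real) \<Rightarrow> real" where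
  "global_obj n D F x = (\<Sum>i<n. local_obj D F i x) / n"

definition minimizers :: "nat \<Rightarrow> ((nat \<Rightarrow>\<^sub>0 real) \<Rightarrow> real) \<Rightarrow> (nat \<Rightarrow>\<^sub>0 real) set" where
  "minimizers p f = {x \<in> euclid p. \<forall>y\<in>euclid p. f x \<le> f y}"

definition min_value :: "nat \<Rightarrow> ((nat \<Rightarrow>\<^sub>0 real) \<Rightarrow> real) \<Rightarrow> real" where
  "min_value p f = (INF x\<in>euclid p. f x)"

text \<open>
  The second moment is an extended nonnegative integral: the Bochner integral would be \<open>0\<close>, and
  the bound void, if the moment were infinite.
\<close>

definition bounded_variance ::
  "nat \<Rightarrow> nat \<Rightarrow> (nat \<Rightarrow> 'z measure) \<Rightarrow> (nat \<Rightarrow> (nat \<Rightarrow>\<^sub>0 real) \<Rightarrow> 'z \<Rightarrow> real) \<Rightarrow> real \<Rightarrow> real \<Rightarrow> bool" where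
  "bounded_variance p n D F \<sigma>0 \<sigma>1 \<longleftrightarrow>
     (\<forall>i<n. \<forall>x\<in>euclid p.
        (\<integral>\<^sup>+z. ennreal ((norm (grad p (\<lambda>y. F i y z) x - grad p (local_obj D F i) x))\<^sup>2) \<partial>D i)
          \<le> ennreal (\<sigma>0\<^sup>2 * (norm (grad p (local_obj D F i) x))\<^sup>2 + \<sigma>1\<^sup>2))"

definition bounded_dissimilarity ::
  "nat \<Rightarrow> nat \<Rightarrow> (nat \<Rightarrow> 'z measure) \<Rightarrow> (nat \<Rightarrow> (nat \<Rightarrow>\<^sub>0 real) \<Rightarrow> 'z \<Rightarrow> real) \<Rightarrow> real \<Rightarrow> real \<Rightarrow> bool" where
  "bounded_dissimilarity p n D F \<tau>0 \<sigma>2 \<longleftrightarrow>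
     (\<forall>i<n. \<forall>x\<in>euclid p.
        (norm (grad p (local_obj D F i) x - grad p (global_obj n D F) x))\<^sup>2
          \<le> \<tau>0\<^sup>2 * (norm (grad p (global_obj n D F) x))\<^sup>2 + \<sigma>2\<^sup>2)"

definition polyak_lojasiewicz :: "nat \<Rightarrow> real \<Rightarrow> ((nat \<Rightarrow>\<^sub>0 real) \<Rightarrow> real) \<Rightarrow> bool" where
  "polyak_lojasiewicz p \<nu> f \<longleftrightarrow>
     (\<forall>x\<in>euclid p. (1/2) * (norm (grad p f x))\<^sup>2 \<ge> \<nu> * (f x - min_value p f))"


section \<open>Distributed zeroth-order primal algorithm\<close>

definition zo_grad ::
  "nat \<Rightarrow> ((nat \<Rightarrow>\<^sub>0 real) \<Rightarrow> 'z \<Rightarrow> real) \<Rightarrow> real \<Rightarrow> (nat \<Rightarrow>\<^sub>0 real) \<Rightarrow> (nat \<Rightarrow>\<^sub>0 real) \<Rightarrow> 'z \<Rightarrow> (nat \<Rightarrow>\<^sub>0 real)"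
where
  "zo_grad p G \<delta> x u z = (p * (G (x + \<delta> *\<^sub>R u) z - G x z) / \<delta>) *\<^sub>R u"

text \<open>
  Iterates along one realisation \<open>u\<close>, \<open>z\<close> of the random draws; \<open>zo_iter \<dots> k i\<close> is \<open>x\<^sub>i\<^sub>,\<^sub>k\<close>.
\<close>

primrec zo_iter ::
  "nat \<Rightarrow> nat \<Rightarrow> (nat \<Rightarrow> nat \<Rightarrow> real) \<Rightarrow> (nat \<Rightarrow> (nat \<Rightarrow>\<^sub>0 real) \<Rightarrow> 'z \<Rightarrow> real) \<Rightarrow>
   real \<Rightarrow> (nat \<Rightarrow> real) \<Rightarrow> (nat \<Rightarrow> nat \<Rightarrow> real) \<Rightarrow> (nat \<Rightarrow> (nat \<Rightarrow>\<^sub>0 real)) \<Rightarrow>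
   (nat \<Rightarrow> nat \<Rightarrow> (nat \<Rightarrow>\<^sub>0 real)) \<Rightarrow> (nat \<Rightarrow> nat \<Rightarrow> 'z) \<Rightarrow> nat \<Rightarrow> nat \<Rightarrow> (nat \<Rightarrow>\<^sub>0 real)"
where
  "zo_iter p n a F \<gamma> \<eta> \<delta> x0 u z 0 = x0"
| "zo_iter p n a F \<gamma> \<eta> \<delta> x0 u z (Suc k) =
     (let x = zo_iter p n a F \<gamma> \<eta> \<delta> x0 u z k in
      (\<lambda>i. x i - \<gamma> *\<^sub>R (\<Sum>j<n. (laplacian n a $$ (i, j)) *\<^sub>R x j)
               - \<eta> k *\<^sub>R zo_grad p (F i) (\<delta> i k) (x i) (u i k) (z i k)))"

text \<open>
  Mutual independence is stated for the generated \<open>\<sigma>\<close>-algebras, which is what \<open>indep_vars\<close>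
  unfolds to, because the two families of draws take values in different types.
\<close>

definition random_draws ::
  "'w measure \<Rightarrow> nat \<Rightarrow> nat \<Rightarrow> (nat \<Rightarrow> 'z measure) \<Rightarrow>
   (nat \<Rightarrow> nat \<Rightarrow> 'w \<Rightarrow> (nat \<Rightarrow>\<^sub>0 real)) \<Rightarrow> (nat \<Rightarrow> nat \<Rightarrow> 'w \<Rightarrow> 'z) \<Rightarrow> bool"
where
  "random_draws M p n D u \<xi> \<longleftrightarrow>
     prob_space M \<and>
     (\<forall>i<n. \<forall>k.
        u i k \<in> measurable M (euclid_borel p) \<and>
        distr M (euclid_borel p) (u i k) = uniform_sphere p \<and>
        \<xi> i k \<in> measurable M (D i) \<and>
        distr M (D i) (\<xi> i k) = D i) \<and>
     prob_space.indep_sets M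
       (case_sum
          (\<lambda>(i, k). sets (vimage_algebra (space M) (u i k) (euclid_borel p)))
          (\<lambda>(i, k). sets (vimage_algebra (space M) (\<xi> i k) (D i))))
       (({..<n} \<times> UNIV) <+> ({..<n} \<times> UNIV))"

definition average :: "nat \<Rightarrow> (nat \<Rightarrow> (nat \<Rightarrow>\<^sub>0 real)) \<Rightarrow> (nat \<Rightarrow>\<^sub>0 real)" where
  "average n x = (1 / real n) *\<^sub>R (\<Sum>i<n. x i)"

definition consensus_error :: "nat \<Rightarrow> (nat \<Rightarrow> (nat \<Rightarrow>\<^sub>0 real)) \<Rightarrow> real" where
  "consensus_error n x = (\<Sum>i<n. (norm (x i - average n x))\<^sup>2) / n"


section \<open>Step-size constants\<close>

text \<open>The arguments \<open>r\<close> and \<open>s\<close> stand for \<open>\<rho>\<^sub>2(L)\<close> and \<open>\<rho>(L\<^sup>2)\<close>.\<close>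

definition d1 :: "real \<Rightarrow> real \<Rightarrow> real" where
  "d1 r s = r / (2 * s)"

definition eps1 :: "real \<Rightarrow> real \<Rightarrow> real \<Rightarrow> real" where
  "eps1 r s \<gamma> = (1/2) * \<gamma> * r - \<gamma>\<^sup>2 * s"

definition eps2 :: "real \<Rightarrow> real \<Rightarrow> real" where
  "eps2 r \<gamma> = (1 + 2 * \<gamma> * r) / (2 * \<gamma> * r)"

definition d2 :: "nat \<Rightarrow> real \<Rightarrow> real \<Rightarrow> real \<Rightarrow> real \<Rightarrow> real \<Rightarrow> real \<Rightarrow> real" where
  "d2 p Lf \<sigma>0 \<tau>0 r s \<gamma> =
     min (4 * eps1 r s \<gamma> / (9 * Lf\<^sup>2))
         (1 / (64 * p * (1 + \<sigma>0\<^sup>2) * (1 + \<tau>0\<^sup>2) * (2 * eps2 r \<gamma> + Lf)))"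

definition d2_hat :: "nat \<Rightarrow> real \<Rightarrow> real \<Rightarrow> real \<Rightarrow> real \<Rightarrow> real \<Rightarrow> real \<Rightarrow> real \<Rightarrow> real" where
  "d2_hat p Lf \<sigma>0 \<tau>0 \<kappa>\<eta> r s \<gamma> = max (1 / eps1 r s \<gamma>) (\<kappa>\<eta> / d2 p Lf \<sigma>0 \<tau>0 r s \<gamma>)"

end

theory Submission
  imports Defs
begin

text \<open>
  Let \<open>V\<close> be the consensus error and \<open>\<phi>\<close> the optimality gap of the mean iterate. On the orthogonal
  complement of the constant vectors the gossip step contracts, so \<open>V\<close> decreases by a factor
  \<open>1 - O(\<gamma> \<rho>\<^sub>2(L))\<close> up to an \<open>O(\<eta>\<^sup>2)\<close> multiple of the second moments of the estimators. The descent
  lemma for \<open>f\<close> at the mean iterate gives a decrease of \<open>\<phi>\<close> by a multiple of \<open>\<eta> \<parallel>\<nabla>f\<parallel>\<^sup>2\<close> up to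
  \<open>O(\<eta> V)\<close>, the squared bias of the estimators and \<open>\<eta>\<^sup>2 / n\<close> times their second moments; independence of the
  agents is responsible for the factor \<open>1 / n\<close>. The step size condition makes \<open>\<phi> + V\<close> bounded,
  hence \<open>V = O(p / k\<^sup>2)\<close>, and the Polyak-Lojasiewicz inequality turns the recursion for \<open>\<phi>\<close> into
  \<open>\<phi>\<^sub>k\<^sub>+\<^sub>1 \<le> (1 - 4 / (k + t\<^sub>1)) \<phi>\<^sub>k + O(p / n) / (k + t\<^sub>1)\<^sup>2 + O(p) / (k + t\<^sub>1)\<^sup>3\<close>, whose
  leading constant does not see the network.

  Rates that are linear in \<open>p\<close> need a bias bound \<open>L\<^sub>f \<delta>\<close> without any power of \<open>p\<close>. It is obtained
  without the divergence theorem, from the invariance of the sphere under reflections.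
\<close>

section \<open>Finitely supported sequences and smooth functions on \<open>\<real>\<^sup>p\<close>\<close>

text \<open>The second moments of the estimators contain the squared gradient at the mean iterate,
  so no rate for \<open>V\<close> can be read off its recursion alone: the gradient has to be
  bounded first, and that needs \<open>\<phi>\<close>, whose recursion contains \<open>V\<close>.
  This circle is broken by the sum \<open>\<phi> + V\<close>, in which the descent of
  \<open>\<phi>\<close> pays for the gradient in \<open>V\<close> and the contraction of
  \<open>V\<close> pays for the disagreement in \<open>\<phi>\<close>; the constants of
  \<open>d2\<close> are sized for these two payments. The bound on the sum contains no
  \<open>p\<close>, since the step-size condition bounds \<open>p * \<eta>\<close>. The radius
  \<delta> is used twice: its square is O(\<eta> p / n), which keeps the bias within the leading
  term, and p^2 \<delta>^2 is O(p), which keeps the second moments linear in \<open>p\<close>.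
  Conditional expectations are replaced by product laws: the draws of one agent at one iteration are
  independent of all remaining draws, so the rest can be frozen and Fubini applied. Finitely
  supported sequences are not complete, hence vector-valued means are formed coordinate by
  coordinate and estimated through inner products.\<close>

lemma norm_sum_sq_le: "(norm (x + y))\<^sup>2 \<le> 2 * (norm x)\<^sup>2 + 2 * (norm (y :: 'a::real_inner))\<^sup>2"
proof -
  have "(norm (x + y))\<^sup>2 \<le> (norm x + norm y)\<^sup>2" by (intro power_mono norm_triangle_ineq) simp
  also have "\<dots> \<le> 2 * (norm x)\<^sup>2 + 2 * (norm y)\<^sup>2"
    using sum_squares_bound[of "norm x" "norm y"] by (simp add: power2_sum)
  finally show ?thesis .
qed

lemma norm_single: "norm (Poly_Mapping.single k (b :: 'b::real_inner)) = norm b"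
  unfolding norm_eq_sqrt_inner[of "Poly_Mapping.single k b"]
  by (subst inner_poly_mapping_superset[of "{k}"]) (auto simp: norm_eq_sqrt_inner)

text \<open>Sums and inner products of random vectors are measurable by way of pairs, which requires
  a countable base of the topology. Finite sums of \<open>Poly_Mapping.single k d\<close> with
  \<open>d\<close> from a countable dense set are dense, and the balls of radius 1 / (m + 1) around
  them form the base.\<close>

instance poly_mapping :: (countable, "{real_inner, second_countable_topology}") second_countable_topology
proof
  obtain D0 :: "'b set" where D0: "countable D0" "\<And>X. open X \<Longrightarrow> X \<noteq> {} \<Longrightarrow> \<exists>d\<in>D0. d \<in> X"
    by (rule countable_dense_setE) auto
  define C :: "('a \<Rightarrow>\<^sub>0 'b) set" where
    "C = (\<lambda>xs. sum_list (map (\<lambda>(k, d). Poly_Mapping.single k d) xs)) ` lists (UNIV \<times> D0)"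
  have cC: "countable C"
    unfolding C_def by (intro countable_image countable_lists countable_SIGMA) (auto simp: D0)
  have appr: "\<exists>c\<in>C. norm ((\<Sum>k\<in>K. Poly_Mapping.single k (g k)) - c) < e"
    if "finite K" "0 < e" for K :: "'a set" and g :: "'a \<Rightarrow> 'b" and e :: real
    using that
  proof (induction K arbitrary: e rule: finite_induct)
    case empty
    have "sum_list (map (\<lambda>(k, d). Poly_Mapping.single k d) []) \<in> C"
      unfolding C_def by (rule imageI) simp
    then show ?case using empty by (intro bexI[of _ 0]) simp_all
  next
    case (insert k K)
    obtain c where c: "c \<in> C" "norm ((\<Sum>k\<in>K. Poly_Mapping.single k (g k)) - c) < e / 2"
      using insert.IH[of "e/2"] insert.prems by auto
    obtain d where d: "d \<in> D0" "dist (g k) d < e / 2"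
      using D0(2)[of "ball (g k) (e/2)"] insert.prems by auto
    obtain xs where xs: "xs \<in> lists (UNIV \<times> D0)" "c = sum_list (map (\<lambda>(k, d). Poly_Mapping.single k d) xs)"
      using c(1) unfolding C_def by auto
    have "sum_list (map (\<lambda>(k, d). Poly_Mapping.single k d) ((k, d) # xs)) \<in> C"
      unfolding C_def by (rule imageI) (use xs d in auto)
    then have "Poly_Mapping.single k d + c \<in> C" by (simp add: xs)
    moreover have "(\<Sum>k\<in>insert k K. Poly_Mapping.single k (g k)) - (Poly_Mapping.single k d + c)
        = Poly_Mapping.single k (g k - d) + ((\<Sum>k\<in>K. Poly_Mapping.single k (g k)) - c)"
      using insert.hyps by (simp add: single_diff)
    then have "norm ((\<Sum>k\<in>insert k K. Poly_Mapping.single k (g k)) - (Poly_Mapping.single k d + c))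
        \<le> norm (g k - d) + norm ((\<Sum>k\<in>K. Poly_Mapping.single k (g k)) - c)"
      by (metis norm_single norm_triangle_ineq)
    then have "norm ((\<Sum>k\<in>insert k K. Poly_Mapping.single k (g k)) - (Poly_Mapping.single k d + c)) < e"
      using c(2) d(2) by (simp add: dist_norm)
    ultimately show ?case by blast
  qed
  have dense: "\<exists>c\<in>C. dist x c < e" if pos: "0 < e" for x :: "'a \<Rightarrow>\<^sub>0 'b" and e
  proof -
    define S where "S = (\<Sum>k\<in>Poly_Mapping.keys x. Poly_Mapping.single k (Poly_Mapping.lookup x k))"
    have x: "S = x"
      unfolding S_def by (rule poly_mapping_eqI) (auto simp: lookup_sum lookup_single when_def in_keys_iff)
    obtain c where c: "c \<in> C" "norm (S - c) < e"
      using appr[OF finite_keys pos] unfolding S_def by blast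
    then show ?thesis unfolding x by (auto simp: dist_norm)
  qed
  define B where "B = (\<lambda>(c, m::nat). ball c (1 / real (Suc m))) ` (C \<times> UNIV)"
  have "countable B" unfolding B_def using cC by (intro countable_image countable_SIGMA) auto
  moreover have "topological_basis B"
  proof (rule topological_basisI)
    fix b assume "b \<in> B" then show "open b" by (auto simp: B_def)
  next
    fix U :: "('a \<Rightarrow>\<^sub>0 'b) set" and x assume "open U" "x \<in> U"
    then obtain e where e: "0 < e" "ball x e \<subseteq> U" using open_contains_ball by blast
    obtain m where m: "1 / real (Suc m) < e / 2"
      using reals_Archimedean[of "e/2"] e by (auto simp: inverse_eq_divide)
    obtain c where c: "c \<in> C" "dist x c < 1 / real (Suc m)" using dense[of "1 / real (Suc m)" x] by auto
    have "ball c (1 / real (Suc m)) \<subseteq> ball x e"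
    proof
      fix y assume "y \<in> ball c (1 / real (Suc m))"
      then have "dist c y < e / 2" using m by simp
      moreover have "dist x y \<le> dist x c + dist c y" by (rule dist_triangle)
      ultimately show "y \<in> ball x e" using c m by simp
    qed
    then show "\<exists>B'\<in>B. x \<in> B' \<and> B' \<subseteq> U"
      using e c by (intro bexI[of _ "ball c (1 / real (Suc m))"]) (auto simp: B_def dist_commute)
  qed
  ultimately show "\<exists>B::('a \<Rightarrow>\<^sub>0 'b) set set. countable B \<and> open = generate_topology B"
    using topological_basis_imp_subbasis by blast
qed

lemma norm_lookup_le: "norm (Poly_Mapping.lookup x k) \<le> norm (x :: 'a \<Rightarrow>\<^sub>0 'b::real_inner)"
proof -
  have "inner x x = (\<Sum>j\<in>insert k (Poly_Mapping.keys x). inner (Poly_Mapping.lookup x j) (Poly_Mapping.lookup x j))"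
    by (rule inner_poly_mapping_superset) auto
  also have "\<dots> \<ge> inner (Poly_Mapping.lookup x k) (Poly_Mapping.lookup x k)"
    by (rule member_le_sum) auto
  finally show ?thesis by (simp add: norm_eq_sqrt_inner)
qed

lemma bounded_linear_single:
  "bounded_linear (Poly_Mapping.single k :: 'b::real_inner \<Rightarrow> 'a \<Rightarrow>\<^sub>0 'b)"
  by (rule bounded_linear_intro[where K = 1])
    (auto simp: single_add norm_single scaleR_poly_mapping.rep_eq lookup_single when_def intro!: poly_mapping_eqI)

lemma borel_measurable_of_coords:
  assumes "\<And>i. i < p \<Longrightarrow> (\<lambda>\<omega>. f \<omega> i) \<in> borel_measurable M"
  shows "(\<lambda>\<omega>. of_coords p (f \<omega>)) \<in> borel_measurable M"
  unfolding of_coords_def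
  by (intro borel_measurable_sum measurable_compose[OF assms] borel_measurable_continuous_onI
      linear_continuous_on bounded_linear_single) auto

lemma space_euclid_borel[simp]: "space (euclid_borel p) = euclid p"
  by (simp add: euclid_borel_def space_restrict_space)

lemma measurable_euclid_borel_iff:
  "f \<in> measurable M (euclid_borel p) \<longleftrightarrow> f \<in> borel_measurable M \<and> (\<forall>x\<in>space M. f x \<in> euclid p)"
  unfolding euclid_borel_def by (subst measurable_restrict_space2_iff) auto

lemma measurable_euclid_borelD[measurable_dest]:
  "f \<in> measurable M (euclid_borel p) \<Longrightarrow> f \<in> borel_measurable M"
  by (simp add: measurable_euclid_borel_iff)

lemma measurable_of_coords:
  assumes "\<And>i. i < p \<Longrightarrow> (\<lambda>\<omega>. f \<omega> i) \<in> borel_measurable M"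
  shows "(\<lambda>\<omega>. of_coords p (f \<omega>)) \<in> measurable M (euclid_borel p)"
  using borel_measurable_of_coords[OF assms] by (simp add: measurable_euclid_borel_iff of_coords_in_euclid)

lemma of_coords_lookup: "x \<in> euclid p \<Longrightarrow> of_coords p (Poly_Mapping.lookup x) = x"
  by (intro poly_mapping_eqI) (auto simp: lookup_of_coords euclid_def in_keys_iff)

lemmas euclid_0[simp] = real_vector.subspace_0[OF subspace_euclid]
lemmas euclid_add = real_vector.subspace_add[OF subspace_euclid]
lemmas euclid_diff = real_vector.subspace_diff[OF subspace_euclid]
lemmas euclid_scaleR = real_vector.subspace_scale[OF subspace_euclid]
lemmas euclid_sum = real_vector.subspace_sum[OF subspace_euclid]

section \<open>Smooth functions on the coordinate subspace\<close>

context
  fixes p l f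
  assumes sm: "smooth p l f"
begin

lemma smooth_grad_in: "x \<in> euclid p \<Longrightarrow> grad p f x \<in> euclid p"
  using sm grad_exists(1)[of x p f] by (simp add: smooth_def differentiable_on_def)

lemma smooth_has_derivative:
  "x \<in> euclid p \<Longrightarrow> (f has_derivative (\<lambda>h. inner (grad p f x) h)) (at x within euclid p)"
  using sm grad_exists(2)[of x p f] by (simp add: smooth_def differentiable_on_def)

lemma smooth_nonneg: "0 \<le> l"
  using sm lipschitz_on_nonneg by (auto simp: smooth_def)

lemma smooth_lipschitz:
  "x \<in> euclid p \<Longrightarrow> y \<in> euclid p \<Longrightarrow> norm (grad p f x - grad p f y) \<le> l * norm (x - y)"
  using sm lipschitz_onD[of l "euclid p" "grad p f" x y] by (simp add: smooth_def dist_norm)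

lemma smooth_continuous_on: "continuous_on (euclid p) f"
  by (rule has_derivative_continuous_on[OF smooth_has_derivative])

lemma smooth_continuous_on_grad: "continuous_on (euclid p) (grad p f)"
  using sm unfolding smooth_def by (blast intro: lipschitz_on_continuous_on)

lemma smooth_measurable: "f \<in> borel_measurable (euclid_borel p)"
  unfolding euclid_borel_def by (rule borel_measurable_continuous_on_restrict[OF smooth_continuous_on])

lemma smooth_measurable_grad: "grad p f \<in> measurable (euclid_borel p) (euclid_borel p)"
  unfolding measurable_euclid_borel_iff
  using borel_measurable_continuous_on_restrict[OF smooth_continuous_on_grad]
  by (simp add: euclid_borel_def smooth_grad_in space_restrict_space)

text \<open>The derivative within \<open>euclid p\<close> may be restricted to a line, and the
  parameter of the line runs through all reals. One-variable calculus thus applies to a function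
  that is differentiable relative to the subspace.\<close>

lemma smooth_line_derivative:
  assumes x: "x \<in> euclid p" and d: "d \<in> euclid p"
  shows "((\<lambda>t. f (x + t *\<^sub>R d)) has_real_derivative inner (grad p f (x + t *\<^sub>R d)) d) (at t)"
proof -
  have in_e: "x + t *\<^sub>R d \<in> euclid p" for t
    by (intro euclid_add euclid_scaleR x d)
  have "((\<lambda>t. x + t *\<^sub>R d) has_derivative (\<lambda>t. t *\<^sub>R d)) (at t)"
    by (auto intro!: derivative_eq_intros)
  moreover have "(f has_derivative (\<lambda>h. inner (grad p f (x + t *\<^sub>R d)) h))
      (at (x + t *\<^sub>R d) within range (\<lambda>t. x + t *\<^sub>R d))"
    using smooth_has_derivative[OF in_e] by (rule has_derivative_subset) (use in_e in auto)
  ultimately have "((\<lambda>t. f (x + t *\<^sub>R d)) has_derivative (\<lambda>h. inner (grad p f (x + t *\<^sub>R d)) (h *\<^sub>R d))) (at t)"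
    by (rule has_derivative_in_compose[where f = "\<lambda>t. x + t *\<^sub>R d" and g = f])
  then show ?thesis
    by (simp add: has_field_derivative_def mult.commute[of _ "inner _ _"] cong: if_cong)
qed

lemma smooth_mvt:
  assumes x: "x \<in> euclid p" and y: "y \<in> euclid p"
  shows "\<exists>t>0. t < 1 \<and> f y - f x = inner (grad p f (x + t *\<^sub>R (y - x))) (y - x)"
  using MVT2[of 0 1 "\<lambda>t. f (x + t *\<^sub>R (y - x))" "\<lambda>t. inner (grad p f (x + t *\<^sub>R (y - x))) (y - x)"]
    smooth_line_derivative[OF x euclid_diff[OF y x]] by auto

lemma smooth_quadratic_bound:
  assumes x: "x \<in> euclid p" and y: "y \<in> euclid p"
  shows "\<bar>f y - f x - inner (grad p f x) (y - x)\<bar> \<le> l / 2 * (norm (y - x))\<^sup>2"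
proof -
  define d where "d = y - x"
  have d: "d \<in> euclid p" using x y by (simp add: d_def euclid_diff)
  \<comment> \<open>The sign \<open>s\<close> treats the upper and the lower bound together: the
    Lipschitz bound makes the auxiliary function \<open>h\<close> nonincreasing on [0, 1].\<close>
  have main: "s * (f y - f x - inner (grad p f x) d) \<le> l / 2 * (norm d)\<^sup>2" if s: "\<bar>s\<bar> = 1" for s :: real
  proof -
    define h where "h t = s * (f (x + t *\<^sub>R d) - t * inner (grad p f x) d) - l / 2 * t\<^sup>2 * (norm d)\<^sup>2" for t :: real
    define h' where "h' t = s * (inner (grad p f (x + t *\<^sub>R d)) d - inner (grad p f x) d) - l * t * (norm d)\<^sup>2" for t :: real
    have der: "(h has_real_derivative h' t) (at t)" for t
      unfolding h_def h'_def
      by (rule derivative_eq_intros smooth_line_derivative[OF x d] refl | simp)+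
    have "h 1 \<le> h 0"
    proof (rule DERIV_nonpos_imp_nonincreasing[of 0 1 h])
      fix t :: real assume t: "0 \<le> t" "t \<le> 1"
      have "s * (inner (grad p f (x + t *\<^sub>R d)) d - inner (grad p f x) d)
          \<le> \<bar>inner (grad p f (x + t *\<^sub>R d) - grad p f x) d\<bar>"
        using s by (simp add: inner_diff_left abs_if split: if_splits)
      also have "\<dots> \<le> norm (grad p f (x + t *\<^sub>R d) - grad p f x) * norm d"
        by (rule Cauchy_Schwarz_ineq2)
      also have "\<dots> \<le> (l * norm (t *\<^sub>R d)) * norm d"
        using smooth_lipschitz[of "x + t *\<^sub>R d" x] x d
        by (intro mult_right_mono) (simp_all add: euclid_add euclid_scaleR)
      also have "\<dots> = l * t * (norm d)\<^sup>2" using t by (simp add: power2_eq_square)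
      finally have "h' t \<le> 0" by (simp add: h'_def)
      then show "\<exists>y. DERIV h t :> y \<and> y \<le> 0" using der by blast
    qed simp
    then show ?thesis by (simp add: h_def d_def algebra_simps)
  qed
  have "f y - f x - inner (grad p f x) d \<le> l / 2 * (norm d)\<^sup>2"
    "- (f y - f x - inner (grad p f x) d) \<le> l / 2 * (norm d)\<^sup>2"
    using main[of 1] main[of "-1"] by simp_all
  then show ?thesis unfolding d_def by linarith
qed

text \<open>Growth is at most quadratic, which reduces integrability of gradients (here) and of
  function values (next lemma) along the iteration to second moments of the iterates.\<close>

lemma smooth_growth_grad: "x \<in> euclid p \<Longrightarrow> (norm (grad p f x))\<^sup>2 \<le> 2 * (norm (grad p f 0))\<^sup>2 + 2 * l\<^sup>2 * (norm x)\<^sup>2"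
proof -
  assume x: "x \<in> euclid p"
  have "(norm (grad p f x - grad p f 0))\<^sup>2 \<le> (l * norm x)\<^sup>2"
    using smooth_lipschitz[OF x, of 0] by (intro power_mono) auto
  then show ?thesis
    using norm_sum_sq_le[of "grad p f 0" "grad p f x - grad p f 0"] by (simp add: power_mult_distrib)
qed

lemma smooth_growth:
  assumes x: "x \<in> euclid p"
  shows "\<bar>f x\<bar> \<le> \<bar>f 0\<bar> + (norm (grad p f 0))\<^sup>2 + (l + 1) * (norm x)\<^sup>2"
proof -
  have "\<bar>f x - f 0 - inner (grad p f 0) x\<bar> \<le> l / 2 * (norm x)\<^sup>2"
    using smooth_quadratic_bound[of 0 x] x by simp
  moreover have "\<bar>inner (grad p f 0) x\<bar> \<le> norm (grad p f 0) * norm x" by (rule Cauchy_Schwarz_ineq2)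
  moreover have "norm (grad p f 0) * norm x \<le> (norm (grad p f 0))\<^sup>2 + (norm x)\<^sup>2"
    using sum_squares_bound[of "norm (grad p f 0)" "norm x"] zero_le_power2[of "norm (grad p f 0)"]
      zero_le_power2[of "norm x"] by linarith
  moreover have "l / 2 * (norm x)\<^sup>2 \<le> l * (norm x)\<^sup>2" using smooth_nonneg by (simp add: mult_right_mono)
  ultimately show ?thesis unfolding distrib_right mult_1_left by linarith
qed

text \<open>A gradient step of length \<open>1 / l\<close> lowers \<open>f\<close> by at least |g|^2
  / (2 l), and \<open>f\<close> cannot fall below its infimum. This bounds gradients by gaps,
  opposite to the Polyak-Lojasiewicz inequality.\<close>

lemma norm_grad_le_gap:
  assumes x: "x \<in> euclid p" and l: "0 < l" and bdd: "bdd_below (f ` euclid p)"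
  shows "(norm (grad p f x))\<^sup>2 \<le> 2 * l * (f x - min_value p f)"
proof -
  define g where "g = grad p f x"
  define y where "y = x - (1 / l) *\<^sub>R g"
  have y: "y \<in> euclid p" unfolding y_def g_def by (intro euclid_diff euclid_scaleR x smooth_grad_in)
  have "min_value p f \<le> f y" unfolding min_value_def by (rule cINF_lower[OF bdd y])
  moreover have "f y - f x - inner g (y - x) \<le> l / 2 * (norm (y - x))\<^sup>2"
    using smooth_quadratic_bound[OF x y] unfolding g_def by linarith
  moreover have "inner g (y - x) = - ((norm g)\<^sup>2 / l)"
    by (simp add: y_def power2_norm_eq_inner)
  moreover have "l / 2 * (norm (y - x))\<^sup>2 = (norm g)\<^sup>2 / (2 * l)"
    using l by (simp add: y_def power_divide power2_eq_square)
  ultimately have "(norm g)\<^sup>2 / l - (norm g)\<^sup>2 / (2 * l) \<le> f x - min_value p f" by linarith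
  moreover have "(norm g)\<^sup>2 / l - (norm g)\<^sup>2 / (2 * l) = (norm g)\<^sup>2 / (2 * l)" using l by (simp add: field_simps)
  ultimately show ?thesis using l by (simp add: g_def field_simps)
qed

end

text \<open>A quadratic remainder estimate with a candidate \<open>G\<close> already contains
  differentiability and identifies the gradient. Averages and expectations inherit such an estimate,
  so derivatives never have to be exchanged with sums or integrals.\<close>

lemma
  assumes l: "0 \<le> l" and G: "\<And>x. x \<in> euclid p \<Longrightarrow> G x \<in> euclid p"
    and quad: "\<And>x y. x \<in> euclid p \<Longrightarrow> y \<in> euclid p \<Longrightarrow> \<bar>f y - f x - inner (G x) (y - x)\<bar> \<le> l / 2 * (norm (y - x))\<^sup>2"
    and lip: "\<And>x y. x \<in> euclid p \<Longrightarrow> y \<in> euclid p \<Longrightarrow> norm (G x - G y) \<le> l * norm (x - y)"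
  shows smooth_quadraticI: "smooth p l f"
    and grad_quadratic_eq: "x \<in> euclid p \<Longrightarrow> grad p f x = G x"
proof -
  have der: "(f has_derivative (\<lambda>h. inner (G x) h)) (at x within euclid p)" if x: "x \<in> euclid p" for x
  proof (rule has_derivativeI_sandwich[where e = 1 and H = "\<lambda>y. l / 2 * norm (y - x)"])
    show "bounded_linear (inner (G x))" by (rule bounded_linear_inner_right)
    fix y assume y: "y \<in> euclid p" "y \<noteq> x"
    then show "norm (f y - f x - inner (G x) (y - x)) / norm (y - x) \<le> l / 2 * norm (y - x)"
      using quad[OF x y(1)] by (simp add: divide_le_eq power2_eq_square)
  next
    have "((\<lambda>y. l / 2 * norm (y - x)) \<longlongrightarrow> l / 2 * norm (x - x)) (at x within euclid p)"
      by (intro tendsto_intros)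
    then show "((\<lambda>y. l / 2 * norm (y - x)) \<longlongrightarrow> 0) (at x within euclid p)" by simp
  qed simp
  show eq: "grad p f x = G x" if "x \<in> euclid p" for x
    using that by (intro grad_eqI G der)
  show "smooth p l f"
    unfolding smooth_def
  proof
    show "f differentiable_on euclid p" using der by (auto simp: differentiable_on_def differentiable_def)
    show "l-lipschitz_on (euclid p) (grad p f)"
      by (rule lipschitz_onI) (use lip l in \<open>auto simp: eq dist_norm\<close>)
  qed
qed

lemma
  assumes sm: "\<And>i. i < n \<Longrightarrow> smooth p l (f i)" and n: "1 \<le> (n::nat)"
  shows smooth_average: "smooth p l (\<lambda>x. (\<Sum>i<n. f i x) / n)"
    and grad_average: "x \<in> euclid p \<Longrightarrow> grad p (\<lambda>x. (\<Sum>i<n. f i x) / n) x = (1 / n) *\<^sub>R (\<Sum>i<n. grad p (f i) x)"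
proof -
  define G where "G x = (1 / n) *\<^sub>R (\<Sum>i<n. grad p (f i) x)" for x
  have l: "0 \<le> l" using sm[of 0] n smooth_nonneg by simp
  have G: "G x \<in> euclid p" if "x \<in> euclid p" for x
    unfolding G_def by (intro euclid_scaleR euclid_sum smooth_grad_in[OF sm] that) auto
  have quad: "\<bar>(\<Sum>i<n. f i y) / n - (\<Sum>i<n. f i x) / n - inner (G x) (y - x)\<bar> \<le> l / 2 * (norm (y - x))\<^sup>2"
    if "x \<in> euclid p" "y \<in> euclid p" for x y
  proof -
    have "(\<Sum>i<n. f i y) / n - (\<Sum>i<n. f i x) / n - inner (G x) (y - x)
        = (\<Sum>i<n. f i y - f i x - inner (grad p (f i) x) (y - x)) / n"
      by (simp add: G_def sum_subtractf inner_sum_left diff_divide_distrib)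
    also have "\<bar>\<dots>\<bar> = \<bar>\<Sum>i<n. f i y - f i x - inner (grad p (f i) x) (y - x)\<bar> / n" by simp
    also have "\<dots> \<le> (\<Sum>i<n. l / 2 * (norm (y - x))\<^sup>2) / n"
      by (intro divide_right_mono order_trans[OF sum_abs] sum_mono smooth_quadratic_bound[OF sm that]) auto
    also have "\<dots> = l / 2 * (norm (y - x))\<^sup>2" using n by simp
    finally show ?thesis .
  qed
  have lip: "norm (G x - G y) \<le> l * norm (x - y)" if "x \<in> euclid p" "y \<in> euclid p" for x y
  proof -
    have "norm (G x - G y) = norm (\<Sum>i<n. grad p (f i) x - grad p (f i) y) / n"
      by (simp add: G_def sum_subtractf flip: scaleR_diff_right)
    also have "\<dots> \<le> (\<Sum>i<n. l * norm (x - y)) / n"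
      by (intro divide_right_mono sum_norm_le smooth_lipschitz[OF sm] that) auto
    also have "\<dots> = l * norm (x - y)" using n by simp
    finally show ?thesis .
  qed
  show "smooth p l (\<lambda>x. (\<Sum>i<n. f i x) / n)" by (rule smooth_quadraticI[OF l G quad lip])
  show "grad p (\<lambda>x. (\<Sum>i<n. f i x) / n) x = (1 / n) *\<^sub>R (\<Sum>i<n. grad p (f i) x)" if "x \<in> euclid p"
    using grad_quadratic_eq[OF l G quad lip that] by (simp add: G_def)
qed

section \<open>The uniform distribution on the sphere\<close>

definition measure_preserving :: "'a measure \<Rightarrow> ('a \<Rightarrow> 'a) \<Rightarrow> bool" where
  "measure_preserving P T \<longleftrightarrow> T \<in> measurable P P \<and> distr P P T = P"

lemma measure_preserving_comp:
  assumes "measure_preserving P S" "measure_preserving P T"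
  shows "measure_preserving P (\<lambda>y. S (T y))"
proof -
  have m: "S \<in> measurable P P" "T \<in> measurable P P" using assms by (auto simp: measure_preserving_def)
  have "distr P P (\<lambda>y. S (T y)) = distr (distr P P T) P S"
    by (subst distr_distr) (use m in \<open>auto simp: comp_def\<close>)
  then show ?thesis using assms m by (auto simp: measure_preserving_def)
qed

lemma measure_preserving_cong:
  assumes "measure_preserving P S" "\<And>y. y \<in> space P \<Longrightarrow> S y = T y"
  shows "measure_preserving P T"
proof -
  have "distr P P S = distr P P T" by (rule distr_cong) (use assms in auto)
  moreover have "S \<in> measurable P P \<longleftrightarrow> T \<in> measurable P P" by (rule measurable_cong) (use assms in auto)
  ultimately show ?thesis using assms by (simp add: measure_preserving_def)
qed

text \<open>Fubini with the coordinate \<open>j\<close> innermost: the remaining coordinates fix the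
  value of \<phi>, and what is left is the affine map t -> c t + \<phi> of the line, with |c| =
  1.\<close>

lemma measure_preserving_shear:
  fixes I :: "'i set" and \<phi> :: "('i \<Rightarrow> real) \<Rightarrow> real"
  assumes fin: "finite I" and j: "j \<in> I" and c: "\<bar>c\<bar> = 1"
    and meas: "\<phi> \<in> borel_measurable (PiM I (\<lambda>_. lborel))"
    and inv: "\<And>y t. \<phi> (y(j := t)) = \<phi> y"
  shows "measure_preserving (PiM I (\<lambda>_. lborel)) (\<lambda>y. y(j := c * y j + \<phi> y))"
proof -
  interpret product_sigma_finite "\<lambda>_::'i. lborel :: real measure" by standard
  define P where "P = PiM I (\<lambda>_::'i. lborel :: real measure)"
  define J where "J = I - {j}"
  have I: "I = insert j J" "finite J" "j \<notin> J" using fin j by (auto simp: J_def)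
  define T where "T y = y(j := c * y j + \<phi> y)" for y
  have [measurable]: "(\<lambda>y. y i) \<in> borel_measurable P" if "i \<in> I" for i
    unfolding P_def using measurable_component_singleton[OF that, of "\<lambda>_. lborel"] by simp
  have [measurable]: "\<phi> \<in> borel_measurable P" using meas by (simp add: P_def)
  \<comment> \<open>Points of the product space are extensional, so the update agrees there with a
    tuple whose components are visibly measurable.\<close>
  have "(\<lambda>y. \<lambda>i\<in>I. if i = j then c * y j + \<phi> y else y i) \<in> measurable P P"
    unfolding P_def[symmetric] by (subst (2) P_def, rule measurable_restrict) (use j in \<open>auto intro!: borel_measurable_add borel_measurable_times\<close>)
  also have "?this \<longleftrightarrow> T \<in> measurable P P"
    by (rule measurable_cong) (use j in \<open>auto simp: T_def P_def space_PiM PiE_def extensional_def fun_eq_iff\<close>)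
  finally have Tm[measurable]: "T \<in> measurable P P" .
  have "distr P P T = P"
  proof (rule measure_eqI)
    fix A assume "A \<in> sets (distr P P T)"
    then have A[measurable]: "A \<in> sets P" by simp
    have "emeasure (distr P P T) A = (\<integral>\<^sup>+y. indicator A (T y) \<partial>P)"
      by (simp add: nn_integral_distr flip: nn_integral_indicator)
    also have "\<dots> = (\<integral>\<^sup>+x. (\<integral>\<^sup>+t. indicator A (T (x(j := t))) \<partial>lborel) \<partial>PiM J (\<lambda>_. lborel))"
      unfolding P_def I(1)
      by (rule product_nn_integral_insert) (use I in \<open>auto simp flip: I(1) P_def\<close>)
    also have "\<dots> = (\<integral>\<^sup>+x. (\<integral>\<^sup>+t. indicator A (x(j := t)) \<partial>lborel) \<partial>PiM J (\<lambda>_. lborel))"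
    proof (rule nn_integral_cong)
      fix x assume x: "x \<in> space (PiM J (\<lambda>_::'i. lborel :: real measure))"
      have "(\<lambda>t. x(j := t)) \<in> measurable lborel (PiM (insert j J) (\<lambda>_. lborel))"
        by (rule measurable_component_update[OF x I(3)])
      then have "(\<lambda>t. x(j := t)) \<in> measurable lborel P" by (simp add: P_def I(1))
      from measurable_compose[OF this borel_measurable_indicator[OF A]]
      have [measurable]: "(\<lambda>t. indicator A (x(j := t)) :: ennreal) \<in> borel_measurable borel" by simp
      have "(\<integral>\<^sup>+t. indicator A (x(j := t)) \<partial>lborel) = \<bar>c\<bar> * (\<integral>\<^sup>+t. indicator A (x(j := \<phi> x + c * t)) \<partial>lborel)"
        by (rule nn_integral_real_affine) (use c in auto)
      then show "(\<integral>\<^sup>+t. indicator A (T (x(j := t))) \<partial>lborel) = (\<integral>\<^sup>+t. indicator A (x(j := t)) \<partial>lborel)"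
        using c by (simp add: T_def inv add.commute)
    qed
    also have "\<dots> = (\<integral>\<^sup>+y. indicator A y \<partial>P)"
      unfolding P_def I(1)
      by (rule product_nn_integral_insert[symmetric]) (use I in \<open>auto simp flip: I(1) P_def\<close>)
    finally show "emeasure (distr P P T) A = emeasure P A" by simp
  qed simp
  then show ?thesis using Tm by (simp add: measure_preserving_def P_def T_def[abs_def])
qed

lemma measure_preserving_id: "measure_preserving P (\<lambda>y. y)"
  by (simp add: measure_preserving_def distr_id2)

text \<open>The shears are composed one coordinate at a time; all of them read coordinate
  \<open>i\<close>, which none of them changes.\<close>

lemma measure_preserving_multishear:
  fixes b :: "'i \<Rightarrow> real"
  assumes fin: "finite I" and i: "i \<in> I" and "J \<subseteq> I - {i}"
  shows "measure_preserving (PiM I (\<lambda>_. lborel)) (\<lambda>y c. if c \<in> J then y c + b c * y i else y c)"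
proof -
  have "finite J" using assms by (auto intro: finite_subset)
  then show ?thesis using assms(3)
  proof (induction J rule: finite_induct)
    case empty then show ?case by (simp add: measure_preserving_id)
  next
    case (insert j J)
    have "measure_preserving (PiM I (\<lambda>_. lborel)) (\<lambda>y. y(j := 1 * y j + b j * y i))"
    proof (rule measure_preserving_shear[OF fin])
      show "(\<lambda>y. b j * y i) \<in> borel_measurable (PiM I (\<lambda>_. lborel))"
        using measurable_component_singleton[OF i, of "\<lambda>_. lborel :: real measure"]
        by (intro borel_measurable_times borel_measurable_const) simp
    qed (use insert.prems in auto)
    moreover have "measure_preserving (PiM I (\<lambda>_. lborel)) (\<lambda>y c. if c \<in> J then y c + b c * y i else y c)"
      using insert by auto
    ultimately have "measure_preserving (PiM I (\<lambda>_. lborel))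
        (\<lambda>y. (\<lambda>c. if c \<in> J then y c + b c * y i else y c)
          (j := 1 * (if j \<in> J then y j + b j * y i else y j) + b j * (if i \<in> J then y i + b i * y i else y i)))"
      by (rule measure_preserving_comp)
    then show ?case
      by (rule measure_preserving_cong) (use insert.hyps insert.prems in \<open>auto simp: fun_eq_iff\<close>)
  qed
qed

text \<open>With \<open>w i \<noteq> 0\<close>, the coordinate change that replaces the \<open>i\<close>-th coordinate by \<open>\<langle>w, y\<rangle> / w i\<close>
  turns the reflection into a shear followed by a sign flip; no determinant is needed.\<close>

lemma measure_preserving_reflection:
  fixes w :: "'i \<Rightarrow> real"
  assumes fin: "finite I" and w: "(\<Sum>c\<in>I. (w c)\<^sup>2) = 1"
  shows "measure_preserving (PiM I (\<lambda>_. lborel))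
    (\<lambda>y. \<lambda>c\<in>I. y c - 2 * (\<Sum>d\<in>I. w d * y d) * w c)"
proof -
  obtain i where i: "i \<in> I" "w i \<noteq> 0"
    using w by (metis (mono_tags, lifting) power_zero_numeral sum.neutral zero_neq_one)
  define s where "s y = (\<Sum>d\<in>I - {i}. w d * y d) / w i" for y
  have s_upd: "s (y(i := t)) = s y" for y t unfolding s_def by (intro arg_cong2[where f = divide] sum.cong) auto
  have sm: "s \<in> borel_measurable (PiM I (\<lambda>_. lborel))"
  proof -
    have "(\<lambda>y. y d) \<in> borel_measurable (PiM I (\<lambda>_. lborel :: real measure))" if "d \<in> I - {i}" for d
      using measurable_component_singleton[of d I "\<lambda>_. lborel :: real measure"] that by simp
    then show ?thesis unfolding s_def by (intro borel_measurable_divide borel_measurable_sum borel_measurable_times) auto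
  qed
  \<comment> \<open>Write q for <w, y>. \<open>A\<close> puts q / w i into coordinate
    \<open>i\<close>, \<open>B\<close> subtracts 2 q w c from every other coordinate c,
    \<open>C\<close> changes the sign because the reflection turns q into -q, and \<open>D\<close>
    inverts \<open>A\<close>.\<close>
  define A where "A y = y(i := 1 * y i + s y)" for y
  define B where "B y c = (if c \<in> I - {i} then y c + (- 2 * w c * w i) * y i else y c)" for y c
  define C where "C y = y(i := (-1) * y i + (\<lambda>_. 0) y)" for y :: "'i \<Rightarrow> real"
  define D where "D y = y(i := 1 * y i + - s y)" for y
  have mA: "measure_preserving (PiM I (\<lambda>_. lborel)) A"
    unfolding A_def by (rule measure_preserving_shear[OF fin i(1)]) (use sm s_upd in auto)
  have mB: "measure_preserving (PiM I (\<lambda>_. lborel)) B"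
    unfolding B_def by (rule measure_preserving_multishear[OF fin i(1)]) auto
  have mC: "measure_preserving (PiM I (\<lambda>_. lborel)) C"
    unfolding C_def by (rule measure_preserving_shear[OF fin i(1)]) auto
  have mD: "measure_preserving (PiM I (\<lambda>_. lborel)) D"
    unfolding D_def by (rule measure_preserving_shear[OF fin i(1)]) (use sm s_upd in auto)
  have "measure_preserving (PiM I (\<lambda>_. lborel)) (\<lambda>y. D (C (B (A y))))"
    by (rule measure_preserving_comp[OF mD measure_preserving_comp[OF mC measure_preserving_comp[OF mB mA]]])
  then show ?thesis
  proof (rule measure_preserving_cong)
    fix y assume y: "y \<in> space (PiM I (\<lambda>_::'i. lborel :: real measure))"
    define q where "q = (\<Sum>d\<in>I. w d * y d)"
    have q: "q = w i * y i + (\<Sum>d\<in>I - {i}. w d * y d)" unfolding q_def by (rule sum.remove[OF fin i(1)])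
    have Ai: "A y i = q / w i" using i by (simp add: A_def s_def q field_simps)
    have Ac: "A y c = y c" if "c \<noteq> i" for c using that by (simp add: A_def)
    have Bc: "B (A y) c = y c - 2 * q * w c" if "c \<in> I - {i}" for c
      using that i by (simp add: B_def Ac Ai)
    have Bi: "B (A y) i = q / w i" by (simp add: B_def Ai)
    have "s (C (B (A y))) = (\<Sum>d\<in>I - {i}. w d * (y d - 2 * q * w d)) / w i"
      unfolding s_def by (intro arg_cong2[where f = divide] sum.cong refl) (auto simp: C_def Bc)
    also have "(\<Sum>d\<in>I - {i}. w d * (y d - 2 * q * w d))
        = (\<Sum>d\<in>I - {i}. w d * y d) - 2 * q * (\<Sum>d\<in>I - {i}. (w d)\<^sup>2)"
      by (simp add: sum_subtractf sum_distrib_left algebra_simps power2_eq_square)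
    also have "\<dots> = (q - w i * y i) - 2 * q * (1 - (w i)\<^sup>2)"
      using sum.remove[OF fin i(1), of "\<lambda>d. (w d)\<^sup>2"] w q by simp
    finally have sC: "s (C (B (A y))) = ((q - w i * y i) - 2 * q * (1 - (w i)\<^sup>2)) / w i" .
    have Di: "D z i = z i - s z" and Ci: "C z i = - z i" for z by (simp_all add: D_def C_def)
    have "D (C (B (A y))) i = y i - 2 * q * w i"
      unfolding Di Ci sC Bi using i by (simp add: field_simps power2_eq_square)
    moreover have "D (C (B (A y))) c = y c - 2 * q * w c" if "c \<in> I - {i}" for c
      using that by (simp add: D_def C_def Bc)
    moreover have "D (C (B (A y))) c = undefined" if "c \<notin> I" for c
      using that i y by (auto simp: D_def C_def B_def A_def space_PiM PiE_def extensional_def)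
    ultimately show "D (C (B (A y))) = (\<lambda>c\<in>I. y c - 2 * (\<Sum>d\<in>I. w d * y d) * w c)"
      unfolding q_def[symmetric] by (auto simp: fun_eq_iff)
  qed
qed

section \<open>The unit ball in coordinates and its projection to the sphere\<close>

lemma measurable_euclid_borelI: "f \<in> measurable borel N \<Longrightarrow> f \<in> measurable (euclid_borel p) N"
  unfolding euclid_borel_def by (rule measurable_restrict_space1)

lemma lookup_scaleR: "Poly_Mapping.lookup (c *\<^sub>R x) k = c *\<^sub>R Poly_Mapping.lookup x k"
  by (simp add: scaleR_poly_mapping.rep_eq)

lemma euclid_eqI:
  assumes "x \<in> euclid p" "y \<in> euclid p" "\<And>i. i < p \<Longrightarrow> Poly_Mapping.lookup x i = Poly_Mapping.lookup y i"
  shows "x = y"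
  using assms by (metis of_coords_lookup lookup_of_coords poly_mapping_eqI)

lemma norm_euclid_sq: "x \<in> euclid p \<Longrightarrow> (norm x)\<^sup>2 = (\<Sum>i<p. (Poly_Mapping.lookup x i)\<^sup>2)"
  unfolding power2_norm_eq_inner by (simp add: inner_euclid power2_eq_square)

abbreviation "lebesgue_PiM p \<equiv> PiM {..<p} (\<lambda>_::nat. lborel :: real measure)"
abbreviation "coord_ball p \<equiv> {y \<in> space (lebesgue_PiM p). norm (of_coords p y) \<le> 1}"

lemma measurable_PiM_of_coords[measurable]: "of_coords p \<in> measurable (lebesgue_PiM p) (euclid_borel p)"
proof (rule measurable_of_coords)
  fix i assume "i < p"
  then show "(\<lambda>y. y i) \<in> borel_measurable (lebesgue_PiM p)"
    using measurable_component_singleton[of i "{..<p}" "\<lambda>_. lborel :: real measure"] by simp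
qed

lemma coord_ball_sets[measurable]: "coord_ball p \<in> sets (lebesgue_PiM p)"
  by measurable

lemma measurable_sgn_of_coords[measurable]:
  "(\<lambda>y. sgn (of_coords p y)) \<in> measurable (lebesgue_PiM p) (euclid_borel p)"
proof -
  have "(\<lambda>y. inverse (norm (of_coords p y)) *\<^sub>R of_coords p y) \<in> borel_measurable (lebesgue_PiM p)"
    by measurable
  then show ?thesis
    unfolding measurable_euclid_borel_iff by (simp add: sgn_poly_mapping_def euclid_scaleR of_coords_in_euclid)
qed

lemma emeasure_coord_ball: "0 < emeasure (lebesgue_PiM p) (coord_ball p)" "emeasure (lebesgue_PiM p) (coord_ball p) < \<infinity>"
proof -
  interpret product_sigma_finite "\<lambda>_::nat. lborel :: real measure" by standard
  have norm: "(norm (of_coords p y))\<^sup>2 = (\<Sum>i<p. (y i)\<^sup>2)" for y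
    unfolding norm_euclid_sq[OF of_coords_in_euclid] by (simp add: lookup_of_coords cong: sum.cong_simp)
  \<comment> \<open>Points of the cube of side 1 / p have squared norm at most p (1 / p)^2 = 1 / p.
    For p = 0 the product is empty and the measure is 1.\<close>
  define A where "A = PiE {..<p} (\<lambda>_::nat. {0..1 / real p})"
  have "emeasure (lebesgue_PiM p) A = (\<Prod>i<p. emeasure lborel {0..1 / real p})"
    unfolding A_def by (rule emeasure_PiM) auto
  also have "\<dots> = ennreal ((1 / real p) ^ p)" by (simp add: ennreal_power)
  finally have "emeasure (lebesgue_PiM p) A = ennreal ((1 / real p) ^ p)" .
  moreover have "0 < (1 / real p) ^ p" by (cases "p = 0") auto
  ultimately have "0 < emeasure (lebesgue_PiM p) A" by simp
  moreover have "A \<subseteq> coord_ball p"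
  proof
    fix y assume y: "y \<in> A"
    have "(norm (of_coords p y))\<^sup>2 \<le> (\<Sum>i<p. (1 / real p)\<^sup>2)"
      unfolding norm by (rule sum_mono, rule power_mono) (use y in \<open>auto simp: A_def PiE_def Pi_def\<close>)
    also have "\<dots> \<le> 1" by (cases "p = 0") (simp_all add: power2_eq_square field_simps)
    finally have "norm (of_coords p y) \<le> 1" by (simp add: power_le_one_iff)
    then show "y \<in> coord_ball p" using y by (auto simp: A_def space_PiM PiE_def)
  qed
  ultimately show "0 < emeasure (lebesgue_PiM p) (coord_ball p)"
    using emeasure_mono[OF _ coord_ball_sets, of A p] by (simp add: order.strict_trans2)
  define B where "B = PiE {..<p} (\<lambda>_::nat. {-1..1::real})"
  have BS: "B \<in> sets (lebesgue_PiM p)" unfolding B_def by (rule sets_PiM_I_finite) auto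
  have "emeasure (lebesgue_PiM p) B = (\<Prod>i<p. emeasure lborel {-1..1::real})"
    unfolding B_def by (rule emeasure_PiM) auto
  then have "emeasure (lebesgue_PiM p) B < \<infinity>" by (simp add: power_less_top_ennreal)
  moreover have "coord_ball p \<subseteq> B"
  proof
    fix y assume y: "y \<in> coord_ball p"
    have "\<bar>y i\<bar> \<le> 1" if "i < p" for i
      using norm_lookup_le[of "of_coords p y" i] that y by (simp add: lookup_of_coords)
    then show "y \<in> B" using y by (auto simp: B_def space_PiM PiE_def abs_le_iff minus_le_iff)
  qed
  ultimately show "emeasure (lebesgue_PiM p) (coord_ball p) < \<infinity>"
    using emeasure_mono[OF _ BS, of "coord_ball p"] by (simp add: order.strict_trans1)
qed

lemma sets_uniform_sphere[measurable_cong]: "sets (uniform_sphere p) = sets (euclid_borel p)"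
  by (simp add: uniform_sphere_def)

lemma space_uniform_sphere[simp]: "space (uniform_sphere p) = euclid p"
  by (simp add: uniform_sphere_def)

lemma prob_space_uniform_sphere: "prob_space (uniform_sphere p)"
proof -
  interpret prob_space "uniform_measure (lebesgue_PiM p) (coord_ball p)"
    by (rule prob_space_uniform_measure) (use emeasure_coord_ball[of p] in auto)
  show ?thesis unfolding uniform_sphere_def by (rule prob_space_distr) simp
qed

text \<open>\<open>sgn\<close> has norm 1 except at the origin, where its value is 0. The origin
  lies in the null set on which coordinate 0 vanishes, and this coordinate exists because
  \<open>p\<close> is positive.\<close>

lemma AE_uniform_sphere_norm:
  assumes p: "1 \<le> p"
  shows "AE u in uniform_sphere p. norm u = 1"
proof -
  interpret product_sigma_finite "\<lambda>_::nat. lborel :: real measure" by standard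
  define N where "N = PiE {..<p} (\<lambda>i::nat. if i = 0 then {0::real} else UNIV)"
  have NS: "N \<in> sets (lebesgue_PiM p)" unfolding N_def by (rule sets_PiM_I_finite) auto
  have "emeasure (lebesgue_PiM p) N = (\<Prod>i<p. emeasure lborel (if i = 0 then {0::real} else UNIV))"
    unfolding N_def by (rule emeasure_PiM) auto
  also have "\<dots> = 0" using p by (intro prod_zero) (auto intro!: bexI[of _ 0])
  finally have N0: "N \<in> null_sets (lebesgue_PiM p)" using NS by auto
  have "AE y in lebesgue_PiM p. norm (sgn (of_coords p y)) = 1"
  proof (rule AE_I'[OF N0], rule subsetI)
    fix y assume y: "y \<in> {y \<in> space (lebesgue_PiM p). norm (sgn (of_coords p y)) \<noteq> 1}"
    then have "of_coords p y = 0" by (auto simp: norm_sgn split: if_splits)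
    then have "y 0 = 0" using p lookup_of_coords[of p y 0] by simp
    then show "y \<in> N" using y by (auto simp: N_def space_PiM PiE_def)
  qed
  then have "AE y in uniform_measure (lebesgue_PiM p) (coord_ball p). norm (sgn (of_coords p y)) = 1"
    by (intro AE_uniform_measureI) (auto elim: AE_mp)
  moreover have "{u \<in> space (euclid_borel p). norm u = 1} \<in> sets (euclid_borel p)"
    using measurable_sets[OF measurable_euclid_borelI[OF borel_measurable_norm], of "{1}" p]
    by (simp add: vimage_def Int_def conj_commute)
  ultimately show ?thesis
    unfolding uniform_sphere_def by (subst AE_distr_iff) auto
qed

definition reflect :: "(nat \<Rightarrow>\<^sub>0 real) \<Rightarrow> (nat \<Rightarrow>\<^sub>0 real) \<Rightarrow> (nat \<Rightarrow>\<^sub>0 real)" where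
  "reflect w u = u - (2 * inner w u) *\<^sub>R w"

lemma reflect_in_euclid: "w \<in> euclid p \<Longrightarrow> u \<in> euclid p \<Longrightarrow> reflect w u \<in> euclid p"
  unfolding reflect_def by (intro euclid_diff euclid_scaleR)

lemma inner_reflect_left: "inner (reflect w u) v = inner u (reflect w v)"
  by (simp add: reflect_def inner_diff_left inner_diff_right inner_commute)

lemma reflect_reflect: "norm w = 1 \<Longrightarrow> reflect w (reflect w u) = u"
  by (simp add: reflect_def inner_diff_right norm_eq_1 algebra_simps)

lemma norm_reflect: "norm w = 1 \<Longrightarrow> norm (reflect w u) = norm u"
  by (simp add: norm_eq_sqrt_inner inner_reflect_left reflect_reflect)

lemma measurable_reflect: "w \<in> euclid p \<Longrightarrow> reflect w \<in> measurable (euclid_borel p) (euclid_borel p)"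
  unfolding measurable_euclid_borel_iff
  by (auto simp: reflect_in_euclid) (auto simp: reflect_def[abs_def] euclid_borel_def intro!: borel_measurable_continuous_on_restrict continuous_intros)

text \<open>In coordinates the reflection preserves Lebesgue measure and the ball, hence the uniform
  law on the ball; being linear and isometric, it commutes with \<open>sgn\<close>.\<close>

lemma uniform_sphere_reflect:
  assumes w: "w \<in> euclid p" "norm w = 1"
  shows "distr (uniform_sphere p) (uniform_sphere p) (reflect w) = uniform_sphere p"
proof -
  let ?P = "lebesgue_PiM p" and ?B = "coord_ball p"
  define T where "T y = (\<lambda>c\<in>{..<p}. y c - 2 * (\<Sum>d<p. Poly_Mapping.lookup w d * y d) * Poly_Mapping.lookup w c)" for y
  have "(\<Sum>c<p. (Poly_Mapping.lookup w c)\<^sup>2) = 1" using norm_euclid_sq[OF w(1)] w(2) by simp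
  then have "measure_preserving ?P T"
    unfolding T_def by (intro measure_preserving_reflection) auto
  then have T[measurable]: "T \<in> measurable ?P ?P" and Tp: "distr ?P ?P T = ?P"
    by (auto simp: measure_preserving_def)
  have TR: "of_coords p (T y) = reflect w (of_coords p y)" for y
    by (rule euclid_eqI[OF of_coords_in_euclid reflect_in_euclid[OF w(1) of_coords_in_euclid]])
      (simp add: T_def reflect_def lookup_of_coords lookup_minus lookup_scaleR inner_euclid[OF w(1)])
  have TB: "T y \<in> ?B \<longleftrightarrow> y \<in> ?B" if "y \<in> space ?P" for y
    using that measurable_space[OF T that] by (simp add: TR norm_reflect w)
  have U: "distr (uniform_measure ?P ?B) ?P T = uniform_measure ?P ?B" (is "?D = ?U")
  proof (rule measure_eqI)
    fix A assume "A \<in> sets ?D"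
    then have A[measurable]: "A \<in> sets ?P" by simp
    have "emeasure ?D A = emeasure ?U (T -` A \<inter> space ?P)" by (simp add: emeasure_distr)
    also have "\<dots> = emeasure ?P (?B \<inter> (T -` A \<inter> space ?P)) / emeasure ?P ?B"
      by (rule emeasure_uniform_measure) auto
    also have "?B \<inter> (T -` A \<inter> space ?P) = T -` (?B \<inter> A) \<inter> space ?P" using TB by blast
    also have "emeasure ?P \<dots> = emeasure (distr ?P ?P T) (?B \<inter> A)" by (rule emeasure_distr[symmetric]) auto
    also have "\<dots> / emeasure ?P ?B = emeasure ?U A" unfolding Tp by (rule emeasure_uniform_measure[symmetric]) auto
    finally show "emeasure ?D A = emeasure ?U A" .
  qed simp
  have sgnR: "reflect w (sgn x) = sgn (reflect w x)" for x
    by (simp add: sgn_poly_mapping_def norm_reflect w) (simp add: reflect_def scaleR_diff_right)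
  have "distr (uniform_sphere p) (uniform_sphere p) (reflect w) = distr (uniform_sphere p) (euclid_borel p) (reflect w)"
    by (rule distr_cong) (auto simp: sets_uniform_sphere)
  also have "\<dots> = distr ?U (euclid_borel p) (\<lambda>y. sgn (of_coords p (T y)))"
    unfolding uniform_sphere_def
    by (subst distr_distr) (auto simp: measurable_reflect[OF w(1)] comp_def sgnR TR)
  also have "\<dots> = distr (distr ?U ?P T) (euclid_borel p) (\<lambda>y. sgn (of_coords p y))"
    by (subst distr_distr) (auto simp: comp_def)
  also have "\<dots> = uniform_sphere p" unfolding U by (simp add: uniform_sphere_def)
  finally show ?thesis .
qed

lemma integral_uniform_sphere_reflect:
  assumes w: "w \<in> euclid p" "norm w = 1" and f: "f \<in> borel_measurable (euclid_borel p)"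
  shows "(\<integral>u. f (reflect w u) \<partial>uniform_sphere p) = (\<integral>u. f u \<partial>uniform_sphere p :: real)"
proof -
  have "(\<integral>u. f u \<partial>uniform_sphere p) = (\<integral>u. f u \<partial>distr (uniform_sphere p) (uniform_sphere p) (reflect w))"
    by (simp add: uniform_sphere_reflect[OF w])
  also have "\<dots> = (\<integral>u. f (reflect w u) \<partial>uniform_sphere p)"
    by (rule integral_distr)
      (use f measurable_reflect[OF w(1)] in \<open>simp_all cong: measurable_cong_sets add: sets_uniform_sphere\<close>)
  finally show ?thesis ..
qed

lemma integrable_uniform_sphere_bounded:
  fixes f :: "(nat \<Rightarrow>\<^sub>0 real) \<Rightarrow> real"
  assumes "1 \<le> p" "f \<in> borel_measurable (euclid_borel p)"
    and "\<And>u. u \<in> euclid p \<Longrightarrow> norm u = 1 \<Longrightarrow> \<bar>f u\<bar> \<le> B"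
  shows "integrable (uniform_sphere p) f"
proof -
  interpret prob_space "uniform_sphere p" by (rule prob_space_uniform_sphere)
  show ?thesis
  proof (rule integrable_const_bound[where B = B])
    show "AE u in uniform_sphere p. norm (f u) \<le> B"
      using AE_uniform_sphere_norm[OF assms(1)] AE_space by eventually_elim (use assms(3) in auto)
    show "f \<in> borel_measurable (uniform_sphere p)"
      using assms(2) by (simp cong: measurable_cong_sets add: sets_uniform_sphere)
  qed
qed

lemma measurable_inner_euclid[measurable]: "inner w \<in> borel_measurable (euclid_borel p)"
  by (rule measurable_euclid_borelI) measurable

lemma integrable_sphere_inner_sq:
  assumes "1 \<le> p"
  shows "integrable (uniform_sphere p) (\<lambda>u. (inner w u)\<^sup>2)"
proof (rule integrable_uniform_sphere_bounded[OF assms])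
  show "\<bar>(inner w u)\<^sup>2\<bar> \<le> (norm w)\<^sup>2" if "norm u = 1" for u
    using power_mono[OF Cauchy_Schwarz_ineq2[of w u], of 2] that by simp
qed measurable

text \<open>Any two unit vectors are exchanged by a reflection, so the second moment is the same in all
  directions, and the moments along the coordinate axes add up to \<open>1\<close>.\<close>

lemma integral_sphere_inner_sq:
  assumes p: "1 \<le> p" and w: "w \<in> euclid p"
  shows "(\<integral>u. (inner w u)\<^sup>2 \<partial>uniform_sphere p) = (norm w)\<^sup>2 / p"
proof -
  interpret prob_space "uniform_sphere p" by (rule prob_space_uniform_sphere)
  let ?q = "\<lambda>w. (\<integral>u. (inner w u)\<^sup>2 \<partial>uniform_sphere p)"
  have eq: "?q w = ?q w'" if ww: "w \<in> euclid p" "w' \<in> euclid p" "norm w = 1" "norm w' = 1" for w w'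
  proof (cases "w = w'")
    case False
    \<comment> \<open>For unit vectors <w - w', w> is half of |w - w'|^2, so the reflection along
      the normalised difference maps \<open>w\<close> to \<open>w'\<close>.\<close>
    define v where "v = (1 / norm (w - w')) *\<^sub>R (w - w')"
    have v: "v \<in> euclid p" "norm v = 1"
      using False by (auto simp: v_def intro!: euclid_scaleR euclid_diff ww)
    have "inner (w - w') w = (norm (w - w'))\<^sup>2 / 2"
      using ww by (simp add: power2_norm_eq_inner norm_eq_1 inner_diff_left inner_diff_right inner_commute)
    then have "2 * inner (w - w') w / (norm (w - w') * norm (w - w')) = 1"
      using False by (simp add: power2_eq_square)
    moreover have "reflect v w = w - (2 * inner (w - w') w / (norm (w - w') * norm (w - w'))) *\<^sub>R (w - w')"
      by (simp add: reflect_def v_def)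
    ultimately have "reflect v w = w - (w - w')" by (simp only: scaleR_one)
    then have "reflect v w = w'" by simp
    then have "?q w' = (\<integral>u. (inner w (reflect v u))\<^sup>2 \<partial>uniform_sphere p)"
      by (simp flip: inner_reflect_left)
    also have "\<dots> = ?q w"
      by (rule integral_uniform_sphere_reflect[OF v]) measurable
    finally show ?thesis ..
  qed simp
  define e where "e c = Poly_Mapping.single c (1::real)" for c :: nat
  have e: "e c \<in> euclid p" "norm (e c) = 1" if "c < p" for c
    using that by (auto simp: e_def euclid_def norm_single)
  have inner_e: "inner (e c) u = Poly_Mapping.lookup u c" for c u
    unfolding e_def by (subst inner_poly_mapping_superset[of "{c}"]) auto
  have "(\<Sum>c<p. ?q (e c)) = (\<integral>u. (\<Sum>c<p. (inner (e c) u)\<^sup>2) \<partial>uniform_sphere p)"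
    by (rule Bochner_Integration.integral_sum[symmetric]) (rule integrable_sphere_inner_sq[OF p])
  also have "\<dots> = (\<integral>u. 1 \<partial>uniform_sphere p)"
  proof (rule integral_cong_AE)
    show "AE u in uniform_sphere p. (\<Sum>c<p. (inner (e c) u)\<^sup>2) = 1"
      using AE_uniform_sphere_norm[OF p] AE_space
      by eventually_elim (simp add: inner_e flip: norm_euclid_sq)
    show "(\<lambda>u. \<Sum>c<p. (inner (e c) u)\<^sup>2) \<in> borel_measurable (uniform_sphere p)"
      by (intro borel_measurable_sum borel_measurable_power)
        (simp cong: measurable_cong_sets add: sets_uniform_sphere measurable_inner_euclid)
  qed simp
  finally have sum1: "(\<Sum>c<p. ?q (e c)) = 1" using prob_space by simp
  have unit: "?q w = 1 / p" if "w \<in> euclid p" "norm w = 1" for w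
  proof -
    have "(\<Sum>c<p. ?q (e c)) = (\<Sum>c<p. ?q w)"
      by (intro sum.cong refl eq that e) auto
    with sum1 p show ?thesis by (simp add: field_simps)
  qed
  show ?thesis
  proof (cases "w = 0")
    case False
    have "?q w = (\<integral>u. (norm w)\<^sup>2 * (inner (sgn w) u)\<^sup>2 \<partial>uniform_sphere p)"
      using False by (simp add: sgn_poly_mapping_def power_mult_distrib power_inverse)
    also have "\<dots> = (norm w)\<^sup>2 * ?q (sgn w)" by simp
    also have "?q (sgn w) = 1 / p"
      by (rule unit) (use w False in \<open>auto simp: sgn_poly_mapping_def intro!: euclid_scaleR\<close>)
    finally show ?thesis by simp
  qed simp
qed

section \<open>Bias and second moment of the estimator for a deterministic function\<close>

lemma smooth_measurable_shift:
  assumes sm: "smooth p l f" and x: "x \<in> euclid p"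
  shows "(\<lambda>u. f (x + d *\<^sub>R u)) \<in> borel_measurable (euclid_borel p)"
proof (rule measurable_compose[OF _ smooth_measurable[OF sm]])
  show "(\<lambda>u. x + d *\<^sub>R u) \<in> measurable (euclid_borel p) (euclid_borel p)"
    unfolding measurable_euclid_borel_iff using x
    by (auto simp: euclid_add euclid_scaleR intro!: measurable_euclid_borelI)
qed

lemma smooth_difference_bound:
  assumes sm: "smooth p l f" and x: "x \<in> euclid p" and u: "u \<in> euclid p" "norm u = 1" and d: "0 < d"
  shows "\<bar>f (x + d *\<^sub>R u) - f x\<bar> \<le> d * \<bar>inner (grad p f x) u\<bar> + l / 2 * d\<^sup>2"
proof -
  have "\<bar>f (x + d *\<^sub>R u) - f x - d * inner (grad p f x) u\<bar> \<le> l / 2 * d\<^sup>2"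
    using smooth_quadratic_bound[OF sm x euclid_add[OF x euclid_scaleR[OF u(1), of d]]] u d by simp
  moreover have "\<bar>d * inner (grad p f x) u\<bar> = d * \<bar>inner (grad p f x) u\<bar>" using d by (simp add: abs_mult)
  ultimately show ?thesis by linarith
qed

text \<open>Antisymmetrising the estimator with the reflection along \<open>w\<close> leaves a difference of \<open>f\<close> at two
  points at distance \<open>2 d \<bar>\<langle>w, u\<rangle>\<bar>\<close>; this is where a bias bound free of \<open>p\<close> comes from.\<close>

lemma zo_bias_unit:
  assumes sm: "smooth p l f" and p: "1 \<le> p" and x: "x \<in> euclid p" and d: "0 < d"
    and w: "w \<in> euclid p" "norm w = 1"
  shows "\<bar>(\<integral>u. (f (x + d *\<^sub>R u) - f x) * inner w u \<partial>uniform_sphere p) - d * inner (grad p f x) w / p\<bar> \<le> l * d\<^sup>2 / p"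
proof -
  interpret prob_space "uniform_sphere p" by (rule prob_space_uniform_sphere)
  let ?S = "uniform_sphere p" and ?g = "grad p f x"
  define h where "h u = (f (x + d *\<^sub>R u) - f x) * inner w u" for u
  have hm: "h \<in> borel_measurable (euclid_borel p)"
    unfolding h_def using smooth_measurable_shift[OF sm x, of d]
    by (intro borel_measurable_times borel_measurable_diff measurable_inner_euclid) auto
  have hb: "\<bar>h u\<bar> \<le> d * norm ?g + l / 2 * d\<^sup>2" if u: "u \<in> euclid p" "norm u = 1" for u
  proof -
    have l: "0 \<le> l" by (rule smooth_nonneg[OF sm])
    have wu: "\<bar>inner w u\<bar> \<le> 1" using Cauchy_Schwarz_ineq2[of w u] w u by simp
    have "\<bar>f (x + d *\<^sub>R u) - f x\<bar> \<le> d * \<bar>inner ?g u\<bar> + l / 2 * d\<^sup>2"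
      by (rule smooth_difference_bound[OF sm x u d])
    also have "\<dots> \<le> d * norm ?g + l / 2 * d\<^sup>2"
      using Cauchy_Schwarz_ineq2[of ?g u] u d by simp
    finally have "\<bar>f (x + d *\<^sub>R u) - f x\<bar> * \<bar>inner w u\<bar> \<le> (d * norm ?g + l / 2 * d\<^sup>2) * 1"
      using wu l d by (intro mult_mono) auto
    then show ?thesis by (simp add: h_def abs_mult)
  qed
  have hi: "integrable ?S h" by (rule integrable_uniform_sphere_bounded[OF p hm hb])
  have hRm: "(\<lambda>u. h (reflect w u)) \<in> borel_measurable (euclid_borel p)"
    by (rule measurable_compose[OF measurable_reflect[OF w(1)] hm])
  have hRi: "integrable ?S (\<lambda>u. h (reflect w u))"
    by (rule integrable_uniform_sphere_bounded[OF p hRm])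
      (rule hb, auto simp: reflect_in_euclid w norm_reflect)
  \<comment> \<open>\<open>k\<close> is the symmetrised integrand minus its linearisation. Its
    integral is the bias, since the reflection leaves the integral of \<open>h\<close> unchanged and
    the second moment in direction \<open>w\<close> is 1 / p.\<close>
  define k where "k u = (h u + h (reflect w u)) / 2 - d * inner ?g w * (inner w u)\<^sup>2" for u
  have ki: "integrable ?S k"
    unfolding k_def using hi hRi integrable_sphere_inner_sq[OF p] by auto
  have "(\<integral>u. k u \<partial>?S) = (\<integral>u. h u \<partial>?S) - d * inner ?g w * (1 / p)"
    unfolding k_def using hi hRi integrable_sphere_inner_sq[OF p] integral_sphere_inner_sq[OF p w(1)] w(2)
      integral_uniform_sphere_reflect[OF w hm] by simp
  moreover have "\<bar>\<integral>u. k u \<partial>?S\<bar> \<le> (\<integral>u. l * d\<^sup>2 * (inner w u)\<^sup>2 \<partial>?S)"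
  proof (rule order_trans[OF integral_abs_bound integral_mono_AE])
    show "integrable ?S (\<lambda>u. \<bar>k u\<bar>)" using ki by (rule integrable_abs)
    show "integrable ?S (\<lambda>u. l * d\<^sup>2 * (inner w u)\<^sup>2)" using integrable_sphere_inner_sq[OF p] by auto
    show "AE u in ?S. \<bar>k u\<bar> \<le> l * d\<^sup>2 * (inner w u)\<^sup>2"
      using AE_uniform_sphere_norm[OF p] AE_space
    proof eventually_elim
      case (elim u)
      then have u: "u \<in> euclid p" "norm u = 1" by auto
      define a b where "a = x + d *\<^sub>R reflect w u" and "b = x + d *\<^sub>R u"
      have ab: "a \<in> euclid p" "b \<in> euclid p"
        unfolding a_def b_def by (intro euclid_add euclid_scaleR reflect_in_euclid x w u)+
      \<comment> \<open>The intermediate point lies on a chord of the sphere of radius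
        \<open>d\<close> around \<open>x\<close>, so its gradient differs from the one at
        \<open>x\<close> by at most \<open>l * d\<close>.\<close>
      obtain t where t: "0 < t" "t < 1" "f b - f a = inner (grad p f (a + t *\<^sub>R (b - a))) (b - a)"
        using smooth_mvt[OF sm ab] by auto
      define y where "y = a + t *\<^sub>R (b - a)"
      have y: "y \<in> euclid p" unfolding y_def by (intro euclid_add euclid_scaleR euclid_diff ab)
      have "y - x = d *\<^sub>R ((1 - t) *\<^sub>R reflect w u + t *\<^sub>R u)"
        by (simp add: y_def a_def b_def algebra_simps)
      then have "norm (y - x) = d * norm ((1 - t) *\<^sub>R reflect w u + t *\<^sub>R u)" using d by simp
      also have "\<dots> \<le> d * (norm ((1 - t) *\<^sub>R reflect w u) + norm (t *\<^sub>R u))"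
        using d by (intro mult_left_mono norm_triangle_ineq) auto
      also have "\<dots> = d" using t u w by (simp add: norm_reflect)
      finally have yx: "norm (y - x) \<le> d" .
      have ba: "b - a = (2 * d * inner w u) *\<^sub>R w"
        by (simp add: a_def b_def reflect_def algebra_simps)
      have wR: "inner w (reflect w u) = - inner w u"
        using w by (simp add: reflect_def inner_diff_right norm_eq_1)
      have "h u + h (reflect w u) = (f b - f a) * inner w u"
        unfolding h_def wR a_def b_def by (simp add: algebra_simps)
      also have "\<dots> = 2 * d * (inner w u)\<^sup>2 * inner (grad p f y) w"
        using t(3) by (simp add: y_def[symmetric]) (simp add: ba power2_eq_square)
      finally have "k u = d * (inner w u)\<^sup>2 * inner (grad p f y - ?g) w"
        by (simp add: k_def inner_diff_left algebra_simps)
      then have "\<bar>k u\<bar> = d * (inner w u)\<^sup>2 * \<bar>inner (grad p f y - ?g) w\<bar>"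
        using d by (simp add: abs_mult)
      also have "\<dots> \<le> d * (inner w u)\<^sup>2 * (l * d)"
      proof (rule mult_left_mono)
        have "\<bar>inner (grad p f y - ?g) w\<bar> \<le> norm (grad p f y - ?g) * norm w" by (rule Cauchy_Schwarz_ineq2)
        also have "\<dots> \<le> l * norm (y - x)" using smooth_lipschitz[OF sm y x] w by simp
        also have "\<dots> \<le> l * d" using yx smooth_nonneg[OF sm] by (rule mult_left_mono)
        finally show "\<bar>inner (grad p f y - ?g) w\<bar> \<le> l * d" .
      qed (use d in auto)
      finally show ?case by (simp add: power2_eq_square algebra_simps)
    qed
  qed
  moreover have "(\<integral>u. l * d\<^sup>2 * (inner w u)\<^sup>2 \<partial>?S) = l * d\<^sup>2 / p" using integral_sphere_inner_sq[OF p w(1)] w(2) by simp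
  ultimately show ?thesis by (simp add: h_def)
qed

text \<open>By homogeneity \<open>w\<close> may be normalised. The factor p / d of the estimator
  then meets the bound l d^2 / p for unit vectors, and the powers of \<open>p\<close>
  cancel.\<close>

lemma zo_bias:
  assumes sm: "smooth p l f" and p: "1 \<le> p" and x: "x \<in> euclid p" and d: "0 < d" and w: "w \<in> euclid p"
  shows "\<bar>(\<integral>u. inner w ((p * (f (x + d *\<^sub>R u) - f x) / d) *\<^sub>R u) \<partial>uniform_sphere p) - inner (grad p f x) w\<bar>
    \<le> l * d * norm w"
proof (cases "w = 0")
  case False
  define v where "v = sgn w"
  have v: "v \<in> euclid p" "norm v = 1" "w = norm w *\<^sub>R v"
    using w False by (auto simp: v_def sgn_poly_mapping_def intro!: euclid_scaleR)
  let ?I = "\<integral>u. (f (x + d *\<^sub>R u) - f x) * inner v u \<partial>uniform_sphere p"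
  have "(\<integral>u. inner w ((p * (f (x + d *\<^sub>R u) - f x) / d) *\<^sub>R u) \<partial>uniform_sphere p)
      = (\<integral>u. (norm w * (p / d)) * ((f (x + d *\<^sub>R u) - f x) * inner v u) \<partial>uniform_sphere p)"
    by (rule Bochner_Integration.integral_cong[OF refl], subst v(3)) simp
  also have "\<dots> = (norm w * (p / d)) * ?I" by simp
  finally have I: "(\<integral>u. inner w ((p * (f (x + d *\<^sub>R u) - f x) / d) *\<^sub>R u) \<partial>uniform_sphere p)
      = (norm w * (p / d)) * ?I" .
  have "inner (grad p f x) w = (norm w * (p / d)) * (d * inner (grad p f x) v / p)"
    using p d by (subst v(3)) simp
  then have "(norm w * (p / d)) * ?I - inner (grad p f x) w
      = (norm w * (p / d)) * (?I - d * inner (grad p f x) v / p)" by (simp add: right_diff_distrib)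
  then have "\<bar>(norm w * (p / d)) * ?I - inner (grad p f x) w\<bar>
      = (norm w * (p / d)) * \<bar>?I - d * inner (grad p f x) v / p\<bar>"
    using d by (simp add: abs_mult)
  also have "\<dots> \<le> (norm w * (p / d)) * (l * d\<^sup>2 / p)"
    using d by (intro mult_left_mono zo_bias_unit[OF sm p x d v(1,2)]) auto
  also have "\<dots> = l * d * norm w" using d p by (simp add: power2_eq_square)
  finally show ?thesis unfolding I .
qed simp

text \<open>The linearised estimator has squared norm p^2 <g, u>^2, whose mean is only p |g|^2. The
  factor p^2 survives solely next to d^2, where the choice of the radius absorbs it.\<close>

lemma zo_second_moment:
  assumes sm: "smooth p l f" and p: "1 \<le> p" and x: "x \<in> euclid p" and d: "0 < d"
  shows "(\<integral>\<^sup>+u. ennreal ((norm ((p * (f (x + d *\<^sub>R u) - f x) / d) *\<^sub>R u))\<^sup>2) \<partial>uniform_sphere p)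
    \<le> ennreal (2 * real p * (norm (grad p f x))\<^sup>2 + (real p)\<^sup>2 * l\<^sup>2 * d\<^sup>2 / 2)"
proof -
  interpret prob_space "uniform_sphere p" by (rule prob_space_uniform_sphere)
  let ?g = "grad p f x"
  have "(\<integral>\<^sup>+u. ennreal ((norm ((p * (f (x + d *\<^sub>R u) - f x) / d) *\<^sub>R u))\<^sup>2) \<partial>uniform_sphere p)
      \<le> (\<integral>\<^sup>+u. ennreal (2 * (real p)\<^sup>2 * (inner ?g u)\<^sup>2 + (real p)\<^sup>2 * l\<^sup>2 * d\<^sup>2 / 2) \<partial>uniform_sphere p)"
  proof (rule nn_integral_mono_AE)
    show "AE u in uniform_sphere p. ennreal ((norm ((p * (f (x + d *\<^sub>R u) - f x) / d) *\<^sub>R u))\<^sup>2)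
        \<le> ennreal (2 * (real p)\<^sup>2 * (inner ?g u)\<^sup>2 + (real p)\<^sup>2 * l\<^sup>2 * d\<^sup>2 / 2)"
      using AE_uniform_sphere_norm[OF p] AE_space
    proof eventually_elim
      case (elim u)
      define a where "a = \<bar>inner ?g u\<bar>"
      have "\<bar>f (x + d *\<^sub>R u) - f x\<bar> \<le> d * a + l / 2 * d\<^sup>2"
        unfolding a_def using elim by (intro smooth_difference_bound[OF sm x _ _ d]) auto
      then have "\<bar>f (x + d *\<^sub>R u) - f x\<bar> / d \<le> a + l / 2 * d"
        using d by (simp add: pos_divide_le_eq power2_eq_square algebra_simps)
      then have "(\<bar>f (x + d *\<^sub>R u) - f x\<bar> / d)\<^sup>2 \<le> (a + l / 2 * d)\<^sup>2"
        using d by (intro power_mono) auto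
      also have "\<dots> \<le> 2 * a\<^sup>2 + 2 * (l / 2 * d)\<^sup>2"
        using sum_squares_bound[of a "l / 2 * d"] by (simp add: power2_sum)
      finally have le: "(real p)\<^sup>2 * (\<bar>f (x + d *\<^sub>R u) - f x\<bar> / d)\<^sup>2 \<le> (real p)\<^sup>2 * (2 * a\<^sup>2 + 2 * (l / 2 * d)\<^sup>2)"
        by (rule mult_left_mono) auto
      have eq: "(norm ((p * (f (x + d *\<^sub>R u) - f x) / d) *\<^sub>R u))\<^sup>2 = (real p)\<^sup>2 * (\<bar>f (x + d *\<^sub>R u) - f x\<bar> / d)\<^sup>2"
        using elim d by (simp add: power_mult_distrib power_divide abs_mult)
      show ?case
        unfolding eq by (rule ennreal_leI, rule order_trans[OF le])
          (simp add: a_def power_mult_distrib power_divide algebra_simps)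
    qed
  qed
  also have "\<dots> = ennreal (\<integral>u. 2 * (real p)\<^sup>2 * (inner ?g u)\<^sup>2 + (real p)\<^sup>2 * l\<^sup>2 * d\<^sup>2 / 2 \<partial>uniform_sphere p)"
    using integrable_sphere_inner_sq[OF p] by (intro nn_integral_eq_integral) auto
  also have "(\<integral>u. 2 * (real p)\<^sup>2 * (inner ?g u)\<^sup>2 + (real p)\<^sup>2 * l\<^sup>2 * d\<^sup>2 / 2 \<partial>uniform_sphere p)
      = 2 * real p * (norm ?g)\<^sup>2 + (real p)\<^sup>2 * l\<^sup>2 * d\<^sup>2 / 2"
    using integrable_sphere_inner_sq[OF p] integral_sphere_inner_sq[OF p smooth_grad_in[OF sm x]] p
      prob_space
    by (simp add: power2_eq_square)
  finally show ?thesis .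
qed

section \<open>Spectral bounds for the Laplacian\<close>

abbreviation lin :: "nat \<Rightarrow> (nat \<Rightarrow> nat \<Rightarrow> real) \<Rightarrow> (nat \<Rightarrow> real) \<Rightarrow> nat \<Rightarrow> real" where
  "lin n A v i \<equiv> \<Sum>j<n. A i j * v j"

lemma symmetric_form_swap:
  assumes "\<And>i j. i < n \<Longrightarrow> j < n \<Longrightarrow> A i j = A j i"
  shows "(\<Sum>i<n. v i * lin n A w i) = (\<Sum>i<n. w i * lin n A v i)"
proof -
  have "(\<Sum>i<n. v i * lin n A w i) = (\<Sum>i<n. \<Sum>j<n. v i * A i j * w j)"
    by (simp add: sum_distrib_left mult.assoc)
  also have "\<dots> = (\<Sum>j<n. \<Sum>i<n. v i * A i j * w j)" by (rule sum.swap)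
  also have "\<dots> = (\<Sum>j<n. \<Sum>i<n. w j * (A j i * v i))"
    using assms by (intro sum.cong refl) auto
  finally show ?thesis by (simp add: sum_distrib_left)
qed

text \<open>The eigenvector minimises the Rayleigh quotient on the orthogonal complement of \<open>c\<close>;
  \<open>c = 0\<close> imposes no constraint.\<close>

lemma symmetric_min_eigenvector:
  fixes A :: "nat \<Rightarrow> nat \<Rightarrow> real" and c :: "nat \<Rightarrow> real"
  assumes sym: "\<And>i j. i < n \<Longrightarrow> j < n \<Longrightarrow> A i j = A j i"
    and ker: "\<And>i. i < n \<Longrightarrow> lin n A c i = 0"
    and v0: "i0 < n" "v0 i0 \<noteq> 0" "(\<Sum>i<n. c i * v0 i) = 0"
  obtains \<mu> v where "\<exists>i<n. v i \<noteq> 0" "(\<Sum>i<n. c i * v i) = 0" "\<And>i. i < n \<Longrightarrow> lin n A v i = \<mu> * v i"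
    "\<And>w. (\<Sum>i<n. c i * w i) = 0 \<Longrightarrow> \<mu> * (\<Sum>i<n. (w i)\<^sup>2) \<le> (\<Sum>i<n. w i * lin n A w i)"
proof -
  define Q where "Q v = (\<Sum>i<n. v i * lin n A v i)" for v
  define N where "N v = (\<Sum>i<n. (v i)\<^sup>2)" for v :: "nat \<Rightarrow> real"
  \<comment> \<open>\<open>K\<close> is the unit sphere within the hyperplane orthogonal to
    \<open>c\<close>. Coordinates from \<open>n\<close> on are pinned to 0, so that \<open>K\<close>
    is a closed subset of a product of compact intervals.\<close>
  define bx where "bx i = (if i < n then {-1..1::real} else {0})" for i
  define K where "K = PiE UNIV bx \<inter> ({v. N v = 1} \<inter> {v. (\<Sum>i<n. c i * v i) = 0})"
  have "compact (PiE UNIV bx)"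
  proof -
    have "compactin (product_topology (\<lambda>_::nat. euclidean :: real topology) UNIV) (PiE UNIV bx)"
      by (subst compactin_PiE) (auto simp: bx_def)
    then show ?thesis by (simp only: euclidean_product_topology compactin_euclidean_iff)
  qed
  moreover have "closed {v. N v = 1}" "closed {v. (\<Sum>i<n. c i * v i) = 0}"
    unfolding N_def by (intro closed_Collect_eq continuous_intros continuous_on_product_coordinates)+
  ultimately have compK: "compact K" unfolding K_def by (intro compact_Int_closed closed_Int)
  have scaled: "(\<lambda>i. if i < n then w i / sqrt (N w) else 0) \<in> K"
      "Q (\<lambda>i. if i < n then w i / sqrt (N w) else 0) = Q w / N w"
    if w: "(\<Sum>i<n. c i * w i) = 0" "0 < N w" for w
  proof -
    let ?w = "\<lambda>i. if i < n then w i / sqrt (N w) else 0"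
    have N1: "N ?w = 1" using w by (simp add: N_def power_divide flip: sum_divide_distrib)
    have c0: "(\<Sum>i<n. c i * ?w i) = 0" using w(1) by (simp flip: sum_divide_distrib)
    have "\<bar>?w i\<bar> \<le> 1" for i
    proof (cases "i < n")
      case True
      have "(?w i)\<^sup>2 \<le> N ?w" unfolding N_def using True by (intro member_le_sum) auto
      then show ?thesis using N1 abs_square_le_1 by metis
    qed simp
    then have bw: "- 1 \<le> ?w i \<and> ?w i \<le> 1" for i unfolding abs_le_iff by (simp add: minus_le_iff)
    have "?w \<in> PiE UNIV bx"
    proof (rule PiE_I)
      show "?w i \<in> bx i" for i using bw[of i] by (cases "i < n") (simp_all add: bx_def)
    qed simp
    then show "?w \<in> K" using N1 c0 by (simp only: K_def) simp
    show "Q ?w = Q w / N w"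
      unfolding Q_def using w(2)
      by (simp add: sum_divide_distrib sum_distrib_left)
  qed
  have Npos: "0 < N w" if "i < n" "w i \<noteq> 0" for w i
  proof -
    have "(w i)\<^sup>2 \<le> N w" unfolding N_def using that by (intro member_le_sum) auto
    then show ?thesis using that zero_less_power2[of "w i"] by linarith
  qed
  have "K \<noteq> {}" using scaled(1)[OF v0(3) Npos[where w = v0, OF v0(1,2)]] by auto
  moreover have "continuous_on K Q"
    unfolding Q_def by (intro continuous_intros continuous_on_subset[OF continuous_on_product_coordinates]) auto
  ultimately obtain v where v: "v \<in> K" "\<And>w. w \<in> K \<Longrightarrow> Q v \<le> Q w"
    using continuous_attains_inf[OF compK] by metis
  define \<mu> where "\<mu> = Q v"
  have vN: "N v = 1" and vc: "(\<Sum>i<n. c i * v i) = 0" using v by (auto simp: K_def)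
  have low: "\<mu> * N w \<le> Q w" if w: "(\<Sum>i<n. c i * w i) = 0" for w
  proof (cases "0 < N w")
    case True
    have "\<mu> \<le> Q w / N w" using v(2)[OF scaled(1)[OF w True]] scaled(2)[OF w True] by (simp add: \<mu>_def)
    then show ?thesis using True by (simp add: pos_le_divide_eq)
  next
    case False
    then have "w i = 0" if "i < n" for i using Npos[of i w] that by auto
    then have "Q w = 0" "N w = 0" by (simp_all add: Q_def N_def)
    then show ?thesis by simp
  qed
  define g where "g i = lin n A v i - \<mu> * v i" for i
  define b where "b = Q g - \<mu> * N g"
  \<comment> \<open>Symmetry moves \<open>A\<close> onto \<open>c\<close>, which it annihilates, so
    the residual \<open>g\<close> of the eigenvalue equation is an admissible direction.\<close>
  have gc: "(\<Sum>i<n. c i * g i) = 0"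
  proof -
    have "(\<Sum>i<n. c i * g i) = (\<Sum>i<n. c i * lin n A v i) - \<mu> * (\<Sum>i<n. c i * v i)"
      by (simp add: g_def algebra_simps sum_subtractf sum_distrib_left)
    also have "(\<Sum>i<n. c i * lin n A v i) = (\<Sum>i<n. v i * lin n A c i)"
      by (rule symmetric_form_swap[OF sym])
    finally show ?thesis using ker vc by simp
  qed
  \<comment> \<open>Moving from the minimiser \<open>v\<close> by \<open>t * g\<close> changes the
    form \<open>Q - \<mu> * N\<close> by 2 t N g to first order; minimality keeps the result
    nonnegative for all \<open>t\<close>.\<close>
  have expand: "0 \<le> 2 * t * N g + t\<^sup>2 * b" for t
  proof -
    define w where "w i = v i + t * g i" for i
    have "(\<Sum>i<n. c i * w i) = 0"
      using vc gc by (simp add: w_def algebra_simps sum.distrib flip: sum_distrib_left)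
    then have "\<mu> * N w \<le> Q w" by (rule low)
    moreover have "lin n A w i = lin n A v i + t * lin n A g i" for i
      by (simp add: w_def algebra_simps sum.distrib sum_distrib_left)
    then have "Q w = Q v + t * (\<Sum>i<n. v i * lin n A g i) + t * (\<Sum>i<n. g i * lin n A v i) + t\<^sup>2 * Q g"
      unfolding Q_def by (simp add: w_def algebra_simps sum.distrib sum_distrib_left power2_eq_square)
    moreover have "(\<Sum>i<n. v i * lin n A g i) = (\<Sum>i<n. g i * lin n A v i)"
      by (rule symmetric_form_swap[OF sym])
    moreover have "N w = N v + 2 * t * (\<Sum>i<n. g i * v i) + t\<^sup>2 * N g"
      unfolding N_def by (simp add: w_def algebra_simps sum.distrib sum_distrib_left power2_eq_square)
    moreover have "N g = (\<Sum>i<n. g i * lin n A v i) - \<mu> * (\<Sum>i<n. g i * v i)"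
      unfolding N_def power2_eq_square by (subst (2) g_def) (simp add: algebra_simps sum_subtractf sum_distrib_left)
    ultimately have le: "\<mu> * (1 + 2 * t * (\<Sum>i<n. g i * v i) + t\<^sup>2 * N g)
        \<le> \<mu> + 2 * t * (\<Sum>i<n. g i * lin n A v i) + t\<^sup>2 * Q g"
      and Ng: "N g = (\<Sum>i<n. g i * lin n A v i) - \<mu> * (\<Sum>i<n. g i * v i)"
      using vN by (simp_all add: \<mu>_def)
    have "2 * t * (X - \<mu> * Y) + t\<^sup>2 * b = \<mu> + 2 * t * X + t\<^sup>2 * Q g - \<mu> * (1 + 2 * t * Y + t\<^sup>2 * N g)" for X Y
      by (simp add: b_def algebra_simps)
    then show ?thesis using le by (subst Ng) simp
  qed
  have b0: "0 \<le> b" using low[OF gc] by (simp add: b_def)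
  have "N g = 0"
  proof -
    \<comment> \<open>A negative \<open>t\<close> lets the first-order term win unless N g = 0. The
      denominator is \<open>b + 1\<close> rather than \<open>b\<close>, because \<open>b\<close> may
      be 0.\<close>
    have e: "0 \<le> 2 * (- N g / (b + 1)) * N g + (- N g / (b + 1))\<^sup>2 * b" by (rule expand)
    have "2 * (- N g / k) * N g + (- N g / k)\<^sup>2 * b = (N g)\<^sup>2 * (b - 2 * k) / k\<^sup>2" if "k \<noteq> 0" for k
      using that by (simp add: field_simps power2_eq_square)
    from this[of "b + 1"] e b0 have "0 \<le> (N g)\<^sup>2 * (b - 2 * (b + 1)) / (b + 1)\<^sup>2" by simp
    then have "0 \<le> (N g)\<^sup>2 * (- (b + 2))" using b0 by (simp add: zero_le_divide_iff zero_le_mult_iff)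
    then show ?thesis using b0 by (simp add: zero_le_mult_iff)
  qed
  then have eig: "lin n A v i = \<mu> * v i" if "i < n" for i
    using Npos[of i g] that by (auto simp: g_def)
  have "\<exists>i<n. v i \<noteq> 0"
  proof (rule ccontr)
    assume "\<not> (\<exists>i<n. v i \<noteq> 0)"
    then have "N v = 0" by (simp add: N_def)
    with vN show False by simp
  qed
  then show ?thesis using that[of v \<mu>] vc eig low by (auto simp: N_def Q_def)
qed

lemma eigenvalue_mat_lin:
  assumes "\<exists>i<n. v i \<noteq> 0" "\<And>i. i < n \<Longrightarrow> lin n A v i = \<mu> * v i"
  shows "eigenvalue (mat n n (\<lambda>(i, j). A i j)) \<mu>"
  unfolding eigenvalue_def eigenvector_def
proof (intro exI[of _ "Matrix.vec n v"] conjI)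
  show "mat n n (\<lambda>(i, j). A i j) *\<^sub>v Matrix.vec n v = \<mu> \<cdot>\<^sub>v Matrix.vec n v"
    by (rule eq_vecI) (simp_all add: scalar_prod_def assms(2) lessThan_atLeast0[symmetric])
  show "Matrix.vec n v \<noteq> 0\<^sub>v (dim_row (mat n n (\<lambda>(i, j). A i j)))"
    using assms(1) by (auto simp: vec_eq_iff)
qed simp

lemma real_eigenvalue_le_rho:
  assumes A: "A \<in> carrier_mat n n" and n: "0 < n" and ev: "eigenvalue A \<mu>"
  shows "\<bar>\<mu>\<bar> \<le> rho A"
proof -
  have "eigenvalue (map_mat complex_of_real A) (complex_of_real \<mu>)"
    by (rule of_real_hom.eigenvalue_hom[OF A ev])
  then have "\<bar>\<mu>\<bar> \<in> norm ` spectrum (map_mat complex_of_real A)"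
    by (auto simp: spectrum_def intro!: image_eqI[of _ _ "complex_of_real \<mu>"])
  then show ?thesis unfolding rho_def
    by (rule spectral_radius_mem_max(2)[rotated -1]) (use A n in auto)
qed

text \<open>For a single agent \<open>\<rho>(L\<^sup>2) = 0\<close>, so that \<open>d1\<close> is \<open>0\<close> (division by zero) and no step size is admissible.\<close>

lemma rho_laplacian_single:
  assumes "weighted_graph 1 E a"
  shows "rho (laplacian 1 a * laplacian 1 a) = 0"
proof -
  have 0: "laplacian 1 a * laplacian 1 a = 0\<^sub>m 1 1"
    using assms by (intro eq_matI) (auto simp: laplacian_def weighted_graph_def scalar_prod_def)
  have "spectral_radius (0\<^sub>m 1 1) \<in> norm ` spectrum (0\<^sub>m 1 1 :: complex mat)"
    by (rule spectral_radius_mem_max(1)[of _ 1]) simp_all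
  then obtain k :: complex where k: "eigenvalue (0\<^sub>m 1 1) k" "spectral_radius (0\<^sub>m 1 1) = norm k"
    by (auto simp: spectrum_def)
  then obtain v :: "complex Matrix.vec" where v: "v \<in> carrier_vec 1" "v \<noteq> 0\<^sub>v 1" "0\<^sub>m 1 1 *\<^sub>v v = k \<cdot>\<^sub>v v"
    by (auto simp: eigenvalue_def eigenvector_def)
  have "k * v $ 0 = 0" using arg_cong[OF v(3), of "\<lambda>w :: complex Matrix.vec. w $ 0"] v(1) by (simp add: scalar_prod_def)
  moreover have "v $ 0 \<noteq> 0" using v by (auto simp: vec_eq_iff)
  ultimately have "k = 0" by simp
  moreover have "map_mat complex_of_real (0\<^sub>m 1 1) = 0\<^sub>m 1 1" by (intro eq_matI) auto
  ultimately show ?thesis unfolding rho_def 0 using k by simp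
qed

section \<open>Laplacian of a connected graph\<close>

context
  fixes n E a
  assumes wg: "weighted_graph n E a" and conn: "connected_graph n E" and n: "2 \<le> n"
begin

definition "Lc i j = laplacian n a $$ (i, j)"

lemma laplacian_carrier: "laplacian n a \<in> carrier_mat n n"
  by (simp add: laplacian_def)

lemma laplacian_mat: "laplacian n a = mat n n (\<lambda>(i, j). Lc i j)"
  by (intro eq_matI) (auto simp: Lc_def laplacian_def)

lemma Lc_eq: "i < n \<Longrightarrow> j < n \<Longrightarrow> Lc i j = (if i = j then \<Sum>k<n. a i k else 0) - a i j"
  by (simp add: Lc_def laplacian_def)

lemma a_sym: "i < n \<Longrightarrow> j < n \<Longrightarrow> a i j = a j i"
  and a_nonneg: "i < n \<Longrightarrow> j < n \<Longrightarrow> 0 \<le> a i j"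
  using wg by (auto simp: weighted_graph_def) (metis less_eq_real_def)

lemma Lc_sym: "i < n \<Longrightarrow> j < n \<Longrightarrow> Lc i j = Lc j i"
  by (auto simp: Lc_eq a_sym)

lemma Lc_apply: "i < n \<Longrightarrow> lin n Lc v i = (\<Sum>j<n. a i j * (v i - v j))"
proof -
  assume i: "i < n"
  have "lin n Lc v i = (\<Sum>j<n. (if i = j then (\<Sum>k<n. a i k) * v j else 0) - a i j * v j)"
    using i by (intro sum.cong refl) (auto simp: Lc_eq algebra_simps)
  also have "\<dots> = (\<Sum>k<n. a i k) * v i - (\<Sum>j<n. a i j * v j)"
    using i by (simp add: sum_subtractf sum.delta)
  finally show ?thesis by (simp add: sum_distrib_right right_diff_distrib sum_subtractf)
qed

lemma Lc_const: "i < n \<Longrightarrow> lin n Lc (\<lambda>_. 1) i = 0"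
  by (subst Lc_apply) simp_all

text \<open>Adding the double sum to its transpose leaves the weighted squares of the edge
  differences. The form is therefore nonnegative and vanishes only on vectors that are constant
  along edges.\<close>

lemma Lc_quadratic: "2 * (\<Sum>i<n. v i * lin n Lc v i) = (\<Sum>i<n. \<Sum>j<n. a i j * (v i - v j)\<^sup>2)"
proof -
  define S where "S = (\<Sum>i<n. \<Sum>j<n. v i * (a i j * (v i - v j)))"
  have 1: "(\<Sum>i<n. v i * lin n Lc v i) = S" unfolding S_def by (simp add: Lc_apply sum_distrib_left)
  have "S = (\<Sum>i<n. \<Sum>j<n. v j * (a j i * (v j - v i)))" unfolding S_def by (rule sum.swap)
  also have "\<dots> = (\<Sum>i<n. \<Sum>j<n. v j * (a i j * (v j - v i)))"
    by (intro sum.cong refl) (simp add: a_sym)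
  finally have "2 * S = (\<Sum>i<n. \<Sum>j<n. v i * (a i j * (v i - v j)) + v j * (a i j * (v j - v i)))"
    by (simp add: S_def sum.distrib)
  then show ?thesis unfolding 1 by (simp add: algebra_simps power2_eq_square)
qed

lemma
  shows rho2_laplacian_pos: "0 < rho2 (laplacian n a)"
    and rho2_laplacian_le: "\<And>w. (\<Sum>i<n. w i) = 0 \<Longrightarrow> rho2 (laplacian n a) * (\<Sum>i<n. (w i)\<^sup>2) \<le> (\<Sum>i<n. w i * lin n Lc w i)"
    and eigenvalue_rho2: "eigenvalue (laplacian n a) (rho2 (laplacian n a))"
proof -
  \<comment> \<open>With two agents there is a nonzero vector orthogonal to the constants, so the
    constrained minimum exists.\<close>
  define v0 :: "nat \<Rightarrow> real" where "v0 i = (if i = 0 then 1 else if i = 1 then -1 else 0)" for i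
  have "(\<Sum>i<n. v0 i) = (\<Sum>i\<in>{0, 1}. v0 i)" using n by (intro sum.mono_neutral_right) (auto simp: v0_def)
  then have v0: "(\<Sum>i<n. 1 * v0 i) = 0" by (simp add: v0_def)
  obtain \<mu> v where v: "\<exists>i<n. v i \<noteq> 0" "(\<Sum>i<n. 1 * v i) = 0" "\<And>i. i < n \<Longrightarrow> lin n Lc v i = \<mu> * v i"
    and low: "\<And>w. (\<Sum>i<n. 1 * w i) = 0 \<Longrightarrow> \<mu> * (\<Sum>i<n. (w i)\<^sup>2) \<le> (\<Sum>i<n. w i * lin n Lc w i)"
    by (rule symmetric_min_eigenvector[of n Lc "\<lambda>_. 1" 0 v0])
      (use Lc_sym Lc_const v0 n in \<open>auto simp: v0_def\<close>)
  have ev: "eigenvalue (laplacian n a) \<mu>" unfolding laplacian_mat by (rule eigenvalue_mat_lin[OF v(1,3)])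
  have N: "0 < (\<Sum>i<n. (v i)\<^sup>2)"
    using v(1) by (metis (mono_tags, lifting) finite_lessThan lessThan_iff sum_pos2 zero_le_power2 zero_less_power2)
  have eq: "2 * (\<mu> * (\<Sum>i<n. (v i)\<^sup>2)) = (\<Sum>i<n. \<Sum>j<n. a i j * (v i - v j)\<^sup>2)"
  proof -
    have "(\<Sum>i<n. v i * lin n Lc v i) = (\<Sum>i<n. \<mu> * (v i)\<^sup>2)"
      by (intro sum.cong refl) (use v(3) in \<open>auto simp: power2_eq_square\<close>)
    then show ?thesis unfolding Lc_quadratic[symmetric] by (simp add: sum_distrib_left)
  qed
  \<comment> \<open>A nonpositive minimum makes all edge differences of \<open>v\<close> vanish;
    connectivity then makes \<open>v\<close> constant, and orthogonality to the constants makes it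
    zero.\<close>
  have "0 < \<mu>"
  proof (rule ccontr)
    assume "\<not> 0 < \<mu>"
    then have "\<mu> * (\<Sum>i<n. (v i)\<^sup>2) \<le> 0" using N by (simp add: mult_le_0_iff)
    then have "(\<Sum>i<n. \<Sum>j<n. a i j * (v i - v j)\<^sup>2) \<le> 0" using eq by linarith
    moreover have nn: "0 \<le> a i j * (v i - v j)\<^sup>2" if "i < n" "j < n" for i j using a_nonneg[OF that] by simp
    ultimately have "(\<Sum>i<n. \<Sum>j<n. a i j * (v i - v j)\<^sup>2) = 0" by (intro antisym sum_nonneg) auto
    then have "\<forall>i<n. (\<Sum>j<n. a i j * (v i - v j)\<^sup>2) = 0"
      by (subst (asm) sum_nonneg_eq_0_iff) (auto intro!: sum_nonneg nn)
    then have z: "a i j * (v i - v j)\<^sup>2 = 0" if "i < n" "j < n" for i j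
    proof -
      have "(\<Sum>j<n. a i j * (v i - v j)\<^sup>2) = 0" using \<open>\<forall>i<n. _ i = 0\<close> that(1) by blast
      then have "\<forall>j\<in>{..<n}. a i j * (v i - v j)\<^sup>2 = 0"
        by (subst (asm) sum_nonneg_eq_0_iff) (use nn[OF that(1)] in auto)
      then show ?thesis using that(2) by blast
    qed
    have step: "v i = v j" "j < n" if "(i, j) \<in> E" "i < n" for i j
    proof -
      show "j < n" using that wg by (auto simp: weighted_graph_def)
      then have "0 < a i j" using that wg by (auto simp: weighted_graph_def)
      then show "v i = v j" using z[OF that(2) \<open>j < n\<close>] by simp
    qed
    have "v 0 = v j" if "j < n" for j
    proof -
      have "(0, j) \<in> E\<^sup>*" using conn n that by (auto simp: connected_graph_def)
      then have "v 0 = v j \<and> j < n"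
        by (induction rule: rtrancl_induct) (use n step in auto)
      then show ?thesis ..
    qed
    have "(\<Sum>i<n. v i) = (\<Sum>i<n. v 0)"
      by (rule sum.cong) (use \<open>\<And>j. j < n \<Longrightarrow> v 0 = v j\<close> in auto)
    then have "v 0 = 0" using v(2) n by simp
    then show False using v(1) \<open>\<And>j. j < n \<Longrightarrow> v 0 = v j\<close> by auto
  qed
  define P where "P = {z. eigenvalue (laplacian n a) z \<and> 0 < z}"
  \<comment> \<open>\<open>Min\<close> is meaningful on a finite nonempty set: finiteness comes from
    the spectrum, nonemptiness from \<mu>. Minimality gives rho2 \<le> \<mu>, the direction in which
    the Rayleigh bound for \<mu> carries over.\<close>
  have fin: "finite P"
    by (rule finite_subset[OF _ card_finite_spectrum(1)[OF laplacian_carrier]]) (auto simp: P_def spectrum_def)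
  have mem: "\<mu> \<in> P" using ev \<open>0 < \<mu>\<close> by (simp add: P_def)
  have "rho2 (laplacian n a) \<in> P" unfolding rho2_def P_def[symmetric] by (rule Min_in) (use fin mem in auto)
  then show "0 < rho2 (laplacian n a)" "eigenvalue (laplacian n a) (rho2 (laplacian n a))" by (auto simp: P_def)
  have "rho2 (laplacian n a) \<le> \<mu>" unfolding rho2_def P_def[symmetric] by (rule Min_le[OF fin mem])
  then have "rho2 (laplacian n a) * (\<Sum>i<n. (w i)\<^sup>2) \<le> \<mu> * (\<Sum>i<n. (w i)\<^sup>2)" for w :: "nat \<Rightarrow> real"
    by (rule mult_right_mono) (simp add: sum_nonneg)
  then show "rho2 (laplacian n a) * (\<Sum>i<n. (w i)\<^sup>2) \<le> (\<Sum>i<n. w i * lin n Lc w i)" if "(\<Sum>i<n. w i) = 0" for w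
  proof (rule order_trans)
    show "\<mu> * (\<Sum>i<n. (w i)\<^sup>2) \<le> (\<Sum>i<n. w i * lin n Lc w i)" using low[of w] that by simp
  qed
qed

lemma laplacian_sq: "laplacian n a * laplacian n a = mat n n (\<lambda>(i, j). \<Sum>k<n. Lc i k * Lc k j)"
  unfolding laplacian_mat by (intro eq_matI) (auto simp: scalar_prod_def lessThan_atLeast0)

lemma lin_lin: "lin n (\<lambda>i j. \<Sum>k<n. Lc i k * Lc k j) v i = lin n Lc (lin n Lc v) i"
proof -
  have "lin n (\<lambda>i j. \<Sum>k<n. Lc i k * Lc k j) v i = (\<Sum>j<n. \<Sum>k<n. Lc i k * (Lc k j * v j))"
    by (simp add: sum_distrib_right mult.assoc)
  also have "\<dots> = (\<Sum>k<n. \<Sum>j<n. Lc i k * (Lc k j * v j))" by (rule sum.swap)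
  finally show ?thesis by (simp add: sum_distrib_left)
qed

text \<open>The Rayleigh minimum of the negated square, taken under the void constraint c = 0, is
  minus an eigenvalue of the square, and that eigenvalue is at most the spectral radius. The form of
  the square at \<open>w\<close> is the squared norm of the image of \<open>w\<close>.\<close>

lemma rho_laplacian_sq_ge: "(\<Sum>i<n. (lin n Lc w i)\<^sup>2) \<le> rho (laplacian n a * laplacian n a) * (\<Sum>i<n. (w i)\<^sup>2)"
proof -
  define A where "A i j = - (\<Sum>k<n. Lc i k * Lc k j)" for i j
  have sym: "A i j = A j i" if "i < n" "j < n" for i j
    unfolding A_def using that by (intro arg_cong[of _ _ uminus] sum.cong refl) (simp add: Lc_sym)
  have linA: "lin n A v i = - lin n Lc (lin n Lc v) i" for v i
    unfolding lin_lin[symmetric] by (simp add: A_def sum_negf)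
  obtain \<mu> v where v: "\<exists>i<n. v i \<noteq> 0" "\<And>i. i < n \<Longrightarrow> lin n A v i = \<mu> * v i"
    and low: "\<And>w. (\<Sum>i<n. (\<lambda>_. 0) i * w i) = 0 \<Longrightarrow> \<mu> * (\<Sum>i<n. (w i)\<^sup>2) \<le> (\<Sum>i<n. w i * lin n A w i)"
    by (rule symmetric_min_eigenvector[of n A "\<lambda>_. 0" 0 "\<lambda>_. 1"]) (use sym n in auto)
  have "eigenvalue (laplacian n a * laplacian n a) (- \<mu>)"
    unfolding laplacian_sq
    by (rule eigenvalue_mat_lin[OF v(1)]) (use v(2) in \<open>simp add: lin_lin linA minus_equation_iff\<close>)
  then have "- \<mu> \<le> rho (laplacian n a * laplacian n a)"
    using real_eigenvalue_le_rho[OF mult_carrier_mat[OF laplacian_carrier laplacian_carrier], of "- \<mu>"] n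
    by simp
  then have "- \<mu> * (\<Sum>i<n. (w i)\<^sup>2) \<le> rho (laplacian n a * laplacian n a) * (\<Sum>i<n. (w i)\<^sup>2)"
    by (intro mult_right_mono sum_nonneg) auto
  moreover have "(\<Sum>i<n. w i * lin n A w i) = - (\<Sum>i<n. w i * lin n Lc (lin n Lc w) i)"
    by (simp add: linA sum_negf)
  moreover have "(\<Sum>i<n. w i * lin n Lc (lin n Lc w) i) = (\<Sum>i<n. lin n Lc w i * lin n Lc w i)"
    by (rule symmetric_form_swap) (rule Lc_sym)
  ultimately show ?thesis using low[of w] by (simp add: power2_eq_square)
qed

text \<open>An eigenvector of the Laplacian is one of its square, with the squared eigenvalue.
  Together with \<gamma> < d1 this yields \<gamma> rho2 \<le> 1/2.\<close>

lemma rho2_sq_le: "(rho2 (laplacian n a))\<^sup>2 \<le> rho (laplacian n a * laplacian n a)"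
proof -
  obtain v where v: "eigenvector (laplacian n a) v (rho2 (laplacian n a))"
    using eigenvalue_rho2 by (auto simp: eigenvalue_def)
  define r where "r = rho2 (laplacian n a)"
  have vc: "v \<in> carrier_vec n" "laplacian n a *\<^sub>v v = r \<cdot>\<^sub>v v" "v \<noteq> 0\<^sub>v n"
    using v by (auto simp: eigenvector_def laplacian_def r_def)
  have "eigenvector (laplacian n a * laplacian n a) v (r * r)"
  proof -
    have "dim_row (laplacian n a * laplacian n a) = n" by (simp add: laplacian_def)
    moreover have "laplacian n a * laplacian n a *\<^sub>v v = (r * r) \<cdot>\<^sub>v v"
      unfolding assoc_mult_mat_vec[OF laplacian_carrier laplacian_carrier vc(1)] vc(2)
        mult_mat_vec[OF laplacian_carrier vc(1)] by (simp add: smult_smult_assoc)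
    ultimately show ?thesis unfolding eigenvector_def using vc by simp
  qed
  then have "\<bar>r * r\<bar> \<le> rho (laplacian n a * laplacian n a)"
    by (intro real_eigenvalue_le_rho[of _ n]) (use n in \<open>auto simp: eigenvalue_def laplacian_def\<close>)
  then show ?thesis by (simp add: r_def power2_eq_square)
qed

text \<open>The cross term of the expanded square is controlled from below by \<open>rho2\<close>,
  which is where the zero sum of \<open>y\<close> enters, and the quadratic term from above by the
  spectral radius of the square.\<close>

lemma gossip_contraction:
  assumes y: "(\<Sum>i<n. y i) = 0" and \<gamma>: "0 \<le> \<gamma>"
  shows "(\<Sum>i<n. (y i - \<gamma> * lin n Lc y i)\<^sup>2)
    \<le> (1 - 2 * \<gamma> * rho2 (laplacian n a) + \<gamma>\<^sup>2 * rho (laplacian n a * laplacian n a)) * (\<Sum>i<n. (y i)\<^sup>2)"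
proof -
  have "(\<Sum>i<n. (y i - \<gamma> * z i)\<^sup>2) = (\<Sum>i<n. (y i)\<^sup>2) - 2 * \<gamma> * (\<Sum>i<n. y i * z i) + \<gamma>\<^sup>2 * (\<Sum>i<n. (z i)\<^sup>2)"
    for z :: "nat \<Rightarrow> real"
    by (simp add: power2_diff power_mult_distrib sum.distrib sum_subtractf sum_distrib_left mult_ac)
  then have "(\<Sum>i<n. (y i - \<gamma> * lin n Lc y i)\<^sup>2)
      = (\<Sum>i<n. (y i)\<^sup>2) - 2 * \<gamma> * (\<Sum>i<n. y i * lin n Lc y i) + \<gamma>\<^sup>2 * (\<Sum>i<n. (lin n Lc y i)\<^sup>2)" .
  also have "\<dots> \<le> (\<Sum>i<n. (y i)\<^sup>2) - 2 * \<gamma> * (rho2 (laplacian n a) * (\<Sum>i<n. (y i)\<^sup>2))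
      + \<gamma>\<^sup>2 * (rho (laplacian n a * laplacian n a) * (\<Sum>i<n. (y i)\<^sup>2))"
    using rho2_laplacian_le[OF y] rho_laplacian_sq_ge[of y] \<gamma>
    by (intro add_mono diff_mono mult_left_mono) auto
  finally show ?thesis by (simp add: algebra_simps)
qed

end

section \<open>The zeroth-order gradient estimator\<close>

definition axis :: "nat \<Rightarrow> (nat \<Rightarrow>\<^sub>0 real)" where "axis c = Poly_Mapping.single c 1"

lemma axis_in_euclid: "c < p \<Longrightarrow> axis c \<in> euclid p"
  by (auto simp: axis_def euclid_def)

lemma inner_axis: "inner x (axis c) = Poly_Mapping.lookup x c"
  unfolding axis_def inner_commute[of x] by (subst inner_poly_mapping_superset[of "{c}"]) auto

text \<open>Test with \<open>x\<close> itself. This turns bounds on scalar expectations into norm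
  bounds for vectors whose coordinates are expectations.\<close>

lemma norm_le_inner_bound:
  assumes "x \<in> euclid p" "\<And>w. w \<in> euclid p \<Longrightarrow> inner x w \<le> B * norm w" "0 \<le> B"
  shows "norm x \<le> B"
proof (cases "x = 0")
  case False
  have "norm x * norm x \<le> B * norm x"
    using assms(2)[OF assms(1)] by (simp add: power2_norm_eq_inner flip: power2_eq_square)
  then show ?thesis using False by simp
qed (simp add: assms(3))

lemma smooth_difference_quotient_lim:
  assumes sm: "smooth p l f" and x: "x \<in> euclid p" and e: "e \<in> euclid p"
  shows "(\<lambda>m. real (Suc m) * (f (x + (1 / real (Suc m)) *\<^sub>R e) - f x)) \<longlonglongrightarrow> inner (grad p f x) e"
proof -
  have "\<bar>real (Suc m) * (f (x + (1 / real (Suc m)) *\<^sub>R e) - f x) - inner (grad p f x) e\<bar>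
      \<le> l / 2 * (norm e)\<^sup>2 * (1 / real (Suc m))" for m
  proof -
    define k where "k = real (Suc m)"
    have k: "0 < k" by (simp add: k_def)
    have "\<bar>f (x + (1 / k) *\<^sub>R e) - f x - inner (grad p f x) ((1 / k) *\<^sub>R e)\<bar> \<le> l / 2 * (norm ((1 / k) *\<^sub>R e))\<^sup>2"
      using smooth_quadratic_bound[OF sm x euclid_add[OF x euclid_scaleR[OF e, of "1 / k"]]] by simp
    then have "k * \<bar>f (x + (1 / k) *\<^sub>R e) - f x - inner (grad p f x) ((1 / k) *\<^sub>R e)\<bar>
        \<le> k * (l / 2 * (norm ((1 / k) *\<^sub>R e))\<^sup>2)" using k by (intro mult_left_mono) auto
    also have "k * \<bar>f (x + (1 / k) *\<^sub>R e) - f x - inner (grad p f x) ((1 / k) *\<^sub>R e)\<bar>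
        = \<bar>k * (f (x + (1 / k) *\<^sub>R e) - f x) - inner (grad p f x) e\<bar>"
      using k by (simp add: abs_mult[of k, symmetric, unfolded abs_of_pos[OF k]] right_diff_distrib)
    also have "k * (l / 2 * (norm ((1 / k) *\<^sub>R e))\<^sup>2) = l / 2 * (norm e)\<^sup>2 * (1 / k)"
      using k by (simp add: power2_eq_square)
    finally show ?thesis by (simp add: k_def)
  qed
  then have bound: "norm (real (Suc m) * (f (x + (1 / real (Suc m)) *\<^sub>R e) - f x) - inner (grad p f x) e)
      \<le> l / 2 * (norm e)\<^sup>2 * (1 / real (Suc m))" for m
    unfolding real_norm_def .
  have null: "(\<lambda>m. l / 2 * (norm e)\<^sup>2 * (1 / real (Suc m))) \<longlonglongrightarrow> 0"
    by (rule tendsto_mult_right_zero) (rule LIMSEQ_Suc[OF lim_1_over_n])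
  show ?thesis
    by (rule LIM_zero_cancel, rule Lim_null_comparison[OF always_eventually null], rule allI, rule bound)
qed

section \<open>Estimators of one agent with a random objective\<close>

context
  fixes p :: nat and l :: real and D :: "'z measure" and F :: "(nat \<Rightarrow>\<^sub>0 real) \<Rightarrow> 'z \<Rightarrow> real"
  assumes D: "prob_space D" and l: "0 \<le> l" and p: "1 \<le> p"
    and Fm: "(\<lambda>(x, z). F x z) \<in> borel_measurable (euclid_borel p \<Otimes>\<^sub>M D)"
    and Fi: "\<And>x. x \<in> euclid p \<Longrightarrow> integrable D (F x)"
    and sm: "AE z in D. smooth p l (\<lambda>y. F y z)"
begin

interpretation D: prob_space D by (rule D)
interpretation S: prob_space "uniform_sphere p" by (rule prob_space_uniform_sphere)
interpretation SD: pair_prob_space "uniform_sphere p" D by standard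

abbreviation "mean_obj \<equiv> (\<lambda>x. \<integral>z. F x z \<partial>D)"

text \<open>\<open>grad\<close> is a definite description and carries no information on the null set
  of samples that are not smooth, so its measurability in \<open>z\<close> is unclear. Limits of
  difference quotients are measurable in \<open>z\<close> and agree with the gradient for almost all
  samples.\<close>

definition gradient_version :: "(nat \<Rightarrow>\<^sub>0 real) \<Rightarrow> 'z \<Rightarrow> (nat \<Rightarrow>\<^sub>0 real)" where
  "gradient_version x z = of_coords p (\<lambda>c. lim (\<lambda>m. real (Suc m) * (F (x + (1 / real (Suc m)) *\<^sub>R axis c) z - F x z)))"

lemma gradient_version_in: "gradient_version x z \<in> euclid p"
  by (simp add: gradient_version_def of_coords_in_euclid)

lemma measurable_gradient_version:
  assumes x: "x \<in> euclid p"
  shows "gradient_version x \<in> measurable D (euclid_borel p)"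
  unfolding gradient_version_def
proof (rule measurable_of_coords)
  fix c assume c: "c < p"
  show "(\<lambda>z. lim (\<lambda>m. real (Suc m) * (F (x + (1 / real (Suc m)) *\<^sub>R axis c) z - F x z))) \<in> borel_measurable D"
    by (intro borel_measurable_lim_metric borel_measurable_times borel_measurable_diff borel_measurable_const
        borel_measurable_integrable Fi euclid_add euclid_scaleR axis_in_euclid x c)
qed

lemma gradient_version_eq:
  assumes z: "smooth p l (\<lambda>y. F y z)" and x: "x \<in> euclid p"
  shows "gradient_version x z = grad p (\<lambda>y. F y z) x"
proof (rule euclid_eqI[OF gradient_version_in smooth_grad_in[OF z x]])
  fix c assume c: "c < p"
  show "Poly_Mapping.lookup (gradient_version x z) c = Poly_Mapping.lookup (grad p (\<lambda>y. F y z) x) c"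
    using limI[OF smooth_difference_quotient_lim[OF z x axis_in_euclid[OF c]]] c
    by (simp add: gradient_version_def lookup_of_coords inner_axis)
qed

text \<open>The quadratic remainder bound dominates the directional derivative by a difference of
  two function values, which is integrable, plus a constant.\<close>

lemma integrable_gradient_version:
  assumes x: "x \<in> euclid p" and w: "w \<in> euclid p"
  shows "integrable D (\<lambda>z. inner (gradient_version x z) w)"
proof (rule Bochner_Integration.integrable_bound)
  show "integrable D (\<lambda>z. \<bar>F (x + w) z - F x z\<bar> + l / 2 * (norm w)\<^sup>2)"
    using Fi[OF x] Fi[OF euclid_add[OF x w]] by auto
  show "(\<lambda>z. inner (gradient_version x z) w) \<in> borel_measurable D"
    using measurable_gradient_version[OF x] by (intro borel_measurable_inner) (auto dest: measurable_euclid_borelD)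
  show "AE z in D. norm (inner (gradient_version x z) w) \<le> norm (\<bar>F (x + w) z - F x z\<bar> + l / 2 * (norm w)\<^sup>2)"
    using sm
  proof eventually_elim
    case (elim z)
    have "\<bar>F (x + w) z - F x z - inner (gradient_version x z) w\<bar> \<le> l / 2 * (norm w)\<^sup>2"
      using smooth_quadratic_bound[OF elim x euclid_add[OF x w]] by (simp add: gradient_version_eq[OF elim x])
    then have "\<bar>inner (gradient_version x z) w\<bar> \<le> \<bar>F (x + w) z - F x z\<bar> + l / 2 * (norm w)\<^sup>2" by linarith
    then show ?case by simp
  qed
qed

definition mean_gradient :: "(nat \<Rightarrow>\<^sub>0 real) \<Rightarrow> (nat \<Rightarrow>\<^sub>0 real)" where
  "mean_gradient x = of_coords p (\<lambda>c. \<integral>z. inner (gradient_version x z) (axis c) \<partial>D)"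

lemma mean_gradient_in: "mean_gradient x \<in> euclid p"
  by (simp add: mean_gradient_def of_coords_in_euclid)

lemma inner_mean_gradient:
  assumes x: "x \<in> euclid p" and w: "w \<in> euclid p"
  shows "inner (mean_gradient x) w = (\<integral>z. inner (gradient_version x z) w \<partial>D)"
proof -
  have "inner (mean_gradient x) w
      = (\<Sum>c<p. (\<integral>z. inner (gradient_version x z) (axis c) \<partial>D) * Poly_Mapping.lookup w c)"
    by (simp add: inner_euclid[OF mean_gradient_in]) (simp add: mean_gradient_def lookup_of_coords)
  also have "\<dots> = (\<Sum>c<p. (\<integral>z. inner (gradient_version x z) (axis c) * Poly_Mapping.lookup w c \<partial>D))"
    by simp
  also have "\<dots> = (\<integral>z. (\<Sum>c<p. inner (gradient_version x z) (axis c) * Poly_Mapping.lookup w c) \<partial>D)"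
    by (rule Bochner_Integration.integral_sum[symmetric])
      (auto intro!: integrable_mult_left integrable_gradient_version x axis_in_euclid)
  also have "\<dots> = (\<integral>z. inner (gradient_version x z) w \<partial>D)"
    by (simp add: inner_axis inner_euclid[OF gradient_version_in])
  finally show ?thesis .
qed

text \<open>The remainder bound and the Lipschitz bound hold for almost every sample and survive
  integration. \<open>smooth_quadraticI\<close> then recognises the coordinatewise mean of the
  gradients as the gradient of the mean.\<close>

lemma smooth_mean_obj: "smooth p l mean_obj"
proof -
  have quad: "\<bar>mean_obj y - mean_obj x - inner (mean_gradient x) (y - x)\<bar> \<le> l / 2 * (norm (y - x))\<^sup>2"
    if x: "x \<in> euclid p" and y: "y \<in> euclid p" for x y
  proof -
    let ?R = "\<lambda>z. F y z - F x z - inner (gradient_version x z) (y - x)"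
    have yx: "y - x \<in> euclid p" by (rule euclid_diff[OF y x])
    have i: "integrable D ?R" using Fi[OF x] Fi[OF y] integrable_gradient_version[OF x yx] by auto
    have "mean_obj y - mean_obj x - inner (mean_gradient x) (y - x) = (\<integral>z. ?R z \<partial>D)"
      using Fi[OF x] Fi[OF y] integrable_gradient_version[OF x yx] by (simp add: inner_mean_gradient[OF x yx])
    also have "\<bar>\<dots>\<bar> \<le> (\<integral>z. \<bar>?R z\<bar> \<partial>D)" by (rule integral_abs_bound)
    also have "\<dots> \<le> (\<integral>z. l / 2 * (norm (y - x))\<^sup>2 \<partial>D)"
    proof (rule integral_mono_AE)
      show "AE z in D. \<bar>?R z\<bar> \<le> l / 2 * (norm (y - x))\<^sup>2"
        using sm
      proof eventually_elim
        case (elim z)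
        show ?case using smooth_quadratic_bound[OF elim x y] by (simp add: gradient_version_eq[OF elim x])
      qed
    qed (use i in auto)
    also have "\<dots> = l / 2 * (norm (y - x))\<^sup>2" by (simp add: D.prob_space)
    finally show ?thesis .
  qed
  have lip: "norm (mean_gradient x - mean_gradient y) \<le> l * norm (x - y)"
    if x: "x \<in> euclid p" and y: "y \<in> euclid p" for x y
  proof (rule norm_le_inner_bound[OF euclid_diff[OF mean_gradient_in mean_gradient_in]])
    fix w assume w: "w \<in> euclid p"
    have i: "integrable D (\<lambda>z. inner (gradient_version x z) w)" "integrable D (\<lambda>z. inner (gradient_version y z) w)"
      by (rule integrable_gradient_version x y w)+
    have "inner (mean_gradient x - mean_gradient y) w
        = (\<integral>z. inner (gradient_version x z) w - inner (gradient_version y z) w \<partial>D)"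
      using i by (simp add: inner_diff_left inner_mean_gradient x y w)
    also have "\<dots> \<le> (\<integral>z. l * norm (x - y) * norm w \<partial>D)"
    proof (rule integral_mono_AE)
      show "AE z in D. inner (gradient_version x z) w - inner (gradient_version y z) w \<le> l * norm (x - y) * norm w"
        using sm
      proof eventually_elim
        case (elim z)
        have "inner (gradient_version x z) w - inner (gradient_version y z) w
            = inner (grad p (\<lambda>y. F y z) x - grad p (\<lambda>y. F y z) y) w"
          by (simp add: gradient_version_eq[OF elim] x y inner_diff_left)
        also have "\<dots> \<le> norm (grad p (\<lambda>y. F y z) x - grad p (\<lambda>y. F y z) y) * norm w" by (rule norm_cauchy_schwarz)
        also have "\<dots> \<le> l * norm (x - y) * norm w"
          by (rule mult_right_mono[OF smooth_lipschitz[OF elim x y]]) simp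
        finally show ?case .
      qed
    qed (use i in auto)
    also have "\<dots> = l * norm (x - y) * norm w" by (simp add: D.prob_space)
    finally show "inner (mean_gradient x - mean_gradient y) w \<le> l * norm (x - y) * norm w" .
  qed (use l in auto)
  show "smooth p l mean_obj" by (rule smooth_quadraticI[OF l mean_gradient_in quad lip])
qed

text \<open>Measurability is joint in iterate, direction and sample, since the freezing argument
  integrates over the last two while the first is itself random.\<close>

lemma measurable_zo_grad:
  "(\<lambda>(x, u, z). zo_grad p F d x u z) \<in> measurable (euclid_borel p \<Otimes>\<^sub>M (euclid_borel p \<Otimes>\<^sub>M D)) (euclid_borel p)"
proof -
  let ?M = "euclid_borel p \<Otimes>\<^sub>M (euclid_borel p \<Otimes>\<^sub>M D)"
  have a: "fst \<in> borel_measurable ?M" by (rule measurable_euclid_borelD[OF measurable_fst])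
  have b: "(\<lambda>w. fst (snd w)) \<in> borel_measurable ?M"
    by (rule measurable_euclid_borelD[OF measurable_compose[OF measurable_snd measurable_fst]])
  have c: "(\<lambda>w. snd (snd w)) \<in> measurable ?M D" by (rule measurable_compose[OF measurable_snd measurable_snd])
  have E: "(\<lambda>w. fst w + d *\<^sub>R fst (snd w)) \<in> measurable ?M (euclid_borel p)"
    unfolding measurable_euclid_borel_iff
  proof
    show "(\<lambda>w. fst w + d *\<^sub>R fst (snd w)) \<in> borel_measurable ?M"
      by (intro borel_measurable_add borel_measurable_scaleR borel_measurable_const a b)
    show "\<forall>w\<in>space ?M. fst w + d *\<^sub>R fst (snd w) \<in> euclid p"
      by (auto simp: space_pair_measure intro!: euclid_add euclid_scaleR)
  qed
  have 1: "(\<lambda>w. F (fst w + d *\<^sub>R fst (snd w)) (snd (snd w))) \<in> borel_measurable ?M"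
    using measurable_compose[OF measurable_Pair[OF E c] Fm] by simp
  have 2: "(\<lambda>w. F (fst w) (snd (snd w))) \<in> borel_measurable ?M"
    using measurable_compose[OF measurable_Pair[OF measurable_fst c] Fm] by simp
  have "(\<lambda>w. zo_grad p F d (fst w) (fst (snd w)) (snd (snd w))) \<in> borel_measurable ?M"
    unfolding zo_grad_def
    by (intro borel_measurable_scaleR borel_measurable_divide borel_measurable_times borel_measurable_diff
        borel_measurable_const 1 2 b)
  then show ?thesis
    unfolding measurable_euclid_borel_iff
    by (auto simp: case_prod_beta' zo_grad_def space_pair_measure intro!: euclid_scaleR)
qed

lemma measurable_zo_grad_fixed:
  assumes x: "x \<in> euclid p"
  shows "(\<lambda>(u, z). zo_grad p F d x u z) \<in> measurable (uniform_sphere p \<Otimes>\<^sub>M D) (euclid_borel p)"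
proof -
  have "(\<lambda>w. (x, w)) \<in> measurable (uniform_sphere p \<Otimes>\<^sub>M D) (euclid_borel p \<Otimes>\<^sub>M (euclid_borel p \<Otimes>\<^sub>M D))"
    using x by (intro measurable_Pair measurable_const measurable_ident_sets sets_pair_measure_cong) (auto simp: sets_uniform_sphere)
  from measurable_compose[OF this measurable_zo_grad[of d]] show ?thesis by (simp add: case_prod_beta')
qed

text \<open>With the direction innermost in Fubini, each smooth sample falls under the deterministic
  bound. The sampled gradient is then split into the mean gradient and a deviation of second moment
  at most \<open>V\<close>, which doubles the constant 2.\<close>

lemma zo_grad_second_moment:
  assumes x: "x \<in> euclid p" and d: "0 < d" and V: "0 \<le> V"
    and var: "(\<integral>\<^sup>+z. ennreal ((norm (grad p (\<lambda>y. F y z) x - grad p mean_obj x))\<^sup>2) \<partial>D) \<le> ennreal V"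
  shows "(\<integral>\<^sup>+(u, z). ennreal ((norm (zo_grad p F d x u z))\<^sup>2) \<partial>(uniform_sphere p \<Otimes>\<^sub>M D))
    \<le> ennreal (4 * real p * ((norm (grad p mean_obj x))\<^sup>2 + V) + (real p)\<^sup>2 * l\<^sup>2 * d\<^sup>2 / 2)"
proof -
  let ?g = "grad p mean_obj x"
  define B where "B = 4 * real p * (norm ?g)\<^sup>2 + (real p)\<^sup>2 * l\<^sup>2 * d\<^sup>2 / 2"
  have B: "0 \<le> B" by (simp add: B_def)
  have vm: "(\<lambda>z. norm (gradient_version x z - ?g)) \<in> borel_measurable D"
    using measurable_euclid_borelD[OF measurable_gradient_version[OF x]] by measurable
  have "(\<integral>\<^sup>+(u, z). ennreal ((norm (zo_grad p F d x u z))\<^sup>2) \<partial>(uniform_sphere p \<Otimes>\<^sub>M D))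
      = (\<integral>\<^sup>+z. (\<integral>\<^sup>+u. ennreal ((norm (zo_grad p F d x u z))\<^sup>2) \<partial>uniform_sphere p) \<partial>D)"
  proof -
    have "(\<lambda>(u, z). ennreal ((norm (zo_grad p F d x u z))\<^sup>2)) \<in> borel_measurable (uniform_sphere p \<Otimes>\<^sub>M D)"
      using measurable_euclid_borelD[OF measurable_zo_grad_fixed[OF x, of d]] by (simp add: case_prod_beta')
    from SD.nn_integral_snd[OF this] show ?thesis by simp
  qed
  also have "\<dots> \<le> (\<integral>\<^sup>+z. (4 * real p) * ennreal ((norm (gradient_version x z - ?g))\<^sup>2) + ennreal B \<partial>D)"
  proof (rule nn_integral_mono_AE)
    show "AE z in D. (\<integral>\<^sup>+u. ennreal ((norm (zo_grad p F d x u z))\<^sup>2) \<partial>uniform_sphere p)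
      \<le> (4 * real p) * ennreal ((norm (gradient_version x z - ?g))\<^sup>2) + ennreal B"
      using sm
    proof eventually_elim
      case (elim z)
      define h where "h = gradient_version x z"
      have "(\<integral>\<^sup>+u. ennreal ((norm (zo_grad p F d x u z))\<^sup>2) \<partial>uniform_sphere p)
          \<le> ennreal (2 * real p * (norm h)\<^sup>2 + (real p)\<^sup>2 * l\<^sup>2 * d\<^sup>2 / 2)"
        using zo_second_moment[OF elim p x d] by (simp add: zo_grad_def h_def gradient_version_eq[OF elim x])
      also have "\<dots> \<le> ennreal ((4 * real p) * (norm (h - ?g))\<^sup>2 + B)"
      proof (rule ennreal_leI)
        have "(norm h)\<^sup>2 \<le> 2 * (norm (h - ?g))\<^sup>2 + 2 * (norm ?g)\<^sup>2"
          using norm_sum_sq_le[of "h - ?g" ?g] by simp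
        then have "2 * real p * (norm h)\<^sup>2 \<le> 2 * real p * (2 * (norm (h - ?g))\<^sup>2 + 2 * (norm ?g)\<^sup>2)"
          by (rule mult_left_mono) simp
        then show "2 * real p * (norm h)\<^sup>2 + (real p)\<^sup>2 * l\<^sup>2 * d\<^sup>2 / 2 \<le> (4 * real p) * (norm (h - ?g))\<^sup>2 + B"
          by (simp add: B_def algebra_simps)
      qed
      also have "\<dots> = (4 * real p) * ennreal ((norm (h - ?g))\<^sup>2) + ennreal B"
        using B by (simp add: ennreal_plus ennreal_mult)
      finally show ?case by (simp add: h_def)
    qed
  qed
  also have "\<dots> = (4 * real p) * (\<integral>\<^sup>+z. ennreal ((norm (gradient_version x z - ?g))\<^sup>2) \<partial>D) + ennreal B"
    using vm by (simp add: nn_integral_add nn_integral_cmult D.emeasure_space_1)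
  also have "(\<integral>\<^sup>+z. ennreal ((norm (gradient_version x z - ?g))\<^sup>2) \<partial>D)
      = (\<integral>\<^sup>+z. ennreal ((norm (grad p (\<lambda>y. F y z) x - ?g))\<^sup>2) \<partial>D)"
    by (rule nn_integral_cong_AE) (use sm in eventually_elim, simp add: gradient_version_eq x)
  also have "(4 * real p) * \<dots> + ennreal B \<le> (4 * real p) * ennreal V + ennreal B"
    by (intro add_mono mult_left_mono var) auto
  also have "\<dots> = ennreal (4 * real p * V + B)"
    using B V by (simp add: ennreal_plus ennreal_mult)
  finally show ?thesis by (simp add: B_def algebra_simps)
qed

context
  fixes d \<sigma>0 \<sigma>1 :: real
  assumes d: "0 < d"
    and var: "\<And>x. x \<in> euclid p \<Longrightarrow>
      (\<integral>\<^sup>+z. ennreal ((norm (grad p (\<lambda>y. F y z) x - grad p mean_obj x))\<^sup>2) \<partial>D)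
        \<le> ennreal (\<sigma>0\<^sup>2 * (norm (grad p mean_obj x))\<^sup>2 + \<sigma>1\<^sup>2)"
begin

lemma zo_grad_second_moment_bound:
  assumes x: "x \<in> euclid p"
  shows "(\<integral>\<^sup>+(u, z). ennreal ((norm (zo_grad p F d x u z))\<^sup>2) \<partial>(uniform_sphere p \<Otimes>\<^sub>M D))
    \<le> ennreal (4 * real p * ((1 + \<sigma>0\<^sup>2) * (norm (grad p mean_obj x))\<^sup>2 + \<sigma>1\<^sup>2) + (real p)\<^sup>2 * l\<^sup>2 * d\<^sup>2 / 2)"
  using zo_grad_second_moment[OF x d _ var[OF x]] by (simp add: algebra_simps)

lemma integrable_zo_grad_sq:
  assumes x: "x \<in> euclid p"
  shows "integrable (uniform_sphere p \<Otimes>\<^sub>M D) (\<lambda>(u, z). (norm (zo_grad p F d x u z))\<^sup>2)"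
proof (rule integrableI_nonneg)
  show "(\<lambda>(u, z). (norm (zo_grad p F d x u z))\<^sup>2) \<in> borel_measurable (uniform_sphere p \<Otimes>\<^sub>M D)"
    using measurable_euclid_borelD[OF measurable_zo_grad_fixed[OF x, of d]] by (simp add: case_prod_beta')
  show "(\<integral>\<^sup>+w. ennreal (case w of (u, z) \<Rightarrow> (norm (zo_grad p F d x u z))\<^sup>2) \<partial>(uniform_sphere p \<Otimes>\<^sub>M D)) < \<infinity>"
    using zo_grad_second_moment_bound[OF x] by (simp add: case_prod_beta' order.strict_trans1)
qed auto

lemma integrable_zo_grad:
  assumes x: "x \<in> euclid p"
  shows "integrable (uniform_sphere p \<Otimes>\<^sub>M D) (\<lambda>(u, z). inner (zo_grad p F d x u z) w)"
proof (rule Bochner_Integration.integrable_bound)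
  show "integrable (uniform_sphere p \<Otimes>\<^sub>M D) (\<lambda>v. (norm w)\<^sup>2 + (case v of (u, z) \<Rightarrow> (norm (zo_grad p F d x u z))\<^sup>2))"
    using integrable_zo_grad_sq[OF x] by (auto simp: SD.emeasure_space_1)
  show "(\<lambda>(u, z). inner (zo_grad p F d x u z) w) \<in> borel_measurable (uniform_sphere p \<Otimes>\<^sub>M D)"
    using measurable_euclid_borelD[OF measurable_zo_grad_fixed[OF x, of d]] by (simp add: case_prod_beta')
  show "AE v in uniform_sphere p \<Otimes>\<^sub>M D. norm (case v of (u, z) \<Rightarrow> inner (zo_grad p F d x u z) w)
      \<le> norm ((norm w)\<^sup>2 + (case v of (u, z) \<Rightarrow> (norm (zo_grad p F d x u z))\<^sup>2))"
  proof (rule AE_I2, clarsimp simp: split_beta')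
    fix u z
    let ?g = "zo_grad p F d x u z"
    have "\<bar>inner ?g w\<bar> \<le> norm ?g * norm w" by (rule Cauchy_Schwarz_ineq2)
    also have "\<dots> \<le> (norm w)\<^sup>2 + (norm ?g)\<^sup>2"
      using sum_squares_bound[of "norm ?g" "norm w"] zero_le_power2[of "norm ?g"] zero_le_power2[of "norm w"] by linarith
    finally show "\<bar>inner ?g w\<bar> \<le> (norm w)\<^sup>2 + (norm ?g)\<^sup>2" .
  qed
qed

text \<open>This plays the role of the conditional mean of the estimator given the iterate. It is
  assembled from coordinates because the space of finitely supported sequences is not
  complete.\<close>

definition zo_mean :: "(nat \<Rightarrow>\<^sub>0 real) \<Rightarrow> (nat \<Rightarrow>\<^sub>0 real)" where
  "zo_mean x = of_coords p (\<lambda>c. \<integral>(u, z). inner (zo_grad p F d x u z) (axis c) \<partial>(uniform_sphere p \<Otimes>\<^sub>M D))"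

lemma zo_mean_in: "zo_mean x \<in> euclid p"
  by (simp add: zo_mean_def of_coords_in_euclid)

lemma zo_grad_in: "u \<in> euclid p \<Longrightarrow> zo_grad p F d x u z \<in> euclid p"
  by (simp add: zo_grad_def euclid_scaleR)

lemma inner_zo_mean:
  assumes x: "x \<in> euclid p" and w: "w \<in> euclid p"
  shows "inner (zo_mean x) w = (\<integral>(u, z). inner (zo_grad p F d x u z) w \<partial>(uniform_sphere p \<Otimes>\<^sub>M D))"
proof -
  let ?P = "uniform_sphere p \<Otimes>\<^sub>M D"
  have "inner (zo_mean x) w
      = (\<Sum>c<p. (\<integral>(u, z). inner (zo_grad p F d x u z) (axis c) \<partial>?P) * Poly_Mapping.lookup w c)"
    by (simp add: inner_euclid[OF zo_mean_in]) (simp add: zo_mean_def lookup_of_coords)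
  also have "\<dots> = (\<Sum>c<p. (\<integral>v. (case v of (u, z) \<Rightarrow> inner (zo_grad p F d x u z) (axis c)) * Poly_Mapping.lookup w c \<partial>?P))"
    by simp
  also have "\<dots> = (\<integral>v. (\<Sum>c<p. (case v of (u, z) \<Rightarrow> inner (zo_grad p F d x u z) (axis c)) * Poly_Mapping.lookup w c) \<partial>?P)"
    by (rule Bochner_Integration.integral_sum[symmetric]) (auto intro!: integrable_mult_left integrable_zo_grad x)
  also have "\<dots> = (\<integral>(u, z). inner (zo_grad p F d x u z) w \<partial>?P)"
    by (rule Bochner_Integration.integral_cong)
      (auto simp: inner_axis inner_euclid[OF zo_grad_in] space_pair_measure)
  finally show ?thesis .
qed

text \<open>With the sample innermost in Fubini, the estimator becomes the spherical difference
  quotient of the mean objective. That function is smooth with the same constant, so the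
  deterministic bias bound applies.\<close>

lemma zo_mean_bias:
  assumes x: "x \<in> euclid p"
  shows "norm (zo_mean x - grad p mean_obj x) \<le> l * d"
proof (rule norm_le_inner_bound[OF euclid_diff[OF zo_mean_in smooth_grad_in[OF smooth_mean_obj x]]])
  fix w assume w: "w \<in> euclid p"
  have "inner (zo_mean x) w = (\<integral>u. (\<integral>z. inner (zo_grad p F d x u z) w \<partial>D) \<partial>uniform_sphere p)"
    unfolding inner_zo_mean[OF x w]
    using SD.integral_fst'[OF integrable_zo_grad[OF x, of w]] by simp
  also have "\<dots> = (\<integral>u. inner w ((p * (mean_obj (x + d *\<^sub>R u) - mean_obj x) / d) *\<^sub>R u) \<partial>uniform_sphere p)"
  proof (rule Bochner_Integration.integral_cong[OF refl])
    fix u assume "u \<in> space (uniform_sphere p)"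
    then have u: "x + d *\<^sub>R u \<in> euclid p" using x by (simp add: euclid_add euclid_scaleR)
    show "(\<integral>z. inner (zo_grad p F d x u z) w \<partial>D) = inner w ((p * (mean_obj (x + d *\<^sub>R u) - mean_obj x) / d) *\<^sub>R u)"
      using Fi[OF x] Fi[OF u] by (simp add: zo_grad_def inner_commute)
  qed
  finally have "\<bar>inner (zo_mean x) w - inner (grad p mean_obj x) w\<bar> \<le> l * d * norm w"
    using zo_bias[OF smooth_mean_obj p x d w] by simp
  then show "inner (zo_mean x - grad p mean_obj x) w \<le> l * d * norm w" by (simp add: inner_diff_left)
qed (use l d in auto)

lemma measurable_zo_mean: "zo_mean \<in> measurable (euclid_borel p) (euclid_borel p)"
  unfolding zo_mean_def[abs_def]
proof (rule measurable_of_coords)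
  fix c
  have "id \<in> measurable (euclid_borel p \<Otimes>\<^sub>M (uniform_sphere p \<Otimes>\<^sub>M D)) (euclid_borel p \<Otimes>\<^sub>M (euclid_borel p \<Otimes>\<^sub>M D))"
    unfolding id_def by (intro measurable_ident_sets sets_pair_measure_cong) (auto simp: sets_uniform_sphere)
  from measurable_compose[OF this measurable_zo_grad[of d]]
  have "(\<lambda>w. zo_grad p F d (fst w) (fst (snd w)) (snd (snd w))) \<in> borel_measurable (euclid_borel p \<Otimes>\<^sub>M (uniform_sphere p \<Otimes>\<^sub>M D))"
    by (simp add: case_prod_beta' measurable_euclid_borelD)
  then have "(\<lambda>(x, v). case v of (u, z) \<Rightarrow> inner (zo_grad p F d x u z) (axis c))
      \<in> borel_measurable (euclid_borel p \<Otimes>\<^sub>M (uniform_sphere p \<Otimes>\<^sub>M D))"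
    by (simp add: case_prod_beta')
  then show "(\<lambda>x. \<integral>(u, z). inner (zo_grad p F d x u z) (axis c) \<partial>(uniform_sphere p \<Otimes>\<^sub>M D)) \<in> borel_measurable (euclid_borel p)"
    by (rule SD.borel_measurable_lebesgue_integral)
qed

end

end

section \<open>Independence of the draws\<close>

text \<open>Rectangles determine a product of probability measures. The two variables may take
  values in different types, as directions and samples do.\<close>

lemma (in prob_space) distr_Pair_indep:
  assumes X: "X \<in> measurable M N1" and Y: "Y \<in> measurable M N2"
    and indep: "\<And>A B. A \<in> sets N1 \<Longrightarrow> B \<in> sets N2 \<Longrightarrow>
      prob ((X -` A \<inter> space M) \<inter> (Y -` B \<inter> space M)) = prob (X -` A \<inter> space M) * prob (Y -` B \<inter> space M)"
  shows "distr M (N1 \<Otimes>\<^sub>M N2) (\<lambda>\<omega>. (X \<omega>, Y \<omega>)) = distr M N1 X \<Otimes>\<^sub>M distr M N2 Y"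
proof (rule pair_measure_eqI[symmetric])
  show "sigma_finite_measure (distr M N1 X)" "sigma_finite_measure (distr M N2 Y)"
    using prob_space_distr[OF X] prob_space_distr[OF Y] by (simp_all add: prob_space_imp_sigma_finite)
  show "sets (distr M N1 X \<Otimes>\<^sub>M distr M N2 Y) = sets (distr M (N1 \<Otimes>\<^sub>M N2) (\<lambda>\<omega>. (X \<omega>, Y \<omega>)))"
    by (simp cong: sets_pair_measure_cong)
  fix A B assume "A \<in> sets (distr M N1 X)" "B \<in> sets (distr M N2 Y)"
  then have AB: "A \<in> sets N1" "B \<in> sets N2" by auto
  have "emeasure (distr M (N1 \<Otimes>\<^sub>M N2) (\<lambda>\<omega>. (X \<omega>, Y \<omega>))) (A \<times> B)
      = emeasure M ((\<lambda>\<omega>. (X \<omega>, Y \<omega>)) -` (A \<times> B) \<inter> space M)"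
    using X Y AB by (intro emeasure_distr) auto
  also have "(\<lambda>\<omega>. (X \<omega>, Y \<omega>)) -` (A \<times> B) \<inter> space M = (X -` A \<inter> space M) \<inter> (Y -` B \<inter> space M)" by auto
  also have "emeasure M \<dots> = emeasure M (X -` A \<inter> space M) * emeasure M (Y -` B \<inter> space M)"
    using indep[OF AB] by (simp add: emeasure_eq_measure ennreal_mult)
  also have "\<dots> = emeasure (distr M N1 X) A * emeasure (distr M N2 Y) B"
    using X Y AB by (simp add: emeasure_distr)
  finally show "emeasure (distr M N1 X) A * emeasure (distr M N2 Y) B
      = emeasure (distr M (N1 \<Otimes>\<^sub>M N2) (\<lambda>\<omega>. (X \<omega>, Y \<omega>))) (A \<times> B)" ..
qed

section \<open>Square-integrable random vectors\<close>

lemma integrable_inner_of_sq: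
  fixes X Y :: "'a \<Rightarrow> (nat \<Rightarrow>\<^sub>0 real)"
  assumes "X \<in> borel_measurable M" "Y \<in> borel_measurable M"
    and "integrable M (\<lambda>\<omega>. (norm (X \<omega>))\<^sup>2)" "integrable M (\<lambda>\<omega>. (norm (Y \<omega>))\<^sup>2)"
  shows "integrable M (\<lambda>\<omega>. inner (X \<omega>) (Y \<omega>))"
proof (rule Bochner_Integration.integrable_bound)
  show "integrable M (\<lambda>\<omega>. (norm (X \<omega>))\<^sup>2 + (norm (Y \<omega>))\<^sup>2)" using assms by auto
  show "(\<lambda>\<omega>. inner (X \<omega>) (Y \<omega>)) \<in> borel_measurable M" using assms by measurable
  show "AE \<omega> in M. norm (inner (X \<omega>) (Y \<omega>)) \<le> norm ((norm (X \<omega>))\<^sup>2 + (norm (Y \<omega>))\<^sup>2)"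
  proof (rule AE_I2)
    fix \<omega>
    have "\<bar>inner (X \<omega>) (Y \<omega>)\<bar> \<le> norm (X \<omega>) * norm (Y \<omega>)" by (rule Cauchy_Schwarz_ineq2)
    also have "\<dots> \<le> (norm (X \<omega>))\<^sup>2 + (norm (Y \<omega>))\<^sup>2"
      using sum_squares_bound[of "norm (X \<omega>)" "norm (Y \<omega>)"] zero_le_power2[of "norm (X \<omega>)"]
        zero_le_power2[of "norm (Y \<omega>)"] by linarith
    finally show "norm (inner (X \<omega>) (Y \<omega>)) \<le> norm ((norm (X \<omega>))\<^sup>2 + (norm (Y \<omega>))\<^sup>2)" by simp
  qed
qed

lemma integrable_sq_bound:
  fixes X :: "'a \<Rightarrow> (nat \<Rightarrow>\<^sub>0 real)"
  assumes "X \<in> borel_measurable M" "integrable M B" "\<And>\<omega>. \<omega> \<in> space M \<Longrightarrow> (norm (X \<omega>))\<^sup>2 \<le> B \<omega>"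
  shows "integrable M (\<lambda>\<omega>. (norm (X \<omega>))\<^sup>2)"
proof (rule Bochner_Integration.integrable_bound[OF assms(2)])
  show "(\<lambda>\<omega>. (norm (X \<omega>))\<^sup>2) \<in> borel_measurable M" using assms(1) by measurable
  show "AE \<omega> in M. norm ((norm (X \<omega>))\<^sup>2) \<le> norm (B \<omega>)"
    using assms(3) by (intro AE_I2) (auto intro: order_trans[OF _ abs_ge_self])
qed

lemma integrable_sq_add:
  fixes X Y :: "'a \<Rightarrow> (nat \<Rightarrow>\<^sub>0 real)"
  assumes "X \<in> borel_measurable M" "Y \<in> borel_measurable M"
    and "integrable M (\<lambda>\<omega>. (norm (X \<omega>))\<^sup>2)" "integrable M (\<lambda>\<omega>. (norm (Y \<omega>))\<^sup>2)"
  shows "integrable M (\<lambda>\<omega>. (norm (X \<omega> + Y \<omega>))\<^sup>2)"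
  by (rule integrable_sq_bound[where B = "\<lambda>\<omega>. 2 * (norm (X \<omega>))\<^sup>2 + 2 * (norm (Y \<omega>))\<^sup>2"])
    (use assms norm_sum_sq_le in auto)

lemma integrable_sq_scaleR:
  fixes X :: "'a \<Rightarrow> (nat \<Rightarrow>\<^sub>0 real)"
  assumes "integrable M (\<lambda>\<omega>. (norm (X \<omega>))\<^sup>2)"
  shows "integrable M (\<lambda>\<omega>. (norm (c *\<^sub>R X \<omega>))\<^sup>2)"
  using assms by (simp add: power_mult_distrib)

lemma integrable_sq_diff:
  fixes X Y :: "'a \<Rightarrow> (nat \<Rightarrow>\<^sub>0 real)"
  assumes "X \<in> borel_measurable M" "Y \<in> borel_measurable M"
    and "integrable M (\<lambda>\<omega>. (norm (X \<omega>))\<^sup>2)" "integrable M (\<lambda>\<omega>. (norm (Y \<omega>))\<^sup>2)"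
  shows "integrable M (\<lambda>\<omega>. (norm (X \<omega> - Y \<omega>))\<^sup>2)"
  using integrable_sq_add[of X M "\<lambda>\<omega>. - Y \<omega>"] assms by simp

lemma integrable_sq_sum:
  fixes X :: "'i \<Rightarrow> 'a \<Rightarrow> (nat \<Rightarrow>\<^sub>0 real)"
  assumes "finite I" "\<And>i. i \<in> I \<Longrightarrow> X i \<in> borel_measurable M"
    and "\<And>i. i \<in> I \<Longrightarrow> integrable M (\<lambda>\<omega>. (norm (X i \<omega>))\<^sup>2)"
  shows "integrable M (\<lambda>\<omega>. (norm (\<Sum>i\<in>I. X i \<omega>))\<^sup>2)"
  using assms
proof (induction I rule: finite_induct)
  case (insert i I)
  have "(\<lambda>\<omega>. \<Sum>i\<in>I. X i \<omega>) \<in> borel_measurable M" using insert by (intro borel_measurable_sum) auto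
  then show ?case using insert by (simp add: integrable_sq_add)
qed simp

section \<open>The iterates as random variables\<close>

locale zo_algorithm =
  fixes n p :: nat and a :: "nat \<Rightarrow> nat \<Rightarrow> real"
    and D :: "nat \<Rightarrow> 'z measure" and F :: "nat \<Rightarrow> (nat \<Rightarrow>\<^sub>0 real) \<Rightarrow> 'z \<Rightarrow> real"
    and M :: "'w measure" and u :: "nat \<Rightarrow> nat \<Rightarrow> 'w \<Rightarrow> (nat \<Rightarrow>\<^sub>0 real)" and \<xi> :: "nat \<Rightarrow> nat \<Rightarrow> 'w \<Rightarrow> 'z"
    and x0 :: "nat \<Rightarrow> (nat \<Rightarrow>\<^sub>0 real)" and \<eta> :: "nat \<Rightarrow> real" and \<delta> :: "nat \<Rightarrow> nat \<Rightarrow> real"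
    and \<gamma> Lf \<sigma>0 \<sigma>1 :: real
  assumes n: "1 \<le> n" and p: "1 \<le> p" and Lf: "0 < Lf"
    and sf: "stochastic_functions p n D F"
    and smF: "\<And>i. i < n \<Longrightarrow> AE z in D i. smooth p Lf (\<lambda>y. F i y z)"
    and bv: "bounded_variance p n D F \<sigma>0 \<sigma>1"
    and draws: "random_draws M p n D u \<xi>"
    and x0: "\<And>i. i < n \<Longrightarrow> x0 i \<in> euclid p"
    and \<delta>: "\<And>i k. i < n \<Longrightarrow> 0 < \<delta> i k"
begin

lemma agent:
  assumes "i < n"
  shows "prob_space (D i)" "(\<lambda>(x, z). F i x z) \<in> borel_measurable (euclid_borel p \<Otimes>\<^sub>M D i)"
    "\<And>x. x \<in> euclid p \<Longrightarrow> integrable (D i) (F i x)"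
  using sf assms by (auto simp: stochastic_functions_def)

lemma agent_facts:
  assumes "i < n"
  shows "prob_space (D i)" "0 \<le> Lf" "1 \<le> p" "(\<lambda>(x, z). F i x z) \<in> borel_measurable (euclid_borel p \<Otimes>\<^sub>M D i)"
    "\<And>x. x \<in> euclid p \<Longrightarrow> integrable (D i) (F i x)" "AE z in D i. smooth p Lf (\<lambda>y. F i y z)"
  using agent[OF assms] Lf p smF[OF assms] by auto

sublocale M: prob_space M
  using draws by (simp add: random_draws_def)

lemma measurable_u: "i < n \<Longrightarrow> u i k \<in> measurable M (euclid_borel p)"
  and distr_u: "i < n \<Longrightarrow> distr M (euclid_borel p) (u i k) = uniform_sphere p"
  and measurable_\<xi>: "i < n \<Longrightarrow> \<xi> i k \<in> measurable M (D i)"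
  and distr_\<xi>: "i < n \<Longrightarrow> distr M (D i) (\<xi> i k) = D i"
  using draws by (auto simp: random_draws_def)

abbreviation "fl i \<equiv> local_obj D F i"

lemma fl_eq: "fl i = (\<lambda>x. \<integral>z. F i x z \<partial>D i)"
  by (simp add: local_obj_def fun_eq_iff)

lemma smooth_fl: "i < n \<Longrightarrow> smooth p Lf (fl i)"
  unfolding fl_eq by (rule smooth_mean_obj) (rule agent_facts, assumption+)+

definition x :: "nat \<Rightarrow> 'w \<Rightarrow> nat \<Rightarrow> (nat \<Rightarrow>\<^sub>0 real)" where
  "x k \<omega> = zo_iter p n a F \<gamma> \<eta> \<delta> x0 (\<lambda>i l. u i l \<omega>) (\<lambda>i l. \<xi> i l \<omega>) k"

definition g :: "nat \<Rightarrow> 'w \<Rightarrow> nat \<Rightarrow> (nat \<Rightarrow>\<^sub>0 real)" where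
  "g k \<omega> i = zo_grad p (F i) (\<delta> i k) (x k \<omega> i) (u i k \<omega>) (\<xi> i k \<omega>)"

definition m :: "nat \<Rightarrow> 'w \<Rightarrow> nat \<Rightarrow> (nat \<Rightarrow>\<^sub>0 real)" where
  "m k \<omega> i = zo_mean p (D i) (F i) (\<delta> i k) (x k \<omega> i)"

lemma x_0: "x 0 \<omega> = x0" by (simp add: x_def)

lemma x_Suc: "x (Suc k) \<omega> i
    = x k \<omega> i - \<gamma> *\<^sub>R (\<Sum>j<n. (laplacian n a $$ (i, j)) *\<^sub>R x k \<omega> j) - \<eta> k *\<^sub>R g k \<omega> i"
  by (simp add: x_def g_def Let_def)

lemma measurable_g_gen:
  assumes "i < n" "(\<lambda>\<omega>. x k \<omega> i) \<in> measurable H (euclid_borel p)" "u i k \<in> measurable H (euclid_borel p)"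
    "\<xi> i k \<in> measurable H (D i)"
  shows "(\<lambda>\<omega>. g k \<omega> i) \<in> measurable H (euclid_borel p)"
  using measurable_compose[OF measurable_Pair[OF assms(2) measurable_Pair[OF assms(3,4)]]
      measurable_zo_grad[OF agent_facts[OF assms(1)], of "\<delta> i k"]] assms(1)
  unfolding g_def by simp

text \<open>\<open>H\<close> is arbitrary so that one induction serves both \<open>M\<close> and the
  sigma-algebras of selected draws. The condition \<open>l < k\<close> records that the iterate at
  time \<open>k\<close> has not yet seen the draws of iteration \<open>k\<close>.\<close>

lemma measurable_x_gen:
  assumes "\<And>j l. j < n \<Longrightarrow> l < k \<Longrightarrow> u j l \<in> measurable H (euclid_borel p)"
    and "\<And>j l. j < n \<Longrightarrow> l < k \<Longrightarrow> \<xi> j l \<in> measurable H (D j)"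
    and "i < n"
  shows "(\<lambda>\<omega>. x k \<omega> i) \<in> measurable H (euclid_borel p)"
  using assms
proof (induction k arbitrary: i)
  case 0
  then show ?case by (simp add: x_0 x0)
next
  case (Suc k)
  have IH: "(\<lambda>\<omega>. x k \<omega> j) \<in> measurable H (euclid_borel p)" if "j < n" for j
    using Suc that by auto
  have gm: "(\<lambda>\<omega>. g k \<omega> i) \<in> measurable H (euclid_borel p)"
    by (rule measurable_g_gen[OF Suc.prems(3) IH]) (use Suc.prems in auto)
  show ?case
    unfolding measurable_euclid_borel_iff
  proof
    show "(\<lambda>\<omega>. x (Suc k) \<omega> i) \<in> borel_measurable H"
      unfolding x_Suc using Suc.prems(3)
      by (intro borel_measurable_diff borel_measurable_scaleR borel_measurable_sum borel_measurable_const
          measurable_euclid_borelD[OF IH] measurable_euclid_borelD[OF gm]) auto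
    show "\<forall>\<omega>\<in>space H. x (Suc k) \<omega> i \<in> euclid p"
      unfolding x_Suc using Suc.prems(3) measurable_space[OF gm] measurable_space[OF IH]
      by (auto intro!: euclid_diff euclid_scaleR euclid_sum)
  qed
qed

section \<open>Sigma-algebras of the draws and freezing\<close>

abbreviation "draw_idx \<equiv> ({..<n} \<times> (UNIV :: nat set)) <+> ({..<n} \<times> (UNIV :: nat set))"

definition draw_alg :: "nat \<times> nat + nat \<times> nat \<Rightarrow> 'w set set" where
  "draw_alg = case_sum
          (\<lambda>(i, k). sets (vimage_algebra (space M) (u i k) (euclid_borel p)))
          (\<lambda>(i, k). sets (vimage_algebra (space M) (\<xi> i k) (D i)))"

lemma indep_draw_alg: "M.indep_sets draw_alg draw_idx"
  using draws by (simp add: random_draws_def draw_alg_def)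

lemma draw_alg_events: "j \<in> draw_idx \<Longrightarrow> draw_alg j \<subseteq> M.events"
  using indep_draw_alg by (auto simp: M.indep_sets_def)

lemma Int_stable_draw_alg: "Int_stable (draw_alg j)"
  by (cases j) (auto simp: draw_alg_def Int_stable_def split: prod.splits)

text \<open>Only the sigma-algebra of this measure space is of interest; probabilities are always
  taken in \<open>M\<close>.\<close>

definition alg :: "(nat \<times> nat + nat \<times> nat) set \<Rightarrow> 'w measure" where
  "alg J = sigma (space M) (\<Union>j\<in>J. draw_alg j)"

lemma space_alg[simp]: "space (alg J) = space M"
  by (simp add: alg_def space_measure_of_conv)

lemma draw_alg_space: "j \<in> draw_idx \<Longrightarrow> draw_alg j \<subseteq> Pow (space M)"
  using draw_alg_events[of j] sets.space_closed[of M] by blast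

lemma sets_alg: "J \<subseteq> draw_idx \<Longrightarrow> sets (alg J) = sigma_sets (space M) (\<Union>j\<in>J. draw_alg j)"
  unfolding alg_def by (rule sets_measure_of) (use draw_alg_space in blast)

lemma sets_alg_events: "J \<subseteq> draw_idx \<Longrightarrow> sets (alg J) \<subseteq> M.events"
  unfolding sets_alg by (rule sets.sigma_sets_subset) (use draw_alg_events in blast)

lemma measurable_alg_imp:
  assumes "J \<subseteq> draw_idx" "f \<in> measurable (alg J) N" shows "f \<in> measurable M N"
proof (rule measurableI)
  show "f w \<in> space N" if "w \<in> space M" for w using measurable_space[OF assms(2)] that by simp
  show "f -` A \<inter> space M \<in> M.events" if "A \<in> sets N" for A
    using measurable_sets[OF assms(2) that] sets_alg_events[OF assms(1)] by auto
qed

lemma measurable_u_alg: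
  assumes "J \<subseteq> draw_idx" "Inl (i, k) \<in> J"
  shows "u i k \<in> measurable (alg J) (euclid_borel p)"
proof (rule measurableI)
  have i: "i < n" using assms by auto
  show "u i k w \<in> space (euclid_borel p)" if "w \<in> space (alg J)" for w
    using measurable_space[OF measurable_u[OF i]] that by simp
  show "u i k -` A \<inter> space (alg J) \<in> sets (alg J)" if "A \<in> sets (euclid_borel p)" for A
  proof -
    have "u i k -` A \<inter> space M \<in> draw_alg (Inl (i, k))"
      unfolding draw_alg_def using that by (auto intro: in_vimage_algebra)
    then show ?thesis unfolding sets_alg[OF assms(1)] space_alg using assms(2) by (intro sigma_sets.Basic) blast
  qed
qed

lemma measurable_\<xi>_alg:
  assumes "J \<subseteq> draw_idx" "Inr (i, k) \<in> J"
  shows "\<xi> i k \<in> measurable (alg J) (D i)"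
proof (rule measurableI)
  have i: "i < n" using assms by auto
  show "\<xi> i k w \<in> space (D i)" if "w \<in> space (alg J)" for w
    using measurable_space[OF measurable_\<xi>[OF i]] that by simp
  show "\<xi> i k -` A \<inter> space (alg J) \<in> sets (alg J)" if "A \<in> sets (D i)" for A
  proof -
    have "\<xi> i k -` A \<inter> space M \<in> draw_alg (Inr (i, k))"
      unfolding draw_alg_def using that by (auto intro: in_vimage_algebra)
    then show ?thesis unfolding sets_alg[OF assms(1)] space_alg using assms(2) by (intro sigma_sets.Basic) blast
  qed
qed

text \<open>The complement contains, besides the past, the simultaneous draws of the other agents.
  Cross terms of two estimators of the same iteration require this.\<close>

abbreviation "own i k \<equiv> {Inl (i, k), Inr (i, k)} :: (nat \<times> nat + nat \<times> nat) set"
abbreviation "others i k \<equiv> draw_idx - own i k"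

lemma own_subset: "i < n \<Longrightarrow> own i k \<subseteq> draw_idx" by auto

text \<open>Disjoint blocks of an independent family generate independent sigma-algebras; the two
  blocks are indexed by the truth values.\<close>

lemma indep_own_others:
  assumes i: "i < n" and A: "A \<in> sets (alg (others i k))" and B: "B \<in> sets (alg (own i k))"
  shows "M.prob (A \<inter> B) = M.prob A * M.prob B"
proof -
  define I where "I b = (if b then others i k else own i k)" for b
  have U: "(\<Union>b\<in>UNIV. I b) = draw_idx" using own_subset[OF i, of k] by (auto simp: I_def UNIV_bool)
  have "M.indep_sets (\<lambda>b. sigma_sets (space M) (\<Union>j\<in>I b. draw_alg j)) UNIV"
  proof (rule M.indep_sets_collect_sigma)
    show "M.indep_sets draw_alg (\<Union>b\<in>UNIV. I b)" unfolding U by (rule indep_draw_alg)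
    show "Int_stable (draw_alg j)" for j by (rule Int_stable_draw_alg)
    show "disjoint_family_on I UNIV" by (auto simp: disjoint_family_on_def I_def)
  qed
  from M.indep_setsD[OF this, of UNIV "\<lambda>b. if b then A else B"] A B own_subset[OF i, of k]
  show ?thesis by (simp add: UNIV_bool I_def sets_alg Int_ac mult_ac)
qed

lemma distr_draw:
  assumes i: "i < n"
  shows "distr M (euclid_borel p \<Otimes>\<^sub>M D i) (\<lambda>\<omega>. (u i k \<omega>, \<xi> i k \<omega>)) = uniform_sphere p \<Otimes>\<^sub>M D i"
proof -
  have "distr M (euclid_borel p \<Otimes>\<^sub>M D i) (\<lambda>\<omega>. (u i k \<omega>, \<xi> i k \<omega>))
      = distr M (euclid_borel p) (u i k) \<Otimes>\<^sub>M distr M (D i) (\<xi> i k)"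
  proof (rule M.distr_Pair_indep[OF measurable_u[OF i] measurable_\<xi>[OF i]])
    fix A B assume A: "A \<in> sets (euclid_borel p)" and B: "B \<in> sets (D i)"
    define W where "W j = (case j of Inl _ \<Rightarrow> u i k -` A \<inter> space M | Inr _ \<Rightarrow> \<xi> i k -` B \<inter> space M)"
      for j :: "nat \<times> nat + nat \<times> nat"
    have "\<forall>j\<in>own i k. W j \<in> draw_alg j"
      unfolding W_def draw_alg_def using A B by (auto intro: in_vimage_algebra)
    from M.indep_setsD[OF indep_draw_alg own_subset[OF i] _ _ this]
    show "M.prob ((u i k -` A \<inter> space M) \<inter> (\<xi> i k -` B \<inter> space M))
        = M.prob (u i k -` A \<inter> space M) * M.prob (\<xi> i k -` B \<inter> space M)"
      by (simp add: W_def)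
  qed
  then show ?thesis by (simp add: distr_u distr_\<xi> i)
qed

lemma distr_freeze:
  assumes i: "i < n" and W: "W \<in> measurable (alg (others i k)) N"
  shows "distr M (N \<Otimes>\<^sub>M (euclid_borel p \<Otimes>\<^sub>M D i)) (\<lambda>\<omega>. (W \<omega>, (u i k \<omega>, \<xi> i k \<omega>)))
    = distr M N W \<Otimes>\<^sub>M (uniform_sphere p \<Otimes>\<^sub>M D i)"
proof -
  have Y: "(\<lambda>\<omega>. (u i k \<omega>, \<xi> i k \<omega>)) \<in> measurable (alg (own i k)) (euclid_borel p \<Otimes>\<^sub>M D i)"
    using own_subset[OF i] by (intro measurable_Pair measurable_u_alg measurable_\<xi>_alg) auto
  have "distr M (N \<Otimes>\<^sub>M (euclid_borel p \<Otimes>\<^sub>M D i)) (\<lambda>\<omega>. (W \<omega>, (u i k \<omega>, \<xi> i k \<omega>)))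
    = distr M N W \<Otimes>\<^sub>M distr M (euclid_borel p \<Otimes>\<^sub>M D i) (\<lambda>\<omega>. (u i k \<omega>, \<xi> i k \<omega>))"
  proof (rule M.distr_Pair_indep)
    show "W \<in> measurable M N" using measurable_alg_imp[OF _ W] by auto
    show "(\<lambda>\<omega>. (u i k \<omega>, \<xi> i k \<omega>)) \<in> measurable M (euclid_borel p \<Otimes>\<^sub>M D i)"
      by (rule measurable_alg_imp[OF own_subset[OF i] Y])
    fix A B assume "A \<in> sets N" "B \<in> sets (euclid_borel p \<Otimes>\<^sub>M D i)"
    from measurable_sets[OF W this(1)] measurable_sets[OF Y this(2)]
    show "M.prob ((W -` A \<inter> space M) \<inter> ((\<lambda>\<omega>. (u i k \<omega>, \<xi> i k \<omega>)) -` B \<inter> space M))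
        = M.prob (W -` A \<inter> space M) * M.prob ((\<lambda>\<omega>. (u i k \<omega>, \<xi> i k \<omega>)) -` B \<inter> space M)"
      by (intro indep_own_others[OF i]) simp_all
  qed
  then show ?thesis by (simp add: distr_draw i)
qed

text \<open>This replaces conditioning on \<open>W\<close>: the joint law of \<open>W\<close> and
  the draw is a product, so Fubini integrates the draw with \<open>W\<close> held fixed. The version
  for nonnegative integrals is usable before integrability is known.\<close>

lemma
  fixes \<phi> :: "'n \<times> (nat \<Rightarrow>\<^sub>0 real) \<times> 'z \<Rightarrow> real"
  assumes i: "i < n" and W: "W \<in> measurable (alg (others i k)) N"
    and \<phi>: "\<phi> \<in> borel_measurable (N \<Otimes>\<^sub>M (euclid_borel p \<Otimes>\<^sub>M D i))"
  shows nn_integral_freeze: "(\<integral>\<^sup>+\<omega>. ennreal (\<phi> (W \<omega>, u i k \<omega>, \<xi> i k \<omega>)) \<partial>M)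
      = (\<integral>\<^sup>+\<omega>. (\<integral>\<^sup>+y. ennreal (\<phi> (W \<omega>, y)) \<partial>(uniform_sphere p \<Otimes>\<^sub>M D i)) \<partial>M)"
    and integral_freeze: "integrable M (\<lambda>\<omega>. \<phi> (W \<omega>, u i k \<omega>, \<xi> i k \<omega>)) \<Longrightarrow>
      (\<integral>\<omega>. \<phi> (W \<omega>, u i k \<omega>, \<xi> i k \<omega>) \<partial>M) = (\<integral>\<omega>. (\<integral>y. \<phi> (W \<omega>, y) \<partial>(uniform_sphere p \<Otimes>\<^sub>M D i)) \<partial>M)"
proof -
  interpret Di: prob_space "D i" by (rule agent(1)[OF i])
  interpret S: prob_space "uniform_sphere p" by (rule prob_space_uniform_sphere)
  interpret SD: pair_prob_space "uniform_sphere p" "D i" by standard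
  have WM: "W \<in> measurable M N" using measurable_alg_imp[OF _ W] by auto
  interpret NW: prob_space "distr M N W" by (rule M.prob_space_distr[OF WM])
  let ?E = "euclid_borel p \<Otimes>\<^sub>M D i" and ?S = "uniform_sphere p \<Otimes>\<^sub>M D i"
  interpret P: pair_prob_space "distr M N W" ?S by standard
  have Y: "(\<lambda>\<omega>. (u i k \<omega>, \<xi> i k \<omega>)) \<in> measurable M ?E"
    using measurable_u[OF i] measurable_\<xi>[OF i] by (intro measurable_Pair)
  have T: "(\<lambda>\<omega>. (W \<omega>, (u i k \<omega>, \<xi> i k \<omega>))) \<in> measurable M (N \<Otimes>\<^sub>M ?E)"
    by (rule measurable_Pair[OF WM Y])
  have s1: "sets (N \<Otimes>\<^sub>M ?S) = sets (N \<Otimes>\<^sub>M ?E)"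
    by (intro sets_pair_measure_cong) (simp_all add: sets_uniform_sphere)
  have s2: "sets (distr M N W \<Otimes>\<^sub>M ?S) = sets (N \<Otimes>\<^sub>M ?E)"
    by (intro sets_pair_measure_cong) (simp_all add: sets_uniform_sphere)
  have \<phi>1: "\<phi> \<in> borel_measurable (N \<Otimes>\<^sub>M ?S)" and \<phi>2: "\<phi> \<in> borel_measurable (distr M N W \<Otimes>\<^sub>M ?S)"
    using \<phi> by (simp_all add: measurable_cong_sets[OF s1 refl] measurable_cong_sets[OF s2 refl])
  have "(\<integral>\<^sup>+\<omega>. ennreal (\<phi> (W \<omega>, u i k \<omega>, \<xi> i k \<omega>)) \<partial>M)
      = (\<integral>\<^sup>+v. ennreal (\<phi> v) \<partial>distr M (N \<Otimes>\<^sub>M ?E) (\<lambda>\<omega>. (W \<omega>, (u i k \<omega>, \<xi> i k \<omega>))))"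
    using T \<phi> by (simp add: nn_integral_distr)
  also have "\<dots> = (\<integral>\<^sup>+w. (\<integral>\<^sup>+y. ennreal (\<phi> (w, y)) \<partial>?S) \<partial>distr M N W)"
    unfolding distr_freeze[OF i W] using \<phi>2 by (intro SD.nn_integral_fst[symmetric]) simp
  also have "\<dots> = (\<integral>\<^sup>+\<omega>. (\<integral>\<^sup>+y. ennreal (\<phi> (W \<omega>, y)) \<partial>?S) \<partial>M)"
    by (rule nn_integral_distr[OF WM]) (use SD.borel_measurable_nn_integral_fst[of "\<lambda>v. ennreal (\<phi> v)" N] \<phi>1 in simp)
  finally show "(\<integral>\<^sup>+\<omega>. ennreal (\<phi> (W \<omega>, u i k \<omega>, \<xi> i k \<omega>)) \<partial>M)
      = (\<integral>\<^sup>+\<omega>. (\<integral>\<^sup>+y. ennreal (\<phi> (W \<omega>, y)) \<partial>?S) \<partial>M)" .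
  assume int: "integrable M (\<lambda>\<omega>. \<phi> (W \<omega>, u i k \<omega>, \<xi> i k \<omega>))"
  have int': "integrable (distr M N W \<Otimes>\<^sub>M ?S) \<phi>"
    unfolding distr_freeze[OF i W, symmetric] by (subst integrable_distr_eq[OF T \<phi>]) (rule int)
  have "(\<integral>\<omega>. \<phi> (W \<omega>, u i k \<omega>, \<xi> i k \<omega>) \<partial>M)
      = (\<integral>v. \<phi> v \<partial>distr M (N \<Otimes>\<^sub>M ?E) (\<lambda>\<omega>. (W \<omega>, (u i k \<omega>, \<xi> i k \<omega>))))"
    by (rule integral_distr[OF T \<phi>, symmetric])
  also have "\<dots> = (\<integral>w. (\<integral>y. \<phi> (w, y) \<partial>?S) \<partial>distr M N W)"
    unfolding distr_freeze[OF i W] by (rule P.integral_fst'[OF int', symmetric])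
  also have "\<dots> = (\<integral>\<omega>. (\<integral>y. \<phi> (W \<omega>, y) \<partial>?S) \<partial>M)"
    by (rule integral_distr[OF WM])
      (use SD.borel_measurable_lebesgue_integral[of "\<lambda>w y. \<phi> (w, y)" N] \<phi>1 in simp)
  finally show "(\<integral>\<omega>. \<phi> (W \<omega>, u i k \<omega>, \<xi> i k \<omega>) \<partial>M) = (\<integral>\<omega>. (\<integral>y. \<phi> (W \<omega>, y) \<partial>?S) \<partial>M)" .
qed

end

section \<open>Moments along the iteration\<close>

lemma laplacian_row_sum: "i < n \<Longrightarrow> (\<Sum>j<n. laplacian n a $$ (i, j)) = 0"
  by (simp add: laplacian_def sum_subtractf sum.delta)

lemma laplacian_sym:
  "weighted_graph n E a \<Longrightarrow> i < n \<Longrightarrow> j < n \<Longrightarrow> laplacian n a $$ (i, j) = laplacian n a $$ (j, i)"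
  by (auto simp: laplacian_def weighted_graph_def)

text \<open>Variance identity: subtracting the mean removes |s|^2 / n from the sum of squares, with
  s the sum of the vectors.\<close>

lemma sum_norm_sq_deviation_le:
  fixes v :: "nat \<Rightarrow> 'a::real_inner"
  assumes "1 \<le> (n::nat)"
  shows "(\<Sum>i<n. (norm (v i - (1 / real n) *\<^sub>R (\<Sum>j<n. v j)))\<^sup>2) \<le> (\<Sum>i<n. (norm (v i))\<^sup>2)"
proof -
  define s where "s = (\<Sum>j<n. v j)"
  have "(\<Sum>i<n. (norm (v i - (1 / real n) *\<^sub>R s))\<^sup>2)
      = (\<Sum>i<n. (norm (v i))\<^sup>2 - 2 / real n * inner (v i) s + (1 / real n)\<^sup>2 * (norm s)\<^sup>2)"
    unfolding power2_norm_eq_inner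
    by (intro sum.cong refl) (simp add: inner_diff_left inner_diff_right inner_commute power2_eq_square algebra_simps)
  also have "\<dots> = (\<Sum>i<n. (norm (v i))\<^sup>2) - 2 / real n * inner s s + real n * ((1 / real n)\<^sup>2 * (norm s)\<^sup>2)"
    by (simp add: sum.distrib sum_subtractf s_def inner_sum_left sum_distrib_left sum_divide_distrib)
  also have "\<dots> = (\<Sum>i<n. (norm (v i))\<^sup>2) - (norm s)\<^sup>2 / real n"
    unfolding power2_norm_eq_inner[of s] using assms by (simp add: power2_eq_square field_simps)
  finally show ?thesis by (simp add: s_def)
qed

lemma norm_diff_sq_young:
  fixes v w :: "'a::real_inner"
  assumes "0 < c"
  shows "(norm (v - w))\<^sup>2 \<le> (1 + c) * (norm v)\<^sup>2 + (1 + 1 / c) * (norm w)\<^sup>2"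
proof -
  have "(norm (v - w))\<^sup>2 \<le> (norm v + norm w)\<^sup>2" by (intro power_mono norm_triangle_ineq4) simp
  moreover have "2 * norm v * norm w \<le> c * (norm v)\<^sup>2 + (1 / c) * (norm w)\<^sup>2"
  proof -
    have "0 \<le> (sqrt c * norm v - norm w / sqrt c)\<^sup>2" by simp
    also have "\<dots> = c * (norm v)\<^sup>2 + (1 / c) * (norm w)\<^sup>2 - 2 * norm v * norm w"
      using assms by (simp add: power2_diff power_mult_distrib power_divide)
    finally show ?thesis by simp
  qed
  ultimately show ?thesis by (simp add: power2_sum algebra_simps)
qed

lemma average_in: "(\<And>i. i < n \<Longrightarrow> v i \<in> euclid p) \<Longrightarrow> average n v \<in> euclid p"
  unfolding average_def by (intro euclid_scaleR euclid_sum) auto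

lemma norm_average_sq_le:
  assumes "1 \<le> n"
  shows "(norm (average n v))\<^sup>2 \<le> (\<Sum>i<n. (norm (v i))\<^sup>2) / n"
proof -
  have "(norm (average n v))\<^sup>2 = (1 / real n)\<^sup>2 * (norm (\<Sum>i<n. v i))\<^sup>2" by (simp add: average_def power_divide)
  also have "\<dots> \<le> (1 / real n)\<^sup>2 * (\<Sum>i<n. norm (v i))\<^sup>2" by (intro mult_left_mono power_mono norm_sum) auto
  also have "(\<Sum>i<n. norm (v i))\<^sup>2 \<le> real n * (\<Sum>i<n. (norm (v i))\<^sup>2)"
    using sum_squared_le_sum_of_squares[of "\<lambda>i. norm (v i)" "{..<n}"] by (simp add: mult.commute)
  finally show ?thesis using assms by (simp add: power2_eq_square field_simps)
qed

lemma average_diff: "average n (\<lambda>i. v i - w i) = average n v - average n w"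
  by (simp add: average_def sum_subtractf scaleR_diff_right)

lemma sum_deviation: "1 \<le> n \<Longrightarrow> (\<Sum>i<n. v i - average n v) = 0"
  by (simp add: sum_subtractf average_def sum_constant_scaleR del: sum_constant)

text \<open>Rows of the Laplacian sum to zero, by symmetry so do its columns, and the gossip term
  disappears from the mean.\<close>

lemma average_step:
  assumes wg: "weighted_graph n E a"
    and step: "\<And>i. i < n \<Longrightarrow> x' i = x i - \<gamma> *\<^sub>R (\<Sum>j<n. (laplacian n a $$ (i, j)) *\<^sub>R x j) - \<eta> *\<^sub>R g i"
  shows "average n x' = average n x - \<eta> *\<^sub>R average n g"
proof -
  have "(\<Sum>i<n. \<Sum>j<n. (laplacian n a $$ (i, j)) *\<^sub>R x j) = (\<Sum>j<n. \<Sum>i<n. (laplacian n a $$ (i, j)) *\<^sub>R x j)"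
    by (rule sum.swap)
  also have "\<dots> = (\<Sum>j<n. (\<Sum>i<n. laplacian n a $$ (j, i)) *\<^sub>R x j)"
    unfolding scaleR_sum_left by (intro sum.cong refl) (simp add: laplacian_sym[OF wg])
  also have "\<dots> = 0" by (simp add: laplacian_row_sum)
  finally have 0: "(\<Sum>i<n. \<Sum>j<n. (laplacian n a $$ (i, j)) *\<^sub>R x j) = 0" .
  have "(\<Sum>i<n. x' i) = (\<Sum>i<n. x i) - \<gamma> *\<^sub>R (\<Sum>i<n. \<Sum>j<n. (laplacian n a $$ (i, j)) *\<^sub>R x j) - \<eta> *\<^sub>R (\<Sum>i<n. g i)"
    by (simp add: step sum_subtractf flip: scaleR_sum_right)
  then show ?thesis unfolding average_def 0 by (simp add: scaleR_diff_right)
qed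

text \<open>As rows sum to zero, the deviations undergo the same gossip step as the iterates. The
  Laplacian mixes agents and not coordinates, so the scalar contraction applies in each coordinate;
  Young's inequality with the free weight \<open>c\<close> splits off the estimators.\<close>

lemma consensus_step:
  assumes wg: "weighted_graph n E a" and conn: "connected_graph n E" and n: "2 \<le> n"
    and \<gamma>: "0 \<le> \<gamma>" and c: "0 < c" and x: "\<And>i. i < n \<Longrightarrow> x i \<in> euclid p"
    and step: "\<And>i. i < n \<Longrightarrow> x' i = x i - \<gamma> *\<^sub>R (\<Sum>j<n. (laplacian n a $$ (i, j)) *\<^sub>R x j) - \<eta> *\<^sub>R g i"
  shows "consensus_error n x'
    \<le> (1 + c) * (1 - 2 * \<gamma> * rho2 (laplacian n a) + \<gamma>\<^sup>2 * rho (laplacian n a * laplacian n a)) * consensus_error n x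
      + (1 + 1 / c) * \<eta>\<^sup>2 * ((\<Sum>i<n. (norm (g i))\<^sup>2) / n)"
proof -
  let ?q = "1 - 2 * \<gamma> * rho2 (laplacian n a) + \<gamma>\<^sup>2 * rho (laplacian n a * laplacian n a)"
  define y where "y i = x i - average n x" for i
  define b where "b i = y i - \<gamma> *\<^sub>R (\<Sum>j<n. (laplacian n a $$ (i, j)) *\<^sub>R y j)" for i
  have yE: "y i \<in> euclid p" if "i < n" for i
    unfolding y_def using x that by (intro euclid_diff average_in) auto
  have bE: "b i \<in> euclid p" if "i < n" for i
    unfolding b_def using yE that by (intro euclid_diff euclid_scaleR euclid_sum) auto
  have dev: "x' i - average n x' = b i - \<eta> *\<^sub>R (g i - average n g)" if i: "i < n" for i
  proof -
    have "(\<Sum>j<n. (laplacian n a $$ (i, j)) *\<^sub>R y j)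
        = (\<Sum>j<n. (laplacian n a $$ (i, j)) *\<^sub>R x j) - (\<Sum>j<n. laplacian n a $$ (i, j)) *\<^sub>R average n x"
      by (simp add: y_def scaleR_diff_right sum_subtractf scaleR_sum_left)
    then have "(\<Sum>j<n. (laplacian n a $$ (i, j)) *\<^sub>R y j) = (\<Sum>j<n. (laplacian n a $$ (i, j)) *\<^sub>R x j)"
      by (simp add: laplacian_row_sum i)
    then show ?thesis
      unfolding average_step[OF wg step, simplified] b_def step[OF i] by (simp add: y_def algebra_simps)
  qed
  have contr: "(\<Sum>i<n. (norm (b i))\<^sup>2) \<le> ?q * (\<Sum>i<n. (norm (y i))\<^sup>2)"
  proof -
    have "(\<Sum>i<n. (norm (b i))\<^sup>2) = (\<Sum>i<n. \<Sum>d<p. (Poly_Mapping.lookup (b i) d)\<^sup>2)"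
      by (intro sum.cong refl) (simp add: norm_euclid_sq[OF bE])
    also have "\<dots> = (\<Sum>d<p. \<Sum>i<n. (Poly_Mapping.lookup (b i) d)\<^sup>2)" by (rule sum.swap)
    also have "\<dots> \<le> (\<Sum>d<p. ?q * (\<Sum>i<n. (Poly_Mapping.lookup (y i) d)\<^sup>2))"
    proof (rule sum_mono)
      fix d
      let ?y = "\<lambda>i. Poly_Mapping.lookup (y i) d"
      have "(\<Sum>i<n. ?y i) = Poly_Mapping.lookup (\<Sum>i<n. y i) d" by (simp add: lookup_sum)
      also have "\<dots> = 0" using sum_deviation[of n x] n by (simp add: y_def)
      finally have "(\<Sum>i<n. (?y i - \<gamma> * lin n (Lc n a) ?y i)\<^sup>2) \<le> ?q * (\<Sum>i<n. (?y i)\<^sup>2)"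
        by (rule gossip_contraction[OF wg conn n _ \<gamma>])
      moreover have "Poly_Mapping.lookup (b i) d = ?y i - \<gamma> * lin n (Lc n a) ?y i" for i
        by (simp add: b_def lookup_minus lookup_scaleR lookup_sum Lc_def[OF wg conn n])
      ultimately show "(\<Sum>i<n. (Poly_Mapping.lookup (b i) d)\<^sup>2) \<le> ?q * (\<Sum>i<n. (?y i)\<^sup>2)" by simp
    qed
    also have "\<dots> = ?q * (\<Sum>i<n. \<Sum>d<p. (Poly_Mapping.lookup (y i) d)\<^sup>2)"
      by (subst sum.swap) (simp add: sum_distrib_left)
    also have "(\<Sum>i<n. \<Sum>d<p. (Poly_Mapping.lookup (y i) d)\<^sup>2) = (\<Sum>i<n. (norm (y i))\<^sup>2)"
      by (intro sum.cong refl) (simp add: norm_euclid_sq[OF yE])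
    finally show ?thesis .
  qed
  have "(\<Sum>i<n. (norm (x' i - average n x'))\<^sup>2)
      \<le> (\<Sum>i<n. (1 + c) * (norm (b i))\<^sup>2 + (1 + 1 / c) * (norm (\<eta> *\<^sub>R (g i - average n g)))\<^sup>2)"
    by (intro sum_mono) (simp only: dev lessThan_iff norm_diff_sq_young[OF c])
  also have "\<dots> = (1 + c) * (\<Sum>i<n. (norm (b i))\<^sup>2) + (1 + 1 / c) * \<eta>\<^sup>2 * (\<Sum>i<n. (norm (g i - average n g))\<^sup>2)"
    by (simp add: sum.distrib sum_distrib_left power_mult_distrib mult.assoc)
  also have "\<dots> \<le> (1 + c) * (?q * (\<Sum>i<n. (norm (y i))\<^sup>2)) + (1 + 1 / c) * \<eta>\<^sup>2 * (\<Sum>i<n. (norm (g i))\<^sup>2)"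
    using c n contr sum_norm_sq_deviation_le[of n g]
    by (intro add_mono mult_left_mono) (auto simp: average_def)
  finally have "(\<Sum>i<n. (norm (x' i - average n x'))\<^sup>2) / n
      \<le> ((1 + c) * (?q * (\<Sum>i<n. (norm (y i))\<^sup>2)) + (1 + 1 / c) * \<eta>\<^sup>2 * (\<Sum>i<n. (norm (g i))\<^sup>2)) / n"
    by (rule divide_right_mono) simp
  then show ?thesis unfolding consensus_error_def y_def by (simp add: add_divide_distrib mult.assoc)
qed

section \<open>Second moments of iterates and estimators\<close>

context zo_algorithm
begin

lemma measurable_x: "i < n \<Longrightarrow> (\<lambda>\<omega>. x k \<omega> i) \<in> measurable M (euclid_borel p)"
  using measurable_u measurable_\<xi> by (intro measurable_x_gen) auto

lemma measurable_g: "i < n \<Longrightarrow> (\<lambda>\<omega>. g k \<omega> i) \<in> measurable M (euclid_borel p)"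
  using measurable_u measurable_\<xi> by (intro measurable_g_gen measurable_x) auto

lemma x_in: "i < n \<Longrightarrow> \<omega> \<in> space M \<Longrightarrow> x k \<omega> i \<in> euclid p"
  using measurable_space[OF measurable_x] by simp

lemma measurable_x_others: "j < n \<Longrightarrow> (\<lambda>\<omega>. x k \<omega> j) \<in> measurable (alg (others i k)) (euclid_borel p)"
  by (intro measurable_x_gen measurable_u_alg measurable_\<xi>_alg) auto

lemma measurable_g_others:
  "j < n \<Longrightarrow> j \<noteq> i \<Longrightarrow> (\<lambda>\<omega>. g k \<omega> j) \<in> measurable (alg (others i k)) (euclid_borel p)"
  by (intro measurable_g_gen measurable_x_others measurable_u_alg measurable_\<xi>_alg) auto

lemma variance:
  assumes "i < n" "y \<in> euclid p"
  shows "(\<integral>\<^sup>+z. ennreal ((norm (grad p (\<lambda>y. F i y z) y - grad p (\<lambda>x. \<integral>z. F i x z \<partial>D i) y))\<^sup>2) \<partial>D i)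
    \<le> ennreal (\<sigma>0\<^sup>2 * (norm (grad p (\<lambda>x. \<integral>z. F i x z \<partial>D i) y))\<^sup>2 + \<sigma>1\<^sup>2)"
  using bv assms by (simp add: bounded_variance_def fl_eq)

lemma m_bias:
  assumes i: "i < n" and w: "\<omega> \<in> space M"
  shows "norm (m k \<omega> i - grad p (fl i) (x k \<omega> i)) \<le> Lf * \<delta> i k"
  unfolding m_def fl_eq by (rule zo_mean_bias[OF agent_facts[OF i] \<delta>[OF i, of k] variance[OF i] x_in[OF i w]])

lemma measurable_m_others:
  assumes j: "j < n"
  shows "(\<lambda>\<omega>. m k \<omega> j) \<in> measurable (alg (others i k)) (euclid_borel p)"
  unfolding m_def
  by (rule measurable_compose[OF measurable_x_others[OF j] measurable_zo_mean[OF agent_facts[OF j] \<delta>[OF j, of k] variance[OF j]]])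

lemma measurable_m: "j < n \<Longrightarrow> (\<lambda>\<omega>. m k \<omega> j) \<in> measurable M (euclid_borel p)"
  by (rule measurable_alg_imp[OF _ measurable_m_others[where i = j]]) auto

definition g_bound :: "nat \<Rightarrow> nat \<Rightarrow> (nat \<Rightarrow>\<^sub>0 real) \<Rightarrow> real" where
  "g_bound k i y = 4 * real p * ((1 + \<sigma>0\<^sup>2) * (norm (grad p (fl i) y))\<^sup>2 + \<sigma>1\<^sup>2) + (real p)\<^sup>2 * Lf\<^sup>2 * (\<delta> i k)\<^sup>2 / 2"

lemma g_bound_nonneg: "0 \<le> g_bound k i y"
  by (simp add: g_bound_def)

text \<open>The bound is for nonnegative integrals, because it is itself the source of the
  integrability of the estimators.\<close>

lemma nn_integral_g_sq:
  assumes i: "i < n"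
  shows "(\<integral>\<^sup>+\<omega>. ennreal ((norm (g k \<omega> i))\<^sup>2) \<partial>M) \<le> (\<integral>\<^sup>+\<omega>. ennreal (g_bound k i (x k \<omega> i)) \<partial>M)"
proof -
  define \<phi> where "\<phi> = (\<lambda>(y, u, z). (norm (zo_grad p (F i) (\<delta> i k) y u z))\<^sup>2)"
  have \<phi>: "\<phi> \<in> borel_measurable (euclid_borel p \<Otimes>\<^sub>M (euclid_borel p \<Otimes>\<^sub>M D i))"
    using measurable_euclid_borelD[OF measurable_zo_grad[OF agent_facts[OF i], of "\<delta> i k"]]
    by (simp add: \<phi>_def case_prod_beta')
  have "(\<integral>\<^sup>+\<omega>. ennreal ((norm (g k \<omega> i))\<^sup>2) \<partial>M) = (\<integral>\<^sup>+\<omega>. ennreal (\<phi> (x k \<omega> i, u i k \<omega>, \<xi> i k \<omega>)) \<partial>M)"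
    by (simp add: \<phi>_def g_def)
  also have "\<dots> = (\<integral>\<^sup>+\<omega>. (\<integral>\<^sup>+y. ennreal (\<phi> (x k \<omega> i, y)) \<partial>(uniform_sphere p \<Otimes>\<^sub>M D i)) \<partial>M)"
    by (rule nn_integral_freeze[OF i measurable_x_others[OF i] \<phi>])
  also have "\<dots> \<le> (\<integral>\<^sup>+\<omega>. ennreal (g_bound k i (x k \<omega> i)) \<partial>M)"
  proof (rule nn_integral_mono)
    fix \<omega> assume w: "\<omega> \<in> space M"
    show "(\<integral>\<^sup>+y. ennreal (\<phi> (x k \<omega> i, y)) \<partial>(uniform_sphere p \<Otimes>\<^sub>M D i)) \<le> ennreal (g_bound k i (x k \<omega> i))"
      using zo_grad_second_moment_bound[OF agent_facts[OF i] \<delta>[OF i, of k] variance[OF i] x_in[OF i w, of k]]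
      by (simp add: \<phi>_def g_bound_def fl_eq case_prod_beta')
  qed
  finally show ?thesis .
qed

lemma measurable_grad_fl_x: "i < n \<Longrightarrow> (\<lambda>\<omega>. grad p (fl i) (x k \<omega> i)) \<in> measurable M (euclid_borel p)"
  by (rule measurable_compose[OF measurable_x smooth_measurable_grad[OF smooth_fl]])

lemma
  assumes i: "i < n" and xi: "integrable M (\<lambda>\<omega>. (norm (x k \<omega> i))\<^sup>2)"
  shows integrable_g_bound_step: "integrable M (\<lambda>\<omega>. g_bound k i (x k \<omega> i))"
    and integrable_g_step: "integrable M (\<lambda>\<omega>. (norm (g k \<omega> i))\<^sup>2)"
proof -
  have "integrable M (\<lambda>\<omega>. (norm (grad p (fl i) (x k \<omega> i)))\<^sup>2)"
    by (rule integrable_sq_bound[where B = "\<lambda>\<omega>. 2 * (norm (grad p (fl i) 0))\<^sup>2 + 2 * Lf\<^sup>2 * (norm (x k \<omega> i))\<^sup>2"])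
      (use xi i x_in smooth_growth_grad[OF smooth_fl[OF i]] measurable_euclid_borelD[OF measurable_grad_fl_x[OF i]] in auto)
  then show gi: "integrable M (\<lambda>\<omega>. g_bound k i (x k \<omega> i))" by (simp add: g_bound_def)
  have "(\<integral>\<^sup>+\<omega>. ennreal (g_bound k i (x k \<omega> i)) \<partial>M) < \<infinity>"
    using integrableD(2)[OF gi] g_bound_nonneg by (simp add: top.not_eq_extremum)
  then show "integrable M (\<lambda>\<omega>. (norm (g k \<omega> i))\<^sup>2)"
    using measurable_euclid_borelD[OF measurable_g[OF i, of k]] nn_integral_g_sq[OF i, of k]
    by (intro integrableI_nonneg) (auto intro: order.strict_trans1)
qed

text \<open>Initial points are deterministic, and the second moment of an estimator is at most
  quadratic in the iterate, so finite second moments pass from one iteration to the next.\<close>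

lemma integrable_x_sq: "i < n \<Longrightarrow> integrable M (\<lambda>\<omega>. (norm (x k \<omega> i))\<^sup>2)"
proof (induction k arbitrary: i)
  case (Suc k)
  note xm = measurable_euclid_borelD[OF measurable_x] and gm = measurable_euclid_borelD[OF measurable_g]
  show ?case
    unfolding x_Suc
    by (intro integrable_sq_diff integrable_sq_scaleR integrable_sq_sum borel_measurable_diff borel_measurable_scaleR
        borel_measurable_sum borel_measurable_const integrable_g_step Suc xm gm) (use Suc in auto)
qed (simp add: x_0)

lemmas integrable_g_bound = integrable_g_bound_step[OF _ integrable_x_sq]
lemmas integrable_g_sq = integrable_g_step[OF _ integrable_x_sq]

lemma integral_g_sq: "i < n \<Longrightarrow> (\<integral>\<omega>. (norm (g k \<omega> i))\<^sup>2 \<partial>M) \<le> (\<integral>\<omega>. g_bound k i (x k \<omega> i) \<partial>M)"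
  using nn_integral_g_sq[of i k]
  by (simp add: nn_integral_eq_integral integrable_g_sq integrable_g_bound g_bound_nonneg
      ennreal_le_iff integral_nonneg_AE)

lemma integrable_m_sq: "i < n \<Longrightarrow> integrable M (\<lambda>\<omega>. (norm (m k \<omega> i))\<^sup>2)"
proof -
  assume i: "i < n"
  have "integrable M (\<lambda>\<omega>. (norm (grad p (fl i) (x k \<omega> i)))\<^sup>2)"
    by (rule integrable_sq_bound[where B = "\<lambda>\<omega>. 2 * (norm (grad p (fl i) 0))\<^sup>2 + 2 * Lf\<^sup>2 * (norm (x k \<omega> i))\<^sup>2"])
      (use integrable_x_sq i x_in smooth_growth_grad[OF smooth_fl[OF i]] measurable_euclid_borelD[OF measurable_grad_fl_x[OF i]] in auto)
  moreover have "integrable M (\<lambda>\<omega>. (norm (m k \<omega> i - grad p (fl i) (x k \<omega> i)))\<^sup>2)"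
  proof (rule integrable_sq_bound[where B = "\<lambda>_. (Lf * \<delta> i k)\<^sup>2"])
    show "(norm (m k \<omega> i - grad p (fl i) (x k \<omega> i)))\<^sup>2 \<le> (Lf * \<delta> i k)\<^sup>2" if "\<omega> \<in> space M" for \<omega>
      by (rule power_mono[OF m_bias[OF i that]]) simp
  qed (use measurable_euclid_borelD[OF measurable_grad_fl_x[OF i]] measurable_euclid_borelD[OF measurable_m[OF i]] in auto)
  ultimately have "integrable M (\<lambda>\<omega>. (norm ((m k \<omega> i - grad p (fl i) (x k \<omega> i)) + grad p (fl i) (x k \<omega> i)))\<^sup>2)"
    by (intro integrable_sq_add)
      (use measurable_euclid_borelD[OF measurable_grad_fl_x[OF i]] measurable_euclid_borelD[OF measurable_m[OF i]] in auto)
  then show ?thesis by simp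
qed

text \<open>Against a square-integrable vector that does not depend on the draws of agent
  \<open>i\<close> at time \<open>k\<close>, the estimator may be replaced by its conditional mean
  \<open>m\<close>.\<close>

lemma expectation_inner_g:
  assumes i: "i < n" and w: "w \<in> measurable (alg (others i k)) (euclid_borel p)"
    and wi: "integrable M (\<lambda>\<omega>. (norm (w \<omega>))\<^sup>2)"
  shows "(\<integral>\<omega>. inner (g k \<omega> i) (w \<omega>) \<partial>M) = (\<integral>\<omega>. inner (m k \<omega> i) (w \<omega>) \<partial>M)"
proof -
  let ?E = "euclid_borel p" and ?N = "(euclid_borel p \<Otimes>\<^sub>M euclid_borel p) \<Otimes>\<^sub>M (euclid_borel p \<Otimes>\<^sub>M D i)"
  define \<phi> where "\<phi> = (\<lambda>((w, y), (u, z)). inner (zo_grad p (F i) (\<delta> i k) y u z) w)"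
  have wM: "w \<in> measurable M ?E" by (rule measurable_alg_imp[OF _ w]) auto
  \<comment> \<open>The iterate is frozen together with \<open>w\<close>, since the estimator
    depends on it as well.\<close>
  have W: "(\<lambda>\<omega>. (w \<omega>, x k \<omega> i)) \<in> measurable (alg (others i k)) (?E \<Otimes>\<^sub>M ?E)"
    by (rule measurable_Pair[OF w measurable_x_others[OF i]])
  have 1: "(\<lambda>v. (snd (fst v), snd v)) \<in> measurable ?N (?E \<Otimes>\<^sub>M (?E \<Otimes>\<^sub>M D i))"
    by (intro measurable_Pair measurable_compose[OF measurable_fst measurable_snd] measurable_snd)
  have 2: "(\<lambda>v. zo_grad p (F i) (\<delta> i k) (snd (fst v)) (fst (snd v)) (snd (snd v))) \<in> borel_measurable ?N"
    using measurable_euclid_borelD[OF measurable_compose[OF 1 measurable_zo_grad[OF agent_facts[OF i], of "\<delta> i k"]]]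
    by (simp add: case_prod_beta')
  have 3: "(\<lambda>v. fst (fst v)) \<in> borel_measurable ?N"
    by (rule measurable_euclid_borelD[OF measurable_compose[OF measurable_fst measurable_fst]])
  have \<phi>: "\<phi> \<in> borel_measurable ?N"
    unfolding \<phi>_def case_prod_beta' by (intro borel_measurable_inner 2 3)
  have eq: "\<phi> ((w \<omega>, x k \<omega> i), u i k \<omega>, \<xi> i k \<omega>) = inner (g k \<omega> i) (w \<omega>)" for \<omega>
    by (simp add: \<phi>_def g_def)
  have int: "integrable M (\<lambda>\<omega>. inner (g k \<omega> i) (w \<omega>))"
    by (intro integrable_inner_of_sq integrable_g_sq i wi measurable_euclid_borelD[OF measurable_g]
        measurable_euclid_borelD[OF wM])
  have "(\<integral>\<omega>. inner (g k \<omega> i) (w \<omega>) \<partial>M)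
      = (\<integral>\<omega>. (\<integral>y. \<phi> ((w \<omega>, x k \<omega> i), y) \<partial>(uniform_sphere p \<Otimes>\<^sub>M D i)) \<partial>M)"
    using integral_freeze[OF i W \<phi>] int unfolding eq by simp
  also have "\<dots> = (\<integral>\<omega>. inner (m k \<omega> i) (w \<omega>) \<partial>M)"
  proof (rule Bochner_Integration.integral_cong[OF refl])
    fix \<omega> assume o: "\<omega> \<in> space M"
    have "w \<omega> \<in> euclid p" using measurable_space[OF wM o] by simp
    from inner_zo_mean[OF agent_facts[OF i] \<delta>[OF i, of k] variance[OF i] x_in[OF i o] this]
    show "(\<integral>y. \<phi> ((w \<omega>, x k \<omega> i), y) \<partial>(uniform_sphere p \<Otimes>\<^sub>M D i)) = inner (m k \<omega> i) (w \<omega>)"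
      by (simp add: \<phi>_def m_def case_prod_beta')
  qed
  finally show ?thesis .
qed

lemma integrable_inner_gg: "i < n \<Longrightarrow> j < n \<Longrightarrow> integrable M (\<lambda>\<omega>. inner (g k \<omega> i) (g k \<omega> j))"
  by (intro integrable_inner_of_sq integrable_g_sq measurable_euclid_borelD[OF measurable_g])

lemma integrable_inner_mm: "i < n \<Longrightarrow> j < n \<Longrightarrow> integrable M (\<lambda>\<omega>. inner (m k \<omega> i) (m k \<omega> j))"
  by (intro integrable_inner_of_sq integrable_m_sq measurable_euclid_borelD[OF measurable_m])

lemma integral_double_sum:
  fixes h :: "nat \<Rightarrow> nat \<Rightarrow> 'w \<Rightarrow> real"
  assumes "\<And>i j. i < n \<Longrightarrow> j < n \<Longrightarrow> integrable M (h i j)"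
  shows "(\<integral>\<omega>. (\<Sum>i<n. \<Sum>j<n. h i j \<omega>) \<partial>M) = (\<Sum>i<n. \<Sum>j<n. \<integral>\<omega>. h i j \<omega> \<partial>M)"
proof -
  have "(\<integral>\<omega>. (\<Sum>i<n. \<Sum>j<n. h i j \<omega>) \<partial>M) = (\<Sum>i<n. \<integral>\<omega>. (\<Sum>j<n. h i j \<omega>) \<partial>M)"
    by (rule Bochner_Integration.integral_sum) (auto intro!: Bochner_Integration.integrable_sum assms)
  also have "\<dots> = (\<Sum>i<n. \<Sum>j<n. \<integral>\<omega>. h i j \<omega> \<partial>M)"
    by (intro sum.cong refl Bochner_Integration.integral_sum) (auto intro!: assms)
  finally show ?thesis .
qed

lemma norm_sum_sq: "(norm (\<Sum>i<n. v i))\<^sup>2 = (\<Sum>i<n. \<Sum>j<n. inner (v i) (v j))" for v :: "nat \<Rightarrow> (nat \<Rightarrow>\<^sub>0 real)"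
  by (simp add: power2_norm_eq_inner inner_sum_left inner_sum_right) (rule sum.swap)

text \<open>For different agents the estimators are replaced by their conditional means one after
  the other, each time with the other factor depending on other draws only. Raw second moments then
  remain on the diagonal alone, which is the origin of the factor 1 / n.\<close>

lemma expectation_sum_g_sq:
  "(\<integral>\<omega>. (norm (\<Sum>i<n. g k \<omega> i))\<^sup>2 \<partial>M)
    \<le> (\<integral>\<omega>. (norm (\<Sum>i<n. m k \<omega> i))\<^sup>2 \<partial>M) + (\<Sum>i<n. \<integral>\<omega>. (norm (g k \<omega> i))\<^sup>2 \<partial>M)"
proof -
  have cross: "(\<integral>\<omega>. inner (g k \<omega> i) (g k \<omega> j) \<partial>M) = (\<integral>\<omega>. inner (m k \<omega> i) (m k \<omega> j) \<partial>M)"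
    if "i < n" "j < n" "i \<noteq> j" for i j
  proof -
    have "(\<integral>\<omega>. inner (g k \<omega> i) (g k \<omega> j) \<partial>M) = (\<integral>\<omega>. inner (m k \<omega> i) (g k \<omega> j) \<partial>M)"
      using that by (intro expectation_inner_g measurable_g_others integrable_g_sq) auto
    also have "\<dots> = (\<integral>\<omega>. inner (g k \<omega> j) (m k \<omega> i) \<partial>M)" by (simp add: inner_commute)
    also have "\<dots> = (\<integral>\<omega>. inner (m k \<omega> j) (m k \<omega> i) \<partial>M)"
      using that by (intro expectation_inner_g measurable_m_others integrable_m_sq) auto
    finally show ?thesis by (simp add: inner_commute)
  qed
  have "(\<integral>\<omega>. (norm (\<Sum>i<n. g k \<omega> i))\<^sup>2 \<partial>M) = (\<Sum>i<n. \<Sum>j<n. \<integral>\<omega>. inner (g k \<omega> i) (g k \<omega> j) \<partial>M)"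
    unfolding norm_sum_sq by (rule integral_double_sum[OF integrable_inner_gg])
  \<comment> \<open>The diagonal terms of \<open>m\<close> are nonnegative; adding them completes
    the double sum to a square.\<close>
  also have "\<dots> \<le> (\<Sum>i<n. \<Sum>j<n. (\<integral>\<omega>. inner (m k \<omega> i) (m k \<omega> j) \<partial>M)
      + (if i = j then \<integral>\<omega>. (norm (g k \<omega> i))\<^sup>2 \<partial>M else 0))"
  proof (intro sum_mono)
    fix i j assume "i \<in> {..<n}" "j \<in> {..<n}"
    moreover have "0 \<le> (\<integral>\<omega>. inner (m k \<omega> i) (m k \<omega> i) \<partial>M)" by (intro integral_nonneg_AE) auto
    ultimately show "(\<integral>\<omega>. inner (g k \<omega> i) (g k \<omega> j) \<partial>M) \<le> (\<integral>\<omega>. inner (m k \<omega> i) (m k \<omega> j) \<partial>M)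
      + (if i = j then \<integral>\<omega>. (norm (g k \<omega> i))\<^sup>2 \<partial>M else 0)"
      using cross[of i j] by (cases "i = j") (auto simp: power2_norm_eq_inner)
  qed
  also have "\<dots> = (\<integral>\<omega>. (norm (\<Sum>i<n. m k \<omega> i))\<^sup>2 \<partial>M) + (\<Sum>i<n. \<integral>\<omega>. (norm (g k \<omega> i))\<^sup>2 \<partial>M)"
    unfolding norm_sum_sq
    by (subst integral_double_sum[OF integrable_inner_mm]) (simp_all add: sum.distrib)
  finally show ?thesis .
qed

end

section \<open>One step in expectation\<close>

locale zo_network = zo_algorithm +
  fixes E :: "(nat \<times> nat) set" and \<tau>0 \<sigma>2 :: real
  assumes n2: "2 \<le> n" and wg: "weighted_graph n E a" and conn: "connected_graph n E"
    and \<gamma>: "0 \<le> \<gamma>" and bd: "bounded_dissimilarity p n D F \<tau>0 \<sigma>2"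
    and bdd: "bdd_below (global_obj n D F ` euclid p)"
begin

abbreviation "f \<equiv> global_obj n D F"
abbreviation "fstar \<equiv> min_value p f"

lemma f_eq: "f = (\<lambda>x. (\<Sum>i<n. fl i x) / n)"
  by (simp add: global_obj_def fun_eq_iff)

lemma smooth_f: "smooth p Lf f"
  unfolding f_eq by (rule smooth_average[OF smooth_fl n])

lemma grad_f: "y \<in> euclid p \<Longrightarrow> grad p f y = average n (\<lambda>i. grad p (fl i) y)"
  unfolding f_eq average_def by (rule grad_average[OF smooth_fl n])

definition "xb k \<omega> = average n (x k \<omega>)"

abbreviation "V k \<omega> \<equiv> consensus_error n (x k \<omega>)"
abbreviation "gap k \<omega> \<equiv> f (xb k \<omega>) - fstar"

definition "v k = (\<integral>\<omega>. V k \<omega> \<partial>M)"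
definition "phi k = (\<integral>\<omega>. gap k \<omega> \<partial>M)"
definition "G k = (\<integral>\<omega>. (norm (grad p f (xb k \<omega>)))\<^sup>2 \<partial>M)"
definition "gsq k = (\<Sum>i<n. \<integral>\<omega>. (norm (g k \<omega> i))\<^sup>2 \<partial>M) / n"

lemma xb_in: "\<omega> \<in> space M \<Longrightarrow> xb k \<omega> \<in> euclid p"
  unfolding xb_def by (intro average_in x_in)

lemma measurable_average_gen:
  assumes "\<And>i. i < n \<Longrightarrow> (\<lambda>\<omega>. X \<omega> i) \<in> measurable H (euclid_borel p)"
  shows "(\<lambda>\<omega>. average n (X \<omega>)) \<in> measurable H (euclid_borel p)"
  unfolding measurable_euclid_borel_iff
proof
  show "(\<lambda>\<omega>. average n (X \<omega>)) \<in> borel_measurable H"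
    unfolding average_def
    by (intro borel_measurable_scaleR borel_measurable_const borel_measurable_sum measurable_euclid_borelD[OF assms]) auto
  show "\<forall>\<omega>\<in>space H. average n (X \<omega>) \<in> euclid p"
    using measurable_space[OF assms] by (auto intro!: average_in)
qed

lemma measurable_xb: "xb k \<in> measurable M (euclid_borel p)"
  unfolding xb_def[abs_def] by (intro measurable_average_gen measurable_x)

lemma measurable_xb_others: "xb k \<in> measurable (alg (others i k)) (euclid_borel p)"
  unfolding xb_def[abs_def] by (intro measurable_average_gen measurable_x_others)

lemma measurable_grad_f_others: "(\<lambda>\<omega>. grad p f (xb k \<omega>)) \<in> measurable (alg (others i k)) (euclid_borel p)"
  by (rule measurable_compose[OF measurable_xb_others smooth_measurable_grad[OF smooth_f]])

lemma measurable_grad_f: "(\<lambda>\<omega>. grad p f (xb k \<omega>)) \<in> measurable M (euclid_borel p)"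
  by (rule measurable_compose[OF measurable_xb smooth_measurable_grad[OF smooth_f]])

lemma integrable_average_sq:
  assumes "\<And>i. i < n \<Longrightarrow> (\<lambda>\<omega>. X \<omega> i) \<in> borel_measurable M"
    and "\<And>i. i < n \<Longrightarrow> integrable M (\<lambda>\<omega>. (norm (X \<omega> i))\<^sup>2)"
  shows "integrable M (\<lambda>\<omega>. (norm (average n (X \<omega>)))\<^sup>2)"
  unfolding average_def using assms by (intro integrable_sq_scaleR integrable_sq_sum) auto

lemma integrable_xb_sq: "integrable M (\<lambda>\<omega>. (norm (xb k \<omega>))\<^sup>2)"
  unfolding xb_def by (intro integrable_average_sq integrable_x_sq measurable_euclid_borelD[OF measurable_x])

lemma integrable_V: "integrable M (V k)"
  unfolding consensus_error_def xb_def[symmetric]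
  by (intro integrable_divide Bochner_Integration.integrable_sum integrable_sq_diff integrable_x_sq integrable_xb_sq
      measurable_euclid_borelD[OF measurable_x] measurable_euclid_borelD[OF measurable_xb]) auto

lemma integrable_gap: "integrable M (gap k)"
proof -
  have "integrable M (\<lambda>\<omega>. f (xb k \<omega>))"
  proof (rule Bochner_Integration.integrable_bound)
    show "integrable M (\<lambda>\<omega>. \<bar>f 0\<bar> + (norm (grad p f 0))\<^sup>2 + (Lf + 1) * (norm (xb k \<omega>))\<^sup>2)"
      using integrable_xb_sq by auto
    show "(\<lambda>\<omega>. f (xb k \<omega>)) \<in> borel_measurable M"
      by (rule measurable_compose[OF measurable_xb smooth_measurable[OF smooth_f]])
    show "AE \<omega> in M. norm (f (xb k \<omega>)) \<le> norm (\<bar>f 0\<bar> + (norm (grad p f 0))\<^sup>2 + (Lf + 1) * (norm (xb k \<omega>))\<^sup>2)"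
      using smooth_growth[OF smooth_f xb_in] by (intro AE_I2) (auto intro: order_trans[OF _ abs_ge_self])
  qed
  then show ?thesis by auto
qed

lemma integrable_grad_f_sq: "integrable M (\<lambda>\<omega>. (norm (grad p f (xb k \<omega>)))\<^sup>2)"
  by (rule integrable_sq_bound[where B = "\<lambda>\<omega>. 2 * (norm (grad p f 0))\<^sup>2 + 2 * Lf\<^sup>2 * (norm (xb k \<omega>))\<^sup>2"])
    (use integrable_xb_sq xb_in smooth_growth_grad[OF smooth_f] measurable_euclid_borelD[OF measurable_grad_f] in auto)

lemma V_nonneg: "0 \<le> V k \<omega>"
  by (simp add: consensus_error_def sum_nonneg)

lemma gap_nonneg: "\<omega> \<in> space M \<Longrightarrow> 0 \<le> gap k \<omega>"
  unfolding min_value_def using cINF_lower[OF bdd xb_in] by simp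

lemma v_nonneg: "0 \<le> v k" unfolding v_def by (intro integral_nonneg_AE AE_I2 V_nonneg)
lemma phi_nonneg: "0 \<le> phi k" unfolding phi_def by (intro integral_nonneg_AE AE_I2 gap_nonneg)
lemma G_nonneg: "0 \<le> G k" unfolding G_def by (intro integral_nonneg_AE AE_I2) simp
lemma gsq_nonneg: "0 \<le> gsq k"
  unfolding gsq_def by (intro divide_nonneg_nonneg sum_nonneg integral_nonneg_AE AE_I2) auto

lemma G_le_phi: "G k \<le> 2 * Lf * phi k"
proof -
  have "G k \<le> (\<integral>\<omega>. 2 * Lf * gap k \<omega> \<partial>M)"
    unfolding G_def using norm_grad_le_gap[OF smooth_f xb_in Lf bdd] integrable_grad_f_sq integrable_gap
    by (intro integral_mono) auto
  then show ?thesis by (simp add: phi_def)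
qed

lemma phi_le_G:
  assumes "polyak_lojasiewicz p \<nu> f"
  shows "2 * \<nu> * phi k \<le> G k"
proof -
  have "(\<integral>\<omega>. 2 * \<nu> * gap k \<omega> \<partial>M) \<le> G k"
    unfolding G_def
  proof (rule integral_mono)
    fix \<omega> assume "\<omega> \<in> space M"
    from xb_in[OF this] assms have "\<nu> * gap k \<omega> \<le> 1 / 2 * (norm (grad p f (xb k \<omega>)))\<^sup>2"
      by (auto simp: polyak_lojasiewicz_def)
    then show "2 * \<nu> * gap k \<omega> \<le> (norm (grad p f (xb k \<omega>)))\<^sup>2" by simp
  qed (use integrable_grad_f_sq integrable_gap in auto)
  then show ?thesis by (simp add: phi_def)
qed

lemma v_step:
  assumes c: "0 < c"
  shows "v (Suc k) \<le> (1 + c) * (1 - 2 * \<gamma> * rho2 (laplacian n a) + \<gamma>\<^sup>2 * rho (laplacian n a * laplacian n a)) * v k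
    + (1 + 1 / c) * (\<eta> k)\<^sup>2 * gsq k"
proof -
  let ?q = "(1 + c) * (1 - 2 * \<gamma> * rho2 (laplacian n a) + \<gamma>\<^sup>2 * rho (laplacian n a * laplacian n a))"
  have gi: "integrable M (\<lambda>\<omega>. (\<Sum>i<n. (norm (g k \<omega> i))\<^sup>2) / n)"
    by (intro integrable_divide Bochner_Integration.integrable_sum integrable_g_sq) auto
  have "v (Suc k) \<le> (\<integral>\<omega>. ?q * V k \<omega> + (1 + 1 / c) * (\<eta> k)\<^sup>2 * ((\<Sum>i<n. (norm (g k \<omega> i))\<^sup>2) / n) \<partial>M)"
    unfolding v_def
  proof (rule integral_mono)
    show "V (Suc k) \<omega> \<le> ?q * V k \<omega> + (1 + 1 / c) * (\<eta> k)\<^sup>2 * ((\<Sum>i<n. (norm (g k \<omega> i))\<^sup>2) / n)"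
      if "\<omega> \<in> space M" for \<omega>
      by (rule consensus_step[OF wg conn n2 \<gamma> c x_in[OF _ that] x_Suc])
    show "integrable M (\<lambda>\<omega>. ?q * V k \<omega> + (1 + 1 / c) * (\<eta> k)\<^sup>2 * ((\<Sum>i<n. (norm (g k \<omega> i))\<^sup>2) / n))"
      by (rule Bochner_Integration.integrable_add[OF integrable_mult_right[OF integrable_V] integrable_mult_right[OF gi]])
  qed (rule integrable_V)
  also have "\<dots> = ?q * (\<integral>\<omega>. V k \<omega> \<partial>M) + (1 + 1 / c) * (\<eta> k)\<^sup>2 * (\<integral>\<omega>. (\<Sum>i<n. (norm (g k \<omega> i))\<^sup>2) / n \<partial>M)"
    by (simp only: Bochner_Integration.integral_add[OF integrable_mult_right[OF integrable_V] integrable_mult_right[OF gi]]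
        integral_mult_right_zero)
  also have "(\<integral>\<omega>. (\<Sum>i<n. (norm (g k \<omega> i))\<^sup>2) / n \<partial>M) = gsq k"
    unfolding gsq_def by (simp add: Bochner_Integration.integral_sum integrable_g_sq)
  finally show ?thesis by (simp add: v_def)
qed

text \<open>The local gradient at \<open>x k \<omega> i\<close> is compared with the local gradient
  at the mean iterate by smoothness, and that one with the global gradient by dissimilarity. Each
  comparison costs a factor 2, and the estimator contributes 4 p (1 + \<sigma>0^2), whence 16 and
  8.\<close>

lemma gsq_bound:
  assumes dm: "\<And>i. i < n \<Longrightarrow> \<delta> i k \<le> dm"
  shows "gsq k \<le> 16 * real p * (1 + \<sigma>0\<^sup>2) * (1 + \<tau>0\<^sup>2) * G k + 8 * real p * (1 + \<sigma>0\<^sup>2) * Lf\<^sup>2 * v k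
    + (16 * real p * (1 + \<sigma>0\<^sup>2) * \<sigma>2\<^sup>2 + 4 * real p * \<sigma>1\<^sup>2 + (real p)\<^sup>2 * Lf\<^sup>2 * dm\<^sup>2 / 2)"
proof -
  let ?A = "16 * real p * (1 + \<sigma>0\<^sup>2) * (1 + \<tau>0\<^sup>2)" and ?B = "8 * real p * (1 + \<sigma>0\<^sup>2) * Lf\<^sup>2"
    and ?N = "16 * real p * (1 + \<sigma>0\<^sup>2) * \<sigma>2\<^sup>2 + 4 * real p * \<sigma>1\<^sup>2 + (real p)\<^sup>2 * Lf\<^sup>2 * dm\<^sup>2 / 2"
  have pt: "g_bound k i (x k \<omega> i) \<le> ?A * (norm (grad p f (xb k \<omega>)))\<^sup>2 + ?B * (norm (x k \<omega> i - xb k \<omega>))\<^sup>2 + ?N"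
    if i: "i < n" and w: "\<omega> \<in> space M" for i \<omega>
  proof -
    let ?y = "x k \<omega> i" and ?b = "xb k \<omega>"
    let ?G = "(norm (grad p f ?b))\<^sup>2" and ?d = "(norm (?y - ?b))\<^sup>2"
    have "(norm (grad p (fl i) ?y - grad p (fl i) ?b))\<^sup>2 \<le> (Lf * norm (?y - ?b))\<^sup>2"
      by (rule power_mono[OF smooth_lipschitz[OF smooth_fl[OF i] x_in[OF i w] xb_in[OF w]]]) simp
    then have 1: "(norm (grad p (fl i) ?y - grad p (fl i) ?b))\<^sup>2 \<le> Lf\<^sup>2 * ?d" by (simp add: power_mult_distrib)
    have 2: "(norm (grad p (fl i) ?b - grad p f ?b))\<^sup>2 \<le> \<tau>0\<^sup>2 * ?G + \<sigma>2\<^sup>2"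
      using bd i xb_in[OF w] by (auto simp: bounded_dissimilarity_def)
    have 3: "(norm (grad p (fl i) ?y))\<^sup>2 \<le> 2 * (norm (grad p (fl i) ?y - grad p (fl i) ?b))\<^sup>2 + 2 * (norm (grad p (fl i) ?b))\<^sup>2"
      using norm_sum_sq_le[of "grad p (fl i) ?y - grad p (fl i) ?b" "grad p (fl i) ?b"] by simp
    have 4: "(norm (grad p (fl i) ?b))\<^sup>2 \<le> 2 * (norm (grad p (fl i) ?b - grad p f ?b))\<^sup>2 + 2 * ?G"
      using norm_sum_sq_le[of "grad p (fl i) ?b - grad p f ?b" "grad p f ?b"] by simp
    have 5: "(norm (grad p (fl i) ?y))\<^sup>2 \<le> 2 * Lf\<^sup>2 * ?d + 4 * (1 + \<tau>0\<^sup>2) * ?G + 4 * \<sigma>2\<^sup>2"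
      using 1 2 3 4 by (simp add: algebra_simps)
    have 6: "4 * real p * (1 + \<sigma>0\<^sup>2) * (norm (grad p (fl i) ?y))\<^sup>2
        \<le> 4 * real p * (1 + \<sigma>0\<^sup>2) * (2 * Lf\<^sup>2 * ?d + 4 * (1 + \<tau>0\<^sup>2) * ?G + 4 * \<sigma>2\<^sup>2)"
      by (rule mult_left_mono[OF 5]) simp
    have "(\<delta> i k)\<^sup>2 \<le> dm\<^sup>2" using dm[OF i] \<delta>[OF i, of k] by (intro power_mono) auto
    then have 7: "(real p)\<^sup>2 * Lf\<^sup>2 * (\<delta> i k)\<^sup>2 \<le> (real p)\<^sup>2 * Lf\<^sup>2 * dm\<^sup>2" by (rule mult_left_mono) simp
    have "g_bound k i ?y \<le> 4 * real p * (1 + \<sigma>0\<^sup>2) * (2 * Lf\<^sup>2 * ?d + 4 * (1 + \<tau>0\<^sup>2) * ?G + 4 * \<sigma>2\<^sup>2)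
        + 4 * real p * \<sigma>1\<^sup>2 + (real p)\<^sup>2 * Lf\<^sup>2 * dm\<^sup>2 / 2"
    proof -
      have "g_bound k i ?y = 4 * real p * (1 + \<sigma>0\<^sup>2) * (norm (grad p (fl i) ?y))\<^sup>2 + 4 * real p * \<sigma>1\<^sup>2
          + (real p)\<^sup>2 * Lf\<^sup>2 * (\<delta> i k)\<^sup>2 / 2"
        by (simp add: g_bound_def algebra_simps)
      then show ?thesis using 6 7 by linarith
    qed
    also have "\<dots> = ?A * ?G + ?B * ?d + ?N" by (simp add: algebra_simps)
    finally show ?thesis .
  qed
  have di: "integrable M (\<lambda>\<omega>. (norm (x k \<omega> i - xb k \<omega>))\<^sup>2)" if "i < n" for i
    using that by (intro integrable_sq_diff integrable_x_sq integrable_xb_sq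
      measurable_euclid_borelD[OF measurable_x] measurable_euclid_borelD[OF measurable_xb])
  have "(\<Sum>i<n. \<integral>\<omega>. (norm (g k \<omega> i))\<^sup>2 \<partial>M) \<le> (\<Sum>i<n. ?A * G k + ?B * (\<integral>\<omega>. (norm (x k \<omega> i - xb k \<omega>))\<^sup>2 \<partial>M) + ?N)"
  proof (rule sum_mono)
    fix i assume "i \<in> {..<n}"
    then have i: "i < n" by simp
    have "(\<integral>\<omega>. (norm (g k \<omega> i))\<^sup>2 \<partial>M) \<le> (\<integral>\<omega>. g_bound k i (x k \<omega> i) \<partial>M)" by (rule integral_g_sq[OF i])
    also have "\<dots> \<le> (\<integral>\<omega>. ?A * (norm (grad p f (xb k \<omega>)))\<^sup>2 + ?B * (norm (x k \<omega> i - xb k \<omega>))\<^sup>2 + ?N \<partial>M)"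
      by (rule integral_mono[OF integrable_g_bound[OF i]])
        (use i pt[OF i] integrable_grad_f_sq di[OF i] in auto)
    also have "\<dots> = ?A * G k + ?B * (\<integral>\<omega>. (norm (x k \<omega> i - xb k \<omega>))\<^sup>2 \<partial>M) + ?N"
      using integrable_grad_f_sq di[OF i] M.prob_space by (simp add: G_def)
    finally show "(\<integral>\<omega>. (norm (g k \<omega> i))\<^sup>2 \<partial>M) \<le> ?A * G k + ?B * (\<integral>\<omega>. (norm (x k \<omega> i - xb k \<omega>))\<^sup>2 \<partial>M) + ?N" .
  qed
  then have "gsq k \<le> (\<Sum>i<n. ?A * G k + ?B * (\<integral>\<omega>. (norm (x k \<omega> i - xb k \<omega>))\<^sup>2 \<partial>M) + ?N) / n"
    unfolding gsq_def by (rule divide_right_mono) simp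
  also have "\<dots> = ?A * G k + ?B * ((\<Sum>i<n. \<integral>\<omega>. (norm (x k \<omega> i - xb k \<omega>))\<^sup>2 \<partial>M) / n) + ?N"
  proof -
    have "(\<Sum>i<n. P + Q * h i + R) / n = P + Q * ((\<Sum>i<n. h i) / n) + R" for P Q R :: real and h
      using n by (simp add: sum.distrib add_divide_distrib flip: sum_distrib_left)
    then show ?thesis .
  qed
  also have "(\<Sum>i<n. \<integral>\<omega>. (norm (x k \<omega> i - xb k \<omega>))\<^sup>2 \<partial>M) / n = v k"
    unfolding v_def consensus_error_def xb_def[symmetric] by (simp add: Bochner_Integration.integral_sum di)
  finally show ?thesis .
qed

abbreviation "gavg k \<omega> \<equiv> average n (g k \<omega>)"
abbreviation "mavg k \<omega> \<equiv> average n (m k \<omega>)"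

lemma integrable_mavg_sq: "integrable M (\<lambda>\<omega>. (norm (mavg k \<omega>))\<^sup>2)"
  by (intro integrable_average_sq integrable_m_sq measurable_euclid_borelD[OF measurable_m])

lemma integrable_gavg_sq: "integrable M (\<lambda>\<omega>. (norm (gavg k \<omega>))\<^sup>2)"
  by (intro integrable_average_sq integrable_g_sq measurable_euclid_borelD[OF measurable_g])

text \<open>The squared factor 1 / n meets a sum of only \<open>n\<close> raw second moments: the
  noise is divided by \<open>n\<close>, the conditional means are not.\<close>

lemma expectation_gavg_sq: "(\<integral>\<omega>. (norm (gavg k \<omega>))\<^sup>2 \<partial>M) \<le> (\<integral>\<omega>. (norm (mavg k \<omega>))\<^sup>2 \<partial>M) + gsq k / n"
proof -
  have av: "(norm (average n X))\<^sup>2 = (1 / real n)\<^sup>2 * (norm (\<Sum>i<n. X i))\<^sup>2" for X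
    by (simp add: average_def power_divide)
  have "(\<integral>\<omega>. (norm (gavg k \<omega>))\<^sup>2 \<partial>M) = (1 / real n)\<^sup>2 * (\<integral>\<omega>. (norm (\<Sum>i<n. g k \<omega> i))\<^sup>2 \<partial>M)"
    unfolding av by simp
  also have "\<dots> \<le> (1 / real n)\<^sup>2 * ((\<integral>\<omega>. (norm (\<Sum>i<n. m k \<omega> i))\<^sup>2 \<partial>M) + (\<Sum>i<n. \<integral>\<omega>. (norm (g k \<omega> i))\<^sup>2 \<partial>M))"
    by (intro mult_left_mono expectation_sum_g_sq) simp
  also have "\<dots> = (\<integral>\<omega>. (norm (mavg k \<omega>))\<^sup>2 \<partial>M) + gsq k / n"
    unfolding av gsq_def by (simp add: distrib_left power2_eq_square)
  finally show ?thesis .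
qed

text \<open>The error has two sources, the smoothing bias of the estimators and the distance of the
  iterates from their mean; convexity of the square moves the average outside.\<close>

lemma mavg_error:
  assumes w: "\<omega> \<in> space M" and dm: "\<And>i. i < n \<Longrightarrow> \<delta> i k \<le> dm"
  shows "(norm (mavg k \<omega> - grad p f (xb k \<omega>)))\<^sup>2 \<le> 2 * Lf\<^sup>2 * V k \<omega> + 2 * Lf\<^sup>2 * dm\<^sup>2"
proof -
  define b where "b i = m k \<omega> i - grad p (fl i) (x k \<omega> i)" for i
  define h where "h i = grad p (fl i) (x k \<omega> i) - grad p (fl i) (xb k \<omega>)" for i
  have eq: "mavg k \<omega> - grad p f (xb k \<omega>) = average n b + average n h"
    unfolding grad_f[OF xb_in[OF w]] b_def h_def average_diff by simp
  have "(norm (average n b))\<^sup>2 \<le> (\<Sum>i<n. (norm (b i))\<^sup>2) / n" by (rule norm_average_sq_le[OF n])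
  also have "\<dots> \<le> (\<Sum>i<n. (Lf * dm)\<^sup>2) / n"
  proof (intro divide_right_mono sum_mono power_mono)
    fix i assume "i \<in> {..<n}"
    then have i: "i < n" by simp
    have "norm (b i) \<le> Lf * \<delta> i k" unfolding b_def by (rule m_bias[OF i w])
    also have "\<dots> \<le> Lf * dm" using dm[OF i] Lf by simp
    finally show "norm (b i) \<le> Lf * dm" .
  qed auto
  also have "\<dots> = Lf\<^sup>2 * dm\<^sup>2" using n by (simp add: power_mult_distrib)
  finally have 1: "(norm (average n b))\<^sup>2 \<le> Lf\<^sup>2 * dm\<^sup>2" .
  have "(norm (average n h))\<^sup>2 \<le> (\<Sum>i<n. (norm (h i))\<^sup>2) / n" by (rule norm_average_sq_le[OF n])
  also have "\<dots> \<le> (\<Sum>i<n. (Lf * norm (x k \<omega> i - xb k \<omega>))\<^sup>2) / n"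
    unfolding h_def
    by (intro divide_right_mono sum_mono power_mono smooth_lipschitz[OF smooth_fl] x_in[OF _ w] xb_in[OF w]) auto
  also have "\<dots> = Lf\<^sup>2 * V k \<omega>"
    by (simp add: power_mult_distrib consensus_error_def xb_def sum_distrib_left)
  finally have 2: "(norm (average n h))\<^sup>2 \<le> Lf\<^sup>2 * V k \<omega>" .
  show ?thesis unfolding eq using norm_sum_sq_le[of "average n b" "average n h"] 1 2 by linarith
qed

text \<open>The gradient at the mean iterate depends on earlier draws only, so every estimator can
  be replaced by its conditional mean.\<close>

lemma expectation_inner_gavg:
  "(\<integral>\<omega>. inner (gavg k \<omega>) (grad p f (xb k \<omega>)) \<partial>M) = (\<integral>\<omega>. inner (mavg k \<omega>) (grad p f (xb k \<omega>)) \<partial>M)"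
proof -
  have i1: "integrable M (\<lambda>\<omega>. inner (g k \<omega> i) (grad p f (xb k \<omega>)))"
    if "i < n" for i
    using that by (intro integrable_inner_of_sq integrable_g_sq integrable_grad_f_sq
      measurable_euclid_borelD[OF measurable_g] measurable_euclid_borelD[OF measurable_grad_f])
  have i2: "integrable M (\<lambda>\<omega>. inner (m k \<omega> i) (grad p f (xb k \<omega>)))" if "i < n" for i
    using that by (intro integrable_inner_of_sq integrable_m_sq integrable_grad_f_sq
      measurable_euclid_borelD[OF measurable_m] measurable_euclid_borelD[OF measurable_grad_f])
  have "(\<integral>\<omega>. inner (gavg k \<omega>) (grad p f (xb k \<omega>)) \<partial>M)
      = (1 / real n) * (\<Sum>i<n. \<integral>\<omega>. inner (g k \<omega> i) (grad p f (xb k \<omega>)) \<partial>M)"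
    by (simp add: average_def inner_sum_left Bochner_Integration.integral_sum i1)
  also have "\<dots> = (1 / real n) * (\<Sum>i<n. \<integral>\<omega>. inner (m k \<omega> i) (grad p f (xb k \<omega>)) \<partial>M)"
    by (intro arg_cong2[where f = "(*)"] sum.cong refl expectation_inner_g measurable_grad_f_others integrable_grad_f_sq) auto
  also have "\<dots> = (\<integral>\<omega>. inner (mavg k \<omega>) (grad p f (xb k \<omega>)) \<partial>M)"
    by (simp add: average_def inner_sum_left Bochner_Integration.integral_sum i2)
  finally show ?thesis .
qed

text \<open>The descent inequality applies at the mean iterate, which moves by
  \<open>\<eta> k\<close> times the average estimator. Polarisation bounds <m, d> below by |d|^2 / 2
  - |m - d|^2 / 2, and |m|^2 \<le> 2 |m - d|^2 + 2 |d|^2 handles the quadratic term.\<close>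

lemma phi_step:
  assumes \<eta>: "0 \<le> \<eta> k" and dm: "\<And>i. i < n \<Longrightarrow> \<delta> i k \<le> dm"
  shows "phi (Suc k) \<le> phi k - \<eta> k / 2 * G k + \<eta> k * (Lf\<^sup>2 * v k + Lf\<^sup>2 * dm\<^sup>2)
    + Lf / 2 * (\<eta> k)\<^sup>2 * (2 * G k + 4 * Lf\<^sup>2 * v k + 4 * Lf\<^sup>2 * dm\<^sup>2 + gsq k / n)"
proof -
  let ?d = "\<lambda>\<omega>. grad p f (xb k \<omega>)"
  have ig: "integrable M (\<lambda>\<omega>. inner (gavg k \<omega>) (?d \<omega>))"
    by (intro integrable_inner_of_sq integrable_gavg_sq integrable_grad_f_sq
      measurable_euclid_borelD[OF measurable_average_gen[OF measurable_g]] measurable_euclid_borelD[OF measurable_grad_f])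
  have im: "integrable M (\<lambda>\<omega>. inner (mavg k \<omega>) (?d \<omega>))"
    by (intro integrable_inner_of_sq integrable_mavg_sq integrable_grad_f_sq
      measurable_euclid_borelD[OF measurable_average_gen[OF measurable_m]] measurable_euclid_borelD[OF measurable_grad_f])
  have "phi (Suc k) \<le> (\<integral>\<omega>. gap k \<omega> - \<eta> k * inner (gavg k \<omega>) (?d \<omega>) + Lf / 2 * (\<eta> k)\<^sup>2 * (norm (gavg k \<omega>))\<^sup>2 \<partial>M)"
    unfolding phi_def
  proof (rule integral_mono[OF integrable_gap])
    show "integrable M (\<lambda>\<omega>. gap k \<omega> - \<eta> k * inner (gavg k \<omega>) (?d \<omega>) + Lf / 2 * (\<eta> k)\<^sup>2 * (norm (gavg k \<omega>))\<^sup>2)"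
      by (rule Bochner_Integration.integrable_add[OF Bochner_Integration.integrable_diff[OF integrable_gap
            integrable_mult_right[OF ig]] integrable_mult_right[OF integrable_gavg_sq]])
    fix \<omega> assume w: "\<omega> \<in> space M"
    have "xb (Suc k) \<omega> = xb k \<omega> - \<eta> k *\<^sub>R gavg k \<omega>"
      unfolding xb_def by (rule average_step[OF wg x_Suc])
    then have "xb (Suc k) \<omega> - xb k \<omega> = - (\<eta> k *\<^sub>R gavg k \<omega>)" by simp
    with smooth_quadratic_bound[OF smooth_f xb_in[OF w, of k] xb_in[OF w, of "Suc k"]]
    have "\<bar>f (xb (Suc k) \<omega>) - f (xb k \<omega>) + \<eta> k * inner (?d \<omega>) (gavg k \<omega>)\<bar> \<le> Lf / 2 * ((\<eta> k)\<^sup>2 * (norm (gavg k \<omega>))\<^sup>2)"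
      by (simp add: power_mult_distrib)
    then have "f (xb (Suc k) \<omega>) - f (xb k \<omega>) + \<eta> k * inner (?d \<omega>) (gavg k \<omega>) \<le> Lf / 2 * ((\<eta> k)\<^sup>2 * (norm (gavg k \<omega>))\<^sup>2)"
      by linarith
    then show "gap (Suc k) \<omega> \<le> gap k \<omega> - \<eta> k * inner (gavg k \<omega>) (?d \<omega>) + Lf / 2 * (\<eta> k)\<^sup>2 * (norm (gavg k \<omega>))\<^sup>2"
      by (simp add: inner_commute)
  qed
  also have "\<dots> = phi k - \<eta> k * (\<integral>\<omega>. inner (mavg k \<omega>) (?d \<omega>) \<partial>M) + Lf / 2 * (\<eta> k)\<^sup>2 * (\<integral>\<omega>. (norm (gavg k \<omega>))\<^sup>2 \<partial>M)"
    unfolding Bochner_Integration.integral_add[OF Bochner_Integration.integrable_diff[OF integrable_gap integrable_mult_right[OF ig]]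
        integrable_mult_right[OF integrable_gavg_sq]]
      Bochner_Integration.integral_diff[OF integrable_gap integrable_mult_right[OF ig]]
    by (simp only: integral_mult_right_zero expectation_inner_gavg phi_def)
  also have "\<dots> \<le> phi k - \<eta> k * (G k / 2 - (Lf\<^sup>2 * v k + Lf\<^sup>2 * dm\<^sup>2))
      + Lf / 2 * (\<eta> k)\<^sup>2 * ((2 * G k + 4 * Lf\<^sup>2 * v k + 4 * Lf\<^sup>2 * dm\<^sup>2) + gsq k / n)"
  proof (intro add_mono diff_mono mult_left_mono order_refl)
    have err: "(norm (mavg k \<omega> - ?d \<omega>))\<^sup>2 \<le> 2 * Lf\<^sup>2 * V k \<omega> + 2 * Lf\<^sup>2 * dm\<^sup>2" if "\<omega> \<in> space M" for \<omega>
      by (rule mavg_error[OF that dm])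
    have "(\<integral>\<omega>. (norm (?d \<omega>))\<^sup>2 / 2 - (Lf\<^sup>2 * V k \<omega> + Lf\<^sup>2 * dm\<^sup>2) \<partial>M) \<le> (\<integral>\<omega>. inner (mavg k \<omega>) (?d \<omega>) \<partial>M)"
    proof (rule integral_mono)
      fix \<omega> assume w: "\<omega> \<in> space M"
      have "(norm (mavg k \<omega> - ?d \<omega>))\<^sup>2 = (norm (mavg k \<omega>))\<^sup>2 - 2 * inner (mavg k \<omega>) (?d \<omega>) + (norm (?d \<omega>))\<^sup>2"
        by (simp add: power2_norm_eq_inner inner_diff_left inner_diff_right inner_commute)
      then show "(norm (?d \<omega>))\<^sup>2 / 2 - (Lf\<^sup>2 * V k \<omega> + Lf\<^sup>2 * dm\<^sup>2) \<le> inner (mavg k \<omega>) (?d \<omega>)"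
        using err[OF w] zero_le_power2[of "norm (mavg k \<omega>)"] by linarith
    qed (use integrable_grad_f_sq integrable_V im in auto)
    then show "G k / 2 - (Lf\<^sup>2 * v k + Lf\<^sup>2 * dm\<^sup>2) \<le> (\<integral>\<omega>. inner (mavg k \<omega>) (?d \<omega>) \<partial>M)"
      using integrable_grad_f_sq integrable_V M.prob_space by (simp add: G_def v_def)
    have "(\<integral>\<omega>. (norm (mavg k \<omega>))\<^sup>2 \<partial>M) \<le> (\<integral>\<omega>. 2 * (norm (?d \<omega>))\<^sup>2 + 4 * Lf\<^sup>2 * V k \<omega> + 4 * Lf\<^sup>2 * dm\<^sup>2 \<partial>M)"
    proof (rule integral_mono[OF integrable_mavg_sq])
      fix \<omega> assume w: "\<omega> \<in> space M"
      have "(norm (mavg k \<omega>))\<^sup>2 \<le> 2 * (norm (mavg k \<omega> - ?d \<omega>))\<^sup>2 + 2 * (norm (?d \<omega>))\<^sup>2"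
        using norm_sum_sq_le[of "mavg k \<omega> - ?d \<omega>" "?d \<omega>"] by simp
      then show "(norm (mavg k \<omega>))\<^sup>2 \<le> 2 * (norm (?d \<omega>))\<^sup>2 + 4 * Lf\<^sup>2 * V k \<omega> + 4 * Lf\<^sup>2 * dm\<^sup>2"
        using err[OF w] by linarith
    qed (use integrable_grad_f_sq integrable_V in auto)
    also have "\<dots> = 2 * G k + 4 * Lf\<^sup>2 * v k + 4 * Lf\<^sup>2 * dm\<^sup>2"
      using integrable_grad_f_sq integrable_V M.prob_space by (simp add: G_def v_def)
    finally show "(\<integral>\<omega>. (norm (gavg k \<omega>))\<^sup>2 \<partial>M) \<le> 2 * G k + 4 * Lf\<^sup>2 * v k + 4 * Lf\<^sup>2 * dm\<^sup>2 + gsq k / n"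
      using expectation_gavg_sq[of k] by linarith
  qed (use \<eta> Lf in auto)
  finally show ?thesis by (simp add: algebra_simps)
qed

end

section \<open>Recursions for real sequences\<close>

text \<open>Put h = 16 / q and t = k + h. Half of the contraction q / 4 pays for the noise, because
  t \<le> h (k + 1); the other half, q / 8 = 2 / h, covers the relative decrease of 1 / t^2, because
  t \<ge> h.\<close>

lemma inverse_square_decay:
  fixes v :: "nat \<Rightarrow> real"
  assumes q: "0 < q" "q \<le> 1" and b: "0 \<le> b" and K: "0 \<le> K"
    and init: "v 0 * (16 / q)\<^sup>2 \<le> K" and Kb: "8 * b * (16 / q)\<^sup>2 \<le> q * K"
    and step: "\<And>k. v (Suc k) \<le> (1 - q / 4) * v k + b / (real k + 1)\<^sup>2"
  shows "v k \<le> K / (real k + 16 / q)\<^sup>2"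
proof (induction k)
  case 0
  have "0 < (16 / q)\<^sup>2" using q by simp
  then show ?case using init by (simp add: pos_le_divide_eq)
next
  case (Suc k)
  define h where "h = 16 / q"
  define t where "t = real k + h"
  have h: "16 \<le> h" using q by (simp add: h_def pos_le_divide_eq)
  have t: "h \<le> t" "0 < t" using h by (auto simp: t_def)
  have "b / (real k + 1)\<^sup>2 \<le> q / 8 * K / t\<^sup>2"
  proof -
    have "t \<le> h * (real k + 1)" using h mult_right_mono[of 1 h "real k"] by (simp add: t_def algebra_simps)
    then have "t\<^sup>2 \<le> (h * (real k + 1))\<^sup>2" using t by (intro power_mono) auto
    then have "b * t\<^sup>2 \<le> b * (h\<^sup>2 * (real k + 1)\<^sup>2)" using b by (intro mult_left_mono) (auto simp: power_mult_distrib)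
    also have "\<dots> = (b * h\<^sup>2) * (real k + 1)\<^sup>2" by simp
    also have "\<dots> \<le> (q / 8 * K) * (real k + 1)\<^sup>2" using Kb by (intro mult_right_mono) (auto simp: h_def)
    finally show ?thesis using t by (simp add: field_simps)
  qed
  moreover have "(1 - q / 4) * v k \<le> (1 - q / 4) * (K / t\<^sup>2)"
    using Suc q by (intro mult_left_mono) (auto simp: t_def h_def)
  ultimately have "v (Suc k) \<le> (1 - q / 8) * K / t\<^sup>2"
    using step[of k] by (simp add: algebra_simps add_divide_distrib diff_divide_distrib)
  also have "\<dots> \<le> K / (t + 1)\<^sup>2"
  proof -
    have "(1 - q / 8) * (t + 1)\<^sup>2 \<le> t\<^sup>2"
    proof -
      have "q / 8 = 2 / h" using q by (simp add: h_def)
      then have "(1 - q / 8) * (t + 1)\<^sup>2 = (t + 1)\<^sup>2 - 2 * (t + 1)\<^sup>2 / h" by (simp add: algebra_simps)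
      moreover have "2 * t + 1 \<le> 2 * (t + 1)\<^sup>2 / h"
      proof -
        have "h * (2 * t + 1) \<le> 2 * (t + 1)\<^sup>2"
          using mult_right_mono[OF t(1), of "2 * t + 1"] t by (simp add: power2_eq_square algebra_simps)
        then show ?thesis using h by (simp add: pos_le_divide_eq mult.commute)
      qed
      ultimately show ?thesis by (simp add: power2_eq_square algebra_simps)
    qed
    then have "K * ((1 - q / 8) * (t + 1)\<^sup>2) \<le> K * t\<^sup>2" using K by (rule mult_left_mono)
    then show ?thesis using t by (simp add: divide_le_eq pos_le_divide_eq field_simps)
  qed
  finally show ?case by (simp add: t_def h_def add_ac)
qed

text \<open>The rate 4 exceeds both orders of decay, leaving -3 / s^2 and -2 / s^3 as slack after
  the noise is added. The initial value is charged to \<open>d\<close> alone, so that the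
  coefficient of the slow term is the noise level \<open>a\<close>.\<close>

lemma inverse_linear_decay:
  fixes \<phi> :: "nat \<Rightarrow> real"
  assumes t: "4 \<le> t" and a: "0 \<le> a" and d: "0 \<le> d"
    and init: "\<phi> 0 * t\<^sup>2 \<le> d"
    and step: "\<And>k. \<phi> (Suc k) \<le> (1 - 4 / (real k + t)) * \<phi> k + a / (real k + t)\<^sup>2 + 2 * d / (real k + t) ^ 3"
  shows "\<phi> k \<le> a / (real k + t) + d / (real k + t)\<^sup>2"
proof (induction k)
  case 0
  have "\<phi> 0 \<le> d / t\<^sup>2" using init t by (simp add: pos_le_divide_eq)
  moreover have "0 \<le> a / t" using a t by simp
  ultimately show ?case by simp
next
  case (Suc k)
  define s where "s = real k + t"
  have s: "4 \<le> s" using t by (simp add: s_def)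
  have "(1 - 4 / s) * \<phi> k \<le> (1 - 4 / s) * (a / s + d / s\<^sup>2)"
    using Suc s by (intro mult_left_mono) (auto simp: s_def)
  then have "\<phi> (Suc k) \<le> (1 - 4 / s) * (a / s + d / s\<^sup>2) + a / s\<^sup>2 + 2 * d / s ^ 3"
    using step[of k] by (simp add: s_def)
  also have "\<dots> = a * (1 / s - 3 / s\<^sup>2) + d * (1 / s\<^sup>2 - 2 / s ^ 3)"
    using s by (simp add: field_simps power2_eq_square power3_eq_cube)
  also have "\<dots> \<le> a * (1 / (s + 1)) + d * (1 / (s + 1)\<^sup>2)"
  proof (intro add_mono mult_left_mono)
    have "1 / s - 1 / (s + 1) = 1 / (s * (s + 1))" using s by (simp add: field_simps)
    also have "\<dots> \<le> 1 / s\<^sup>2" using s by (intro divide_left_mono) (auto simp: power2_eq_square)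
    also have "\<dots> \<le> 3 / s\<^sup>2" using s by (intro divide_right_mono) auto
    finally show "1 / s - 3 / s\<^sup>2 \<le> 1 / (s + 1)" by simp
    \<comment> \<open>The right side exceeds the left one by 3 s + 2.\<close>
    have "(s - 2) * (s + 1)\<^sup>2 \<le> s ^ 3" using s by (simp add: power2_eq_square power3_eq_cube algebra_simps)
    then have "(s - 2) / s ^ 3 \<le> 1 / (s + 1)\<^sup>2" using s by (simp add: divide_le_eq pos_le_divide_eq field_simps)
    moreover have "(s - 2) / s ^ 3 = 1 / s\<^sup>2 - 2 / s ^ 3" using s by (simp add: field_simps power2_eq_square power3_eq_cube)
    ultimately show "1 / s\<^sup>2 - 2 / s ^ 3 \<le> 1 / (s + 1)\<^sup>2" by simp
  qed (use a d in auto)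
  finally show ?case by (simp add: s_def add_ac)
qed

text \<open>Times \<open>p\<close>, this dominates the additive part of \<open>gsq_bound\<close>;
  its last summand uses p^2 \<delta>^2 \<le> p \<kappa>\<delta>^2.\<close>

definition noise_const :: "real \<Rightarrow> real \<Rightarrow> real \<Rightarrow> real \<Rightarrow> real \<Rightarrow> real" where
  "noise_const Lf \<sigma>0 \<sigma>1 \<sigma>2 \<kappa>\<delta> = 16 * (1 + \<sigma>0\<^sup>2) * \<sigma>2\<^sup>2 + 4 * \<sigma>1\<^sup>2 + Lf\<^sup>2 * \<kappa>\<delta>\<^sup>2 / 2"

text \<open>Coefficient of (p / n) \<eta>^2 in the recursion for the gap: the first summand is the
  bias, the second the noise of the averaged estimator. None of its arguments belongs to the
  network.\<close>

definition gap_const :: "real \<Rightarrow> real \<Rightarrow> real \<Rightarrow> real \<Rightarrow> real \<Rightarrow> real" where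
  "gap_const Lf \<sigma>0 \<sigma>1 \<sigma>2 \<kappa>\<delta> = 2 * Lf\<^sup>2 * \<kappa>\<delta>\<^sup>2 + Lf * noise_const Lf \<sigma>0 \<sigma>1 \<sigma>2 \<kappa>\<delta> / 2"

text \<open>The second entry of the maximum is the stationary level, noise divided by decay rate;
  the first covers the two initial errors.\<close>

definition lyapunov_const :: "real \<Rightarrow> real \<Rightarrow> real \<Rightarrow> real \<Rightarrow> real \<Rightarrow> real \<Rightarrow> real" where
  "lyapunov_const Lf \<nu> e N A R0 = max (2 * \<bar>R0\<bar>) ((A + e * N) / min (7 * \<nu> / 32) (Lf\<^sup>2))"

text \<open>The two entries are the requirements \<open>init\<close> and \<open>Kb\<close> of
  \<open>inverse_square_decay\<close>, solved for its constant.\<close>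

definition consensus_const :: "real \<Rightarrow> real \<Rightarrow> real \<Rightarrow> real" where
  "consensus_const q b R0 = max (\<bar>R0\<bar> * (16 / q)\<^sup>2) (8 * b * (16 / q)\<^sup>2 / q)"

text \<open>In the application \<open>e = 2 \<epsilon>\<^sub>2\<close> and \<open>q = \<gamma> \<rho>\<^sub>2(L)\<close>. The two bounds on \<open>\<eta>\<close> are the two terms of \<open>d2\<close>;
  the second one provides the numerical slack of the estimates below.\<close>

locale step_size =
  fixes n p :: nat and Lf \<sigma>0 \<sigma>1 \<tau>0 \<sigma>2 \<kappa>\<delta> q e \<eta> dm :: real
  assumes n: "1 \<le> n" and p: "1 \<le> p" and Lf: "0 < Lf" and q: "0 < q" and e: "e = 2 + 1 / q"
    and \<eta>: "0 < \<eta>" and \<eta>1: "Lf\<^sup>2 * \<eta> \<le> 2 / 9 * q"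
    and \<eta>2: "64 * real p * (1 + \<sigma>0\<^sup>2) * (1 + \<tau>0\<^sup>2) * (e + Lf) * \<eta> \<le> 1"
    and dm: "dm\<^sup>2 = \<kappa>\<delta>\<^sup>2 * (real p * \<eta>) / (real n + real p)"
begin

abbreviation "N \<equiv> noise_const Lf \<sigma>0 \<sigma>1 \<sigma>2 \<kappa>\<delta>"
abbreviation "A \<equiv> gap_const Lf \<sigma>0 \<sigma>1 \<sigma>2 \<kappa>\<delta>"

lemma N_nonneg: "0 \<le> N" by (simp add: noise_const_def)
lemma A_nonneg: "0 \<le> A" using N_nonneg Lf by (simp add: gap_const_def)
lemma e_ge: "2 \<le> e" using q by (simp add: e)

text \<open>In this notation \<open>\<eta>2\<close> reads X e + X Lf \<le> 1: the second-moment
  factor times the step size is small against both constants that it will meet.\<close>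

definition "X = 64 * real p * (1 + \<sigma>0\<^sup>2) * (1 + \<tau>0\<^sup>2) * \<eta>"
definition "Y = 64 * real p * (1 + \<sigma>0\<^sup>2) * \<eta>"

lemma X_bounds: "0 < X" "X * e \<le> 1" "X * Lf \<le> 1" "Y \<le> X" "0 < Y" "64 * real p * \<eta> \<le> Y" "64 * \<eta> \<le> Y"
proof -
  have pos: "0 < 1 + \<sigma>0\<^sup>2" "0 < 1 + \<tau>0\<^sup>2" by (auto simp: add_pos_nonneg)
  show X: "0 < X" and Y: "0 < Y" using p \<eta> pos by (simp_all add: X_def Y_def)
  have "X * e + X * Lf \<le> 1" using \<eta>2 by (simp add: X_def algebra_simps)
  moreover have "0 < X * e" "0 < X * Lf" using X e_ge Lf by simp_all
  ultimately show "X * e \<le> 1" "X * Lf \<le> 1" by linarith+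
  have "Y * 1 \<le> Y * (1 + \<tau>0\<^sup>2)" using Y by (intro mult_left_mono) auto
  then show "Y \<le> X" by (simp add: X_def Y_def mult_ac)
  have "64 * real p * \<eta> * 1 \<le> 64 * real p * \<eta> * (1 + \<sigma>0\<^sup>2)" using \<eta> by (intro mult_left_mono) auto
  then show 1: "64 * real p * \<eta> \<le> Y" by (simp add: Y_def mult_ac)
  have "64 * \<eta> * 1 \<le> 64 * \<eta> * real p" using \<eta> p by (intro mult_left_mono) auto
  then show "64 * \<eta> \<le> Y" using 1 by (simp add: mult_ac)
qed

lemma X_le: "X \<le> 1 / 2"
proof -
  have "X * 2 \<le> X * e" using X_bounds e_ge by (intro mult_left_mono) auto
  then show ?thesis using X_bounds by linarith
qed

text \<open>This keeps \<open>p\<close> out of the Lyapunov bound: there the noise is of size p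
  \<eta>^2, hence at most a fixed multiple of \<eta>.\<close>

lemma p_\<eta>: "real p * \<eta> \<le> 1 / 128"
  using X_le X_bounds by linarith

text \<open>Dropping \<open>p\<close> from the denominator n + p gives the factor p / n of the
  leading term; dropping \<open>n\<close> instead gives a bound that stays linear in
  \<open>p\<close> after multiplication by p^2.\<close>

lemma dm_bounds: "dm\<^sup>2 \<le> \<kappa>\<delta>\<^sup>2 * (real p / real n) * \<eta>" "(real p)\<^sup>2 * dm\<^sup>2 \<le> real p * \<kappa>\<delta>\<^sup>2"
proof -
  have "\<kappa>\<delta>\<^sup>2 * (real p * \<eta>) / (real n + real p) \<le> \<kappa>\<delta>\<^sup>2 * (real p * \<eta>) / real n"
    using n p \<eta> by (intro divide_left_mono) auto
  then show "dm\<^sup>2 \<le> \<kappa>\<delta>\<^sup>2 * (real p / real n) * \<eta>" unfolding dm by simp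
  have "\<kappa>\<delta>\<^sup>2 * (real p * \<eta>) / (real n + real p) \<le> \<kappa>\<delta>\<^sup>2 * (real p * \<eta>) / real p"
    using n p \<eta> by (intro divide_left_mono) auto
  then have "dm\<^sup>2 \<le> \<kappa>\<delta>\<^sup>2 * \<eta>" unfolding dm using p by simp
  then have "(real p)\<^sup>2 * dm\<^sup>2 \<le> (real p)\<^sup>2 * (\<kappa>\<delta>\<^sup>2 * \<eta>)" by (rule mult_left_mono) simp
  also have "\<dots> = real p * \<kappa>\<delta>\<^sup>2 * (real p * \<eta>)" by (simp add: power2_eq_square)
  also have "\<dots> \<le> real p * \<kappa>\<delta>\<^sup>2 * 1" using p_\<eta> by (intro mult_left_mono) auto
  finally show "(real p)\<^sup>2 * dm\<^sup>2 \<le> real p * \<kappa>\<delta>\<^sup>2" by simp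
qed

section \<open>One-step contraction estimates\<close>

context
  fixes v \<phi> G gs v' \<phi>' :: real
  assumes v: "0 \<le> v" and G: "0 \<le> G" and gs: "0 \<le> gs"
    and gs_le: "gs \<le> 16 * real p * (1 + \<sigma>0\<^sup>2) * (1 + \<tau>0\<^sup>2) * G + 8 * real p * (1 + \<sigma>0\<^sup>2) * Lf\<^sup>2 * v
    + (16 * real p * (1 + \<sigma>0\<^sup>2) * \<sigma>2\<^sup>2 + 4 * real p * \<sigma>1\<^sup>2 + (real p)\<^sup>2 * Lf\<^sup>2 * dm\<^sup>2 / 2)"
begin

lemma gs_bound: "\<eta>\<^sup>2 * gs \<le> X * (\<eta> / 4 * G) + X * (\<eta> * Lf\<^sup>2 / 8 * v) + N * real p * \<eta>\<^sup>2"
proof -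
  have "16 * real p * (1 + \<sigma>0\<^sup>2) * \<sigma>2\<^sup>2 + 4 * real p * \<sigma>1\<^sup>2 + (real p)\<^sup>2 * Lf\<^sup>2 * dm\<^sup>2 / 2 \<le> N * real p"
  proof -
    have "Lf\<^sup>2 * ((real p)\<^sup>2 * dm\<^sup>2) \<le> Lf\<^sup>2 * (real p * \<kappa>\<delta>\<^sup>2)" by (rule mult_left_mono[OF dm_bounds(2)]) simp
    then show ?thesis by (simp add: noise_const_def algebra_simps)
  qed
  then have "\<eta>\<^sup>2 * gs \<le> \<eta>\<^sup>2 * (16 * real p * (1 + \<sigma>0\<^sup>2) * (1 + \<tau>0\<^sup>2) * G + 8 * real p * (1 + \<sigma>0\<^sup>2) * Lf\<^sup>2 * v + N * real p)"
    using gs_le by (intro mult_left_mono) auto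
  also have "\<dots> = X * (\<eta> / 4 * G) + Y * (\<eta> * Lf\<^sup>2 / 8 * v) + N * real p * \<eta>\<^sup>2"
    by (simp add: X_def Y_def power2_eq_square algebra_simps)
  also have "Y * (\<eta> * Lf\<^sup>2 / 8 * v) \<le> X * (\<eta> * Lf\<^sup>2 / 8 * v)"
    using X_bounds \<eta> v by (intro mult_right_mono) auto
  finally show ?thesis by simp
qed

text \<open>The factor (1 + q)(1 - 3q/2) is at most 1 - q/2, and the estimators feed back at most
  q/36 because Lf^2 \<eta> \<le> 2q/9; this leaves 17/36. The first form charges the gradient to the
  descent of the gap, the second keeps it at order \<eta>^2 for use once it is bounded.\<close>

lemma
  assumes v': "v' \<le> (1 + q) * (1 - 3 / 2 * q) * v + (1 + 1 / q) * \<eta>\<^sup>2 * gs"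
  shows v_contract: "v' \<le> (1 - 17 / 36 * q) * v + \<eta> / 4 * G + e * N * real p * \<eta>\<^sup>2"
    and v_contract_sq: "v' \<le> (1 - 17 / 36 * q) * v + e * real p * (16 * (1 + \<sigma>0\<^sup>2) * (1 + \<tau>0\<^sup>2) * G + N) * \<eta>\<^sup>2"
proof -
  have "(1 + q) * (1 - 3 / 2 * q) = 1 - q / 2 - 3 / 2 * q\<^sup>2" by (simp add: power2_eq_square algebra_simps)
  then have 1: "(1 + q) * (1 - 3 / 2 * q) * v \<le> (1 - q / 2) * v" using v by (intro mult_right_mono) auto
  have "(1 + 1 / q) * (\<eta>\<^sup>2 * gs) \<le> e * (\<eta>\<^sup>2 * gs)" using gs by (intro mult_right_mono) (auto simp: e)
  also have "\<dots> \<le> e * (X * (\<eta> / 4 * G) + X * (\<eta> * Lf\<^sup>2 / 8 * v) + N * real p * \<eta>\<^sup>2)"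
    using e_ge by (intro mult_left_mono gs_bound) auto
  also have "\<dots> = (X * e) * (\<eta> / 4 * G) + (X * e) * (\<eta> * Lf\<^sup>2 / 8 * v) + e * N * real p * \<eta>\<^sup>2"
    by (simp add: algebra_simps)
  finally have 2: "(1 + 1 / q) * \<eta>\<^sup>2 * gs
      \<le> (X * e) * (\<eta> / 4 * G) + (X * e) * (\<eta> * Lf\<^sup>2 / 8 * v) + e * N * real p * \<eta>\<^sup>2" by simp
  have 3: "(X * e) * (\<eta> / 4 * G) \<le> 1 * (\<eta> / 4 * G)" using X_bounds \<eta> G by (intro mult_right_mono) auto
  have "(X * e) * (\<eta> * Lf\<^sup>2 / 8 * v) \<le> 1 * (\<eta> * Lf\<^sup>2 / 8 * v)"
    using X_bounds \<eta> v by (intro mult_right_mono) auto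
  also have "\<dots> \<le> q / 36 * v" unfolding mult_1 using \<eta>1 v by (intro mult_right_mono) (auto simp: mult.commute)
  finally have 4: "(X * e) * (\<eta> * Lf\<^sup>2 / 8 * v) \<le> q / 36 * v" .
  have "(1 - q / 2) * v + q / 36 * v = (1 - 17 / 36 * q) * v" by (simp add: algebra_simps)
  then show "v' \<le> (1 - 17 / 36 * q) * v + \<eta> / 4 * G + e * N * real p * \<eta>\<^sup>2"
    using v' 1 2 3 4 by linarith
  have "(X * e) * (\<eta> / 4 * G) + e * N * real p * \<eta>\<^sup>2
      = e * real p * (16 * (1 + \<sigma>0\<^sup>2) * (1 + \<tau>0\<^sup>2) * G + N) * \<eta>\<^sup>2"
    by (simp add: X_def power2_eq_square algebra_simps)
  then show "v' \<le> (1 - 17 / 36 * q) * v + e * real p * (16 * (1 + \<sigma>0\<^sup>2) * (1 + \<tau>0\<^sup>2) * G + N) * \<eta>\<^sup>2"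
    using v' 1 2 4 \<open>(1 - q / 2) * v + q / 36 * v = (1 - 17 / 36 * q) * v\<close> by linarith
qed

text \<open>The factor 1 / n is given up on the gradient and consensus terms and kept on the noise.
  The constants are 23/64 = 1/2 - 2/128 - 1/8 and 35/32 = 1 + 4/128 + 1/16, and the factor 33/32 of
  the bias is rounded up to 2.\<close>

lemma phi_contract:
  assumes \<phi>': "\<phi>' \<le> \<phi> - \<eta> / 2 * G + \<eta> * (Lf\<^sup>2 * v + Lf\<^sup>2 * dm\<^sup>2)
    + Lf / 2 * \<eta>\<^sup>2 * (2 * G + 4 * Lf\<^sup>2 * v + 4 * Lf\<^sup>2 * dm\<^sup>2 + gs / n)"
  shows "\<phi>' \<le> \<phi> - 23 / 64 * \<eta> * G + 35 / 32 * \<eta> * Lf\<^sup>2 * v + A * (real p / real n) * \<eta>\<^sup>2"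
proof -
  have L\<eta>: "64 * \<eta> * Lf \<le> 1"
    using mult_right_mono[of "64 * \<eta>" X Lf] X_bounds Lf by linarith
  define Z where "Z = 2 * G + 4 * Lf\<^sup>2 * v + 4 * Lf\<^sup>2 * dm\<^sup>2"
  have Z: "0 \<le> Z" using G v by (simp add: Z_def)
  have 1: "Lf / 2 * \<eta>\<^sup>2 * Z \<le> \<eta> / 128 * Z"
  proof -
    have "Lf / 2 * \<eta>\<^sup>2 * Z = (64 * \<eta> * Lf) * (\<eta> / 128 * Z)" by (simp add: power2_eq_square)
    also have "\<dots> \<le> 1 * (\<eta> / 128 * Z)" using L\<eta> \<eta> Z by (intro mult_right_mono) auto
    finally show ?thesis by simp
  qed
  have 2: "Lf / 2 * \<eta>\<^sup>2 * (gs / n) \<le> \<eta> / 8 * G + \<eta> * Lf\<^sup>2 / 16 * v + Lf * N / 2 * (real p / real n) * \<eta>\<^sup>2"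
  proof -
    have "Lf / 2 * \<eta>\<^sup>2 * (gs / n) = Lf / (2 * n) * (\<eta>\<^sup>2 * gs)" by simp
    also have "\<dots> \<le> Lf / (2 * n) * (X * (\<eta> / 4 * G) + X * (\<eta> * Lf\<^sup>2 / 8 * v) + N * real p * \<eta>\<^sup>2)"
      using Lf by (intro mult_left_mono gs_bound) auto
    also have "\<dots> = (X * Lf) * ((\<eta> / 8 * G + \<eta> * Lf\<^sup>2 / 16 * v) / n) + Lf * N / 2 * (real p / real n) * \<eta>\<^sup>2"
      using n by (simp add: field_simps)
    also have "(X * Lf) * ((\<eta> / 8 * G + \<eta> * Lf\<^sup>2 / 16 * v) / n) \<le> 1 * ((\<eta> / 8 * G + \<eta> * Lf\<^sup>2 / 16 * v) / 1)"
      using X_bounds Lf \<eta> G v n by (intro mult_mono divide_left_mono) auto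
    finally show ?thesis by simp
  qed
  have 3: "\<eta> * (Lf\<^sup>2 * dm\<^sup>2) \<le> \<eta> * (Lf\<^sup>2 * (\<kappa>\<delta>\<^sup>2 * (real p / real n) * \<eta>))"
    using dm_bounds(1) \<eta> by (intro mult_left_mono) auto
  have "\<phi>' \<le> \<phi> - \<eta> / 2 * G + \<eta> * (Lf\<^sup>2 * v + Lf\<^sup>2 * dm\<^sup>2) + Lf / 2 * \<eta>\<^sup>2 * Z + Lf / 2 * \<eta>\<^sup>2 * (gs / n)"
    using \<phi>' by (simp add: Z_def distrib_left)
  also have "\<dots> \<le> \<phi> - \<eta> / 2 * G + \<eta> * (Lf\<^sup>2 * v + Lf\<^sup>2 * dm\<^sup>2) + \<eta> / 128 * Z
      + (\<eta> / 8 * G + \<eta> * Lf\<^sup>2 / 16 * v + Lf * N / 2 * (real p / real n) * \<eta>\<^sup>2)"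
    using 1 2 by linarith
  also have "\<dots> = \<phi> - 23 / 64 * \<eta> * G + 35 / 32 * \<eta> * Lf\<^sup>2 * v + 33 / 32 * (\<eta> * (Lf\<^sup>2 * dm\<^sup>2))
      + Lf * N / 2 * (real p / real n) * \<eta>\<^sup>2"
    by (simp add: Z_def algebra_simps)
  also have "\<dots> \<le> \<phi> - 23 / 64 * \<eta> * G + 35 / 32 * \<eta> * Lf\<^sup>2 * v + 2 * (\<eta> * (Lf\<^sup>2 * (\<kappa>\<delta>\<^sup>2 * (real p / real n) * \<eta>)))
      + Lf * N / 2 * (real p / real n) * \<eta>\<^sup>2"
  proof -
    have "0 \<le> \<eta> * (Lf\<^sup>2 * dm\<^sup>2)" using \<eta> by simp
    then show ?thesis using 3 by linarith
  qed
  also have "\<dots> = \<phi> - 23 / 64 * \<eta> * G + 35 / 32 * \<eta> * Lf\<^sup>2 * v + A * (real p / real n) * \<eta>\<^sup>2"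
    by (simp add: gap_const_def power2_eq_square algebra_simps)
  finally show ?thesis .
qed

text \<open>Of the descent 23/64 the consensus recursion consumes 1/4; the remaining 7/64 becomes
  the decay rate 7 \<nu> / 32 of \<phi> by the Polyak-Lojasiewicz inequality. A new value is then a
  weighted mean of the old one and the stationary level.\<close>

lemma lyapunov_step:
  assumes v': "v' \<le> (1 + q) * (1 - 3 / 2 * q) * v + (1 + 1 / q) * \<eta>\<^sup>2 * gs"
    and \<phi>': "\<phi>' \<le> \<phi> - \<eta> / 2 * G + \<eta> * (Lf\<^sup>2 * v + Lf\<^sup>2 * dm\<^sup>2)
    + Lf / 2 * \<eta>\<^sup>2 * (2 * G + 4 * Lf\<^sup>2 * v + 4 * Lf\<^sup>2 * dm\<^sup>2 + gs / n)"
    and PL: "2 * \<nu> * \<phi> \<le> G" and \<nu>: "0 < \<nu>" and \<phi>: "0 \<le> \<phi>" and q2: "q \<le> 1"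
    and B: "\<phi> + v \<le> lyapunov_const Lf \<nu> e N A R0"
  shows "\<phi>' + v' \<le> lyapunov_const Lf \<nu> e N A R0"
proof -
  let ?B = "lyapunov_const Lf \<nu> e N A R0"
  define c where "c = min (7 * \<nu> / 32) (Lf\<^sup>2)"
  have c: "0 < c" "c \<le> 7 * \<nu> / 32" "c \<le> Lf\<^sup>2" using \<nu> Lf by (auto simp: c_def)
  have noise: "A * (real p / real n) * \<eta>\<^sup>2 + e * N * real p * \<eta>\<^sup>2 \<le> \<eta> * (A + e * N)"
  proof -
    have "A * (real p / real n) \<le> A * real p"
    proof (rule mult_left_mono)
      show "real p / real n \<le> real p" using n by (simp add: divide_le_eq mult_le_cancel_left1)
    qed (rule A_nonneg)
    then have "A * (real p / real n) * \<eta>\<^sup>2 \<le> A * real p * \<eta>\<^sup>2" by (rule mult_right_mono) simp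
    then have "A * (real p / real n) * \<eta>\<^sup>2 + e * N * real p * \<eta>\<^sup>2 \<le> (\<eta> * (A + e * N)) * (real p * \<eta>)"
      by (simp add: power2_eq_square algebra_simps)
    also have "\<dots> \<le> (\<eta> * (A + e * N)) * 1"
      using p_\<eta> \<eta> A_nonneg N_nonneg e_ge by (intro mult_left_mono) auto
    finally show ?thesis by simp
  qed
  have G1: "\<eta> * (7 / 64) * (2 * \<nu> * \<phi>) \<le> \<eta> * (7 / 64) * G" using PL \<eta> by (intro mult_left_mono) auto
  have G2: "\<eta> * c * \<phi> \<le> \<eta> * (7 * \<nu> / 32) * \<phi>" using c \<eta> \<phi> by (intro mult_right_mono mult_left_mono) auto
  have V1: "Lf\<^sup>2 * \<eta> * v \<le> 2 / 9 * q * v" using \<eta>1 v by (intro mult_right_mono) auto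
  have V2: "\<eta> * c * v \<le> \<eta> * Lf\<^sup>2 * v" using c \<eta> v by (intro mult_right_mono mult_left_mono) auto
  have "\<phi>' + v' \<le> \<phi> + v - \<eta> * (7 / 64) * G + 35 / 32 * (Lf\<^sup>2 * \<eta> * v) - 17 / 36 * q * v
      + (A * (real p / real n) * \<eta>\<^sup>2 + e * N * real p * \<eta>\<^sup>2)"
    using v_contract[OF v'] phi_contract[OF \<phi>'] by (simp add: algebra_simps)
  also have "\<dots> \<le> \<phi> + v - \<eta> * c * \<phi> - \<eta> * c * v + \<eta> * (A + e * N)"
  proof -
    have 1: "\<eta> * c * \<phi> \<le> \<eta> * (7 / 64) * G" using G1 G2 by (simp add: algebra_simps)
    have "\<eta> * Lf\<^sup>2 * v = Lf\<^sup>2 * \<eta> * v" by simp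
    then have 2: "\<eta> * c * v \<le> Lf\<^sup>2 * \<eta> * v" using V2 by linarith
    have "0 \<le> Lf\<^sup>2 * \<eta> * v" using \<eta> v by simp
    \<comment> \<open>With Lf^2 \<eta> \<le> 2q/9 the left side is at most (67/32)(2/9) q v =
      (67/144) q v, while 17/36 = 68/144.\<close>
    then have 3: "35 / 32 * (Lf\<^sup>2 * \<eta> * v) + Lf\<^sup>2 * \<eta> * v \<le> 17 / 36 * q * v" using V1 by linarith
    show ?thesis using 1 2 3 noise by linarith
  qed
  also have "\<dots> \<le> (1 - \<eta> * c) * (\<phi> + v) + \<eta> * c * ?B"
  proof -
    have "(A + e * N) / c \<le> ?B" by (simp add: lyapunov_const_def c_def)
    then have "A + e * N \<le> c * ?B" using c by (simp add: pos_divide_le_eq mult.commute)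
    then have "\<eta> * (A + e * N) \<le> \<eta> * (c * ?B)" using \<eta> by (intro mult_left_mono) auto
    then show ?thesis by (simp add: algebra_simps)
  qed
  also have "\<dots> \<le> (1 - \<eta> * c) * ?B + \<eta> * c * ?B"
  proof -
    \<comment> \<open>The weight of the mean has to be at most 1, which is why the rate
      \<open>c\<close> is capped by Lf^2.\<close>
    have "\<eta> * c \<le> \<eta> * Lf\<^sup>2" using c \<eta> by (intro mult_left_mono) auto
    then have "\<eta> * c \<le> 1" using \<eta>1 q2 by (simp add: mult.commute)
    then show ?thesis using B by (intro add_right_mono mult_left_mono) auto
  qed
  also have "\<dots> = ?B" by (simp add: algebra_simps)
  finally show ?thesis .
qed

end

end

section \<open>Convergence rates\<close>

context zo_network
begin

section \<open>Verification of the step-size conditions and the rates\<close>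

context
  fixes \<nu> \<kappa>\<eta> \<kappa>\<delta> t1 R0 r s q e :: real
  assumes \<nu>: "0 < \<nu>" and \<kappa>: "8 / \<nu> < \<kappa>\<eta>"
    and r: "r = rho2 (laplacian n a)" and s: "s = rho (laplacian n a * laplacian n a)"
    and q: "q = \<gamma> * r" and e: "e = 2 + 1 / q"
    and \<gamma>0: "0 < \<gamma>" and \<gamma>1: "\<gamma> < d1 r s"
    and t1: "d2_hat p Lf \<sigma>0 \<tau>0 \<kappa>\<eta> r s \<gamma> < t1"
    and \<eta>_eq: "\<And>k. \<eta> k = \<kappa>\<eta> / (real k + t1)"
    and \<delta>_le: "\<forall>i<n. \<forall>k. \<delta> i k \<le> \<kappa>\<delta> * sqrt (p * \<eta> k) / sqrt (n + p)"
    and PL: "polyak_lojasiewicz p \<nu> f"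
    and init: "consensus_error n x0 \<le> R0" "f (average n x0) - fstar \<le> R0"
begin

lemma \<kappa>_pos: "0 < \<kappa>\<eta>"
  using \<kappa> \<nu> by (metis divide_pos_pos order_less_trans zero_less_numeral)

text \<open>The bound \<gamma> < d1 says 2 \<gamma> s < r. Multiplied by \<gamma> it gives the last
  claim, and multiplied by r, with r^2 \<le> s, it gives q \<le> 1/2.\<close>

lemma spectral_facts: "0 < r" "r\<^sup>2 \<le> s" "0 < q" "q \<le> 1 / 2" "\<gamma>\<^sup>2 * s < q / 2"
proof -
  show r0: "0 < r" unfolding r by (rule rho2_laplacian_pos[OF wg conn n2])
  show rs: "r\<^sup>2 \<le> s" unfolding r s by (rule rho2_sq_le[OF wg conn n2])
  have s0: "0 < s" using r0 rs zero_less_power2[of r] by linarith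
  show q0: "0 < q" using \<gamma>0 r0 by (simp add: q)
  have \<gamma>s: "\<gamma> * (2 * s) < r" using \<gamma>1 s0 by (simp add: d1_def pos_less_divide_eq)
  have "\<gamma> * (\<gamma> * (2 * s)) < \<gamma> * r" using \<gamma>s \<gamma>0 by (rule mult_strict_left_mono)
  then show "\<gamma>\<^sup>2 * s < q / 2" by (simp add: q power2_eq_square)
  have "\<gamma> * (2 * s) * r < r * r" using \<gamma>s r0 by (rule mult_strict_right_mono)
  then have "q * (2 * s) \<le> s" using rs by (simp add: q power2_eq_square mult_ac)
  then show "q \<le> 1 / 2" using s0 by simp
qed

lemma eps_facts: "0 < eps1 r s \<gamma>" "eps1 r s \<gamma> \<le> q / 2" "2 * eps2 r \<gamma> = e"
proof -
  show "0 < eps1 r s \<gamma>" using spectral_facts(5) by (simp add: eps1_def q)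
  have "0 \<le> \<gamma>\<^sup>2 * s" using order_trans[OF zero_le_power2 spectral_facts(2)] by (intro mult_nonneg_nonneg) auto
  then show "eps1 r s \<gamma> \<le> q / 2" by (simp add: eps1_def q)
  have "\<gamma> \<noteq> 0" "r \<noteq> 0" using \<gamma>0 spectral_facts(1) by auto
  then show "2 * eps2 r \<gamma> = e" by (simp add: eps2_def e q field_simps)
qed

text \<open>This is the use of the entry 1 / eps1 of \<open>d2_hat\<close>: since eps1 \<le> q/2
  \<le> 1/4, the factor 1 - 4 / (k + t1) is nonnegative from the start.\<close>

lemma t1_ge: "4 \<le> t1"
proof -
  have "eps1 r s \<gamma> \<le> 1 / 4" using eps_facts(2) spectral_facts(4) by linarith
  then have "4 \<le> 1 / eps1 r s \<gamma>" using eps_facts(1) by (simp add: pos_le_divide_eq)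
  then show ?thesis using t1 by (simp add: d2_hat_def)
qed

lemma \<eta>_pos: "0 < \<eta> k"
  unfolding \<eta>_eq using \<kappa>_pos t1_ge by simp

lemma \<eta>_lt_d2: "\<eta> k < d2 p Lf \<sigma>0 \<tau>0 r s \<gamma>"
proof -
  let ?d = "d2 p Lf \<sigma>0 \<tau>0 r s \<gamma>"
  have pos: "0 < 1 + \<sigma>0\<^sup>2" "0 < 1 + \<tau>0\<^sup>2" by (auto simp: add_pos_nonneg)
  have "0 < e" using spectral_facts(3) by (simp add: e add_pos_nonneg)
  then have d: "0 < ?d"
    using eps_facts(1) Lf p pos unfolding d2_def eps_facts(3) by auto
  have "\<kappa>\<eta> / ?d < t1" using t1 by (simp add: d2_hat_def)
  then have "\<kappa>\<eta> < t1 * ?d" using d by (simp add: pos_divide_less_eq)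
  also have "\<dots> \<le> (real k + t1) * ?d" using d by (intro mult_right_mono) auto
  finally show ?thesis unfolding \<eta>_eq using t1_ge by (simp add: pos_divide_less_eq mult.commute)
qed

definition "dmax k = \<kappa>\<delta> * sqrt (p * \<eta> k) / sqrt (n + p)"

text \<open>The two entries of \<open>d2\<close> become the two smallness conditions: 4 eps1 / 9 is
  at most 2q/9, and \<open>e\<close> is twice \<open>eps2\<close>.\<close>

lemma step_size: "step_size n p Lf \<sigma>0 \<tau>0 \<kappa>\<delta> q e (\<eta> k) (dmax k)"
proof
  show "Lf\<^sup>2 * \<eta> k \<le> 2 / 9 * q"
  proof -
    have "\<eta> k \<le> 4 * eps1 r s \<gamma> / (9 * Lf\<^sup>2)" using \<eta>_lt_d2[of k] by (simp add: d2_def)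
    then have "Lf\<^sup>2 * \<eta> k \<le> Lf\<^sup>2 * (4 * eps1 r s \<gamma> / (9 * Lf\<^sup>2))" by (rule mult_left_mono) simp
    also have "\<dots> = 4 / 9 * eps1 r s \<gamma>" using Lf by simp
    finally show ?thesis using eps_facts(2) by linarith
  qed
  show "64 * real p * (1 + \<sigma>0\<^sup>2) * (1 + \<tau>0\<^sup>2) * (e + Lf) * \<eta> k \<le> 1"
  proof -
    have pos: "0 < 1 + \<sigma>0\<^sup>2" "0 < 1 + \<tau>0\<^sup>2" by (auto simp: add_pos_nonneg)
    have "0 < e" using spectral_facts(3) by (simp add: e add_pos_nonneg)
    then have P: "0 < 64 * real p * (1 + \<sigma>0\<^sup>2) * (1 + \<tau>0\<^sup>2) * (e + Lf)" using p pos Lf by simp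
    have "\<eta> k \<le> 1 / (64 * real p * (1 + \<sigma>0\<^sup>2) * (1 + \<tau>0\<^sup>2) * (e + Lf))"
      using \<eta>_lt_d2[of k] by (simp add: d2_def eps_facts(3))
    then show ?thesis using P by (simp add: pos_le_divide_eq mult.commute)
  qed
  show "(dmax k)\<^sup>2 = \<kappa>\<delta>\<^sup>2 * (real p * \<eta> k) / (real n + real p)"
    using \<eta>_pos[of k] by (simp add: dmax_def power_divide power_mult_distrib)
qed (use n p Lf spectral_facts e \<eta>_pos in auto)

lemma \<delta>_dmax: "i < n \<Longrightarrow> \<delta> i k \<le> dmax k"
  using \<delta>_le by (simp add: dmax_def)

text \<open>Young's weight is \<open>q\<close> itself. As \<gamma>^2 s < q/2, the gossip factor 1 -
  2q + \<gamma>^2 s is at most 1 - 3q/2.\<close>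

lemma v_step': "v (Suc k) \<le> (1 + q) * (1 - 3 / 2 * q) * v k + (1 + 1 / q) * (\<eta> k)\<^sup>2 * gsq k"
proof -
  have "(1 + q) * (1 - 2 * \<gamma> * r + \<gamma>\<^sup>2 * s) * v k \<le> (1 + q) * (1 - 3 / 2 * q) * v k"
    using spectral_facts v_nonneg by (intro mult_right_mono mult_left_mono) (auto simp: q)
  then show ?thesis using v_step[OF spectral_facts(3), of k] unfolding r s by linarith
qed

abbreviation "N \<equiv> noise_const Lf \<sigma>0 \<sigma>1 \<sigma>2 \<kappa>\<delta>"
abbreviation "A \<equiv> gap_const Lf \<sigma>0 \<sigma>1 \<sigma>2 \<kappa>\<delta>"
abbreviation "B \<equiv> lyapunov_const Lf \<nu> e N A R0"
text \<open>Noise level of the consensus recursion per dimension: 16 doubles to 32 through G \<le> 2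
  Lf B, and the last factor comes from \<open>\<eta>_le\<close>.\<close>

abbreviation "b \<equiv> e * (32 * (1 + \<sigma>0\<^sup>2) * (1 + \<tau>0\<^sup>2) * Lf * B + N) * (\<kappa>\<eta> + 1)\<^sup>2"
abbreviation "K \<equiv> consensus_const q b R0"

lemma v_0: "v 0 \<le> \<bar>R0\<bar>"
  using init(1) by (simp add: v_def x_0 M.prob_space)

lemma phi_0: "phi 0 \<le> \<bar>R0\<bar>"
  using init(2) by (simp add: phi_def xb_def x_0 M.prob_space)

lemma lyapunov_bound: "phi k + v k \<le> B"
proof (induction k)
  case 0
  \<comment> \<open>The two initial errors are bounded by |R0| separately, hence the factor
    2.\<close>
  have "2 * \<bar>R0\<bar> \<le> B" by (simp add: lyapunov_const_def)
  then show ?case using v_0 phi_0 by linarith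
next
  case (Suc k)
  show ?case
    by (rule step_size.lyapunov_step[OF step_size v_nonneg G_nonneg gsq_nonneg gsq_bound[OF \<delta>_dmax] v_step'
          phi_step[OF less_imp_le[OF \<eta>_pos] \<delta>_dmax] phi_le_G[OF PL] \<nu> phi_nonneg _ Suc])
      (use spectral_facts in auto)
qed

lemma consts_nonneg: "0 \<le> N" "0 \<le> A" "0 \<le> B" "0 \<le> b" "0 \<le> K"
proof -
  show N: "0 \<le> N" by (rule step_size.N_nonneg[OF step_size])
  show "0 \<le> A" by (rule step_size.A_nonneg[OF step_size])
  show B: "0 \<le> B" by (simp add: lyapunov_const_def le_max_iff_disj)
  have "0 \<le> e" using spectral_facts(3) by (simp add: e)
  then show "0 \<le> b" using N B Lf by (intro mult_nonneg_nonneg add_nonneg_nonneg) auto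
  show "0 \<le> K" by (simp add: consensus_const_def le_max_iff_disj)
qed

text \<open>Both k \<eta> \<le> \<kappa>\<eta> and \<eta> \<le> 1 are free of \<open>t1\<close>, so
  the consensus constant can be fixed before \<open>t1\<close>.\<close>

lemma \<eta>_le: "\<eta> k \<le> (\<kappa>\<eta> + 1) / (real k + 1)"
proof -
  have "real k * \<eta> k \<le> \<kappa>\<eta>"
    unfolding \<eta>_eq using t1_ge \<kappa>_pos by (simp add: pos_divide_le_eq algebra_simps)
  moreover have "\<eta> k \<le> 1"
  proof -
    have "1 * \<eta> k \<le> real p * \<eta> k" using p \<eta>_pos[of k] by (intro mult_right_mono) auto
    then show ?thesis using step_size.p_\<eta>[OF step_size, of k] by linarith
  qed
  ultimately show ?thesis by (simp add: pos_le_divide_eq algebra_simps)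
qed

text \<open>The Lyapunov bound caps the gradient by 2 Lf B and thereby decouples the recursion of
  \<open>v\<close> from the gap; what remains is a contraction with noise of order p / (k +
  1)^2.\<close>

lemma consensus_rate: "v k \<le> K * real p / (real k + 16 / q)\<^sup>2"
proof (rule inverse_square_decay)
  show "0 < q" "q \<le> 1" using spectral_facts by auto
  show "0 \<le> b * real p" "0 \<le> K * real p" using consts_nonneg by auto
  have "v 0 * (16 / q)\<^sup>2 \<le> \<bar>R0\<bar> * (16 / q)\<^sup>2" by (rule mult_right_mono[OF v_0]) simp
  also have "\<dots> \<le> K" by (simp add: consensus_const_def)
  also have "\<dots> \<le> K * real p" using consts_nonneg p by (simp add: mult_le_cancel_left1)
  finally show "v 0 * (16 / q)\<^sup>2 \<le> K * real p" .
  have "8 * b * (16 / q)\<^sup>2 / q \<le> K" by (simp only: consensus_const_def max.cobounded2)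
  then have "8 * b * (16 / q)\<^sup>2 \<le> q * K" using spectral_facts(3) by (simp add: pos_divide_le_eq mult.commute)
  then have "8 * b * (16 / q)\<^sup>2 * real p \<le> q * K * real p" by (rule mult_right_mono) simp
  then show "8 * (b * real p) * (16 / q)\<^sup>2 \<le> q * (K * real p)" by (simp only: mult_ac)
  fix k
  have "G k \<le> 2 * Lf * B"
  proof -
    have "2 * Lf * phi k \<le> 2 * Lf * B" using lyapunov_bound[of k] v_nonneg[of k] Lf by (intro mult_left_mono) auto
    then show ?thesis using G_le_phi[of k] by linarith
  qed
  then have "16 * (1 + \<sigma>0\<^sup>2) * (1 + \<tau>0\<^sup>2) * G k \<le> 16 * (1 + \<sigma>0\<^sup>2) * (1 + \<tau>0\<^sup>2) * (2 * Lf * B)"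
    by (rule mult_left_mono) simp
  then have G: "16 * (1 + \<sigma>0\<^sup>2) * (1 + \<tau>0\<^sup>2) * G k + N \<le> 32 * (1 + \<sigma>0\<^sup>2) * (1 + \<tau>0\<^sup>2) * Lf * B + N"
    by (simp add: algebra_simps)
  have "(\<eta> k)\<^sup>2 \<le> ((\<kappa>\<eta> + 1) / (real k + 1))\<^sup>2" using \<eta>_pos[of k] by (intro power_mono \<eta>_le) auto
  then have eta2: "(\<eta> k)\<^sup>2 \<le> (\<kappa>\<eta> + 1)\<^sup>2 / (real k + 1)\<^sup>2" by (simp add: power_divide)
  have e0: "0 \<le> e" using spectral_facts(3) by (simp add: e)
  have "e * real p * (16 * (1 + \<sigma>0\<^sup>2) * (1 + \<tau>0\<^sup>2) * G k + N) * (\<eta> k)\<^sup>2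
      \<le> e * real p * (32 * (1 + \<sigma>0\<^sup>2) * (1 + \<tau>0\<^sup>2) * Lf * B + N) * ((\<kappa>\<eta> + 1)\<^sup>2 / (real k + 1)\<^sup>2)"
    using e0 G eta2 consts_nonneg Lf by (intro mult_mono mult_left_mono) auto
  also have "\<dots> = b * real p / (real k + 1)\<^sup>2" by simp
  finally have 1: "e * real p * (16 * (1 + \<sigma>0\<^sup>2) * (1 + \<tau>0\<^sup>2) * G k + N) * (\<eta> k)\<^sup>2 \<le> b * real p / (real k + 1)\<^sup>2" .
  have 2: "(1 - 17 / 36 * q) * v k \<le> (1 - q / 4) * v k"
    using spectral_facts v_nonneg by (intro mult_right_mono) auto
  show "v (Suc k) \<le> (1 - q / 4) * v k + b * real p / (real k + 1)\<^sup>2"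
    using step_size.v_contract_sq[OF step_size v_nonneg G_nonneg gsq_nonneg gsq_bound[OF \<delta>_dmax] v_step', of k] 1 2
    by linarith
qed

lemma consensus_rate': "v k \<le> K * real p / (real k + 1)\<^sup>2"
proof -
  have "1 \<le> 16 / q" using spectral_facts by (simp add: pos_le_divide_eq)
  then have "K * real p / (real k + 16 / q)\<^sup>2 \<le> K * real p / (real k + 1)\<^sup>2"
    using consts_nonneg by (intro divide_left_mono power_mono mult_pos_pos zero_less_power) auto
  then show ?thesis using consensus_rate[of k] by linarith
qed

text \<open>The disagreement enters with \<eta> v = O(p / t^3), so it ends up in the fast term
  together with the initial gap. The slow term carries only \<open>A\<close> and \<kappa>\<eta>,
  which are blind to the network.\<close>

lemma gap_rate:
  "phi k \<le> A * \<kappa>\<eta>\<^sup>2 * (real p / real n) / (real k + t1) + (\<bar>R0\<bar> + Lf\<^sup>2 * \<kappa>\<eta> * K) * t1\<^sup>2 * real p / (real k + t1)\<^sup>2"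
proof (rule inverse_linear_decay[OF t1_ge])
  let ?d = "(\<bar>R0\<bar> + Lf\<^sup>2 * \<kappa>\<eta> * K) * t1\<^sup>2 * real p"
  have K0: "0 \<le> Lf\<^sup>2 * \<kappa>\<eta> * K" using consts_nonneg \<kappa>_pos by auto
  show "0 \<le> A * \<kappa>\<eta>\<^sup>2 * (real p / real n)" using consts_nonneg by auto
  show "0 \<le> ?d" using K0 by auto
  have "phi 0 * t1\<^sup>2 \<le> (\<bar>R0\<bar> + Lf\<^sup>2 * \<kappa>\<eta> * K) * t1\<^sup>2 * 1"
    using phi_0 K0 by (simp add: mult_right_mono)
  also have "\<dots> \<le> ?d" using K0 p by (intro mult_left_mono) auto
  finally show "phi 0 * t1\<^sup>2 \<le> ?d" .
  fix k
  define t where "t = real k + t1"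
  have t: "4 \<le> t" using t1_ge by (simp add: t_def)
  have eta: "\<eta> k = \<kappa>\<eta> / t" by (simp add: t_def \<eta>_eq)
  have step: "phi (Suc k) \<le> phi k - 23 / 64 * \<eta> k * G k + 35 / 32 * \<eta> k * Lf\<^sup>2 * v k + A * (real p / real n) * (\<eta> k)\<^sup>2"
    by (rule step_size.phi_contract[OF step_size v_nonneg G_nonneg gsq_nonneg gsq_bound[OF \<delta>_dmax]
          phi_step[OF less_imp_le[OF \<eta>_pos] \<delta>_dmax]])
  \<comment> \<open>From 8 < \<nu> \<kappa>\<eta> and the Polyak-Lojasiewicz inequality, (4 / t)
    \<phi> is at most \<eta> G / 4, and 1/4 = 16/64 is below 23/64.\<close>
  have "4 / t * phi k \<le> 23 / 64 * \<eta> k * G k"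
  proof -
    have "8 < \<nu> * \<kappa>\<eta>" using \<kappa> \<nu> by (simp add: pos_divide_less_eq mult.commute)
    then have "8 / t \<le> \<nu> * \<eta> k" unfolding eta using t by (simp add: divide_right_mono)
    then have "8 / t * phi k \<le> \<nu> * \<eta> k * phi k" using phi_nonneg by (rule mult_right_mono)
    moreover have "\<eta> k * (2 * \<nu> * phi k) \<le> \<eta> k * G k"
      using phi_le_G[OF PL] \<eta>_pos[of k] by (intro mult_left_mono) auto
    moreover have "0 \<le> \<eta> k * G k" using \<eta>_pos[of k] G_nonneg by simp
    ultimately show ?thesis by (simp add: mult_ac)
  qed
  moreover have "35 / 32 * \<eta> k * Lf\<^sup>2 * v k \<le> 2 * ?d / t ^ 3"
  proof -
    \<comment> \<open>The consensus rate is in terms of k + 1; the change to t = k + t1 costs the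
      factor t1^2, which therefore appears in \<open>?d\<close>.\<close>
    have "t \<le> t1 * (real k + 1)" using t1_ge mult_right_mono[of 1 t1 "real k"] by (simp add: t_def algebra_simps)
    then have "t\<^sup>2 \<le> t1\<^sup>2 * (real k + 1)\<^sup>2" using t power_mono[of t "t1 * (real k + 1)" 2] by (simp add: power_mult_distrib)
    then have "K * real p * t\<^sup>2 \<le> K * real p * (t1\<^sup>2 * (real k + 1)\<^sup>2)"
      using consts_nonneg by (intro mult_left_mono) auto
    then have "K * real p / (real k + 1)\<^sup>2 \<le> K * real p * t1\<^sup>2 / t\<^sup>2"
      using t by (simp add: field_simps)
    then have "v k \<le> K * real p * t1\<^sup>2 / t\<^sup>2" using consensus_rate'[of k] by linarith
    then have "2 * \<eta> k * Lf\<^sup>2 * v k \<le> 2 * \<eta> k * Lf\<^sup>2 * (K * real p * t1\<^sup>2 / t\<^sup>2)"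
      using \<eta>_pos[of k] by (intro mult_left_mono) auto
    also have "\<dots> = 2 * ((Lf\<^sup>2 * \<kappa>\<eta> * K) * t1\<^sup>2 * real p) / t ^ 3"
    proof -
      have "2 * (\<kappa>\<eta> / t) * L * (k * P * Q / t\<^sup>2) = 2 * ((L * \<kappa>\<eta> * k) * Q * P) / t ^ 3" for L k P Q :: real
        using t by (simp add: field_simps power3_eq_cube power2_eq_square)
      then show ?thesis unfolding eta .
    qed
    also have "\<dots> \<le> 2 * ?d / t ^ 3"
      using t by (intro divide_right_mono mult_left_mono mult_right_mono) auto
    finally have "2 * \<eta> k * Lf\<^sup>2 * v k \<le> 2 * ?d / t ^ 3" .
    moreover have "0 \<le> \<eta> k * Lf\<^sup>2 * v k" using \<eta>_pos[of k] v_nonneg by simp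
    ultimately show ?thesis by linarith
  qed
  moreover have "A * (real p / real n) * (\<eta> k)\<^sup>2 = A * \<kappa>\<eta>\<^sup>2 * (real p / real n) / t\<^sup>2"
    by (simp add: eta power_divide)
  ultimately show "phi (Suc k) \<le> (1 - 4 / (real k + t1)) * phi k + A * \<kappa>\<eta>\<^sup>2 * (real p / real n) / (real k + t1)\<^sup>2
      + 2 * ?d / (real k + t1) ^ 3"
    unfolding t_def[symmetric] using step by (simp only: left_diff_distrib mult_1)
qed

lemma final_rates:
  assumes T: "1 \<le> T"
  shows "v T \<le> K * (real p / (real T)\<^sup>2)"
    and "phi T \<le> A * \<kappa>\<eta>\<^sup>2 * (real p / (real n * real T)) + (\<bar>R0\<bar> + Lf\<^sup>2 * \<kappa>\<eta> * K) * t1\<^sup>2 * (real p / (real T)\<^sup>2)"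
proof -
  have T0: "0 < real T" using T by simp
  have "K * real p / (real T + 1)\<^sup>2 \<le> K * real p / (real T)\<^sup>2"
    using consts_nonneg T0 by (intro divide_left_mono power_mono mult_pos_pos zero_less_power) auto
  then show "v T \<le> K * (real p / (real T)\<^sup>2)" using consensus_rate'[of T] by simp
  have K0: "0 \<le> Lf\<^sup>2 * \<kappa>\<eta> * K" using consts_nonneg \<kappa>_pos by auto
  have "A * \<kappa>\<eta>\<^sup>2 * (real p / real n) / (real T + t1) \<le> A * \<kappa>\<eta>\<^sup>2 * (real p / real n) / real T"
    using consts_nonneg T0 t1_ge by (intro divide_left_mono mult_pos_pos) auto
  moreover have "(\<bar>R0\<bar> + Lf\<^sup>2 * \<kappa>\<eta> * K) * t1\<^sup>2 * real p / (real T + t1)\<^sup>2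
      \<le> (\<bar>R0\<bar> + Lf\<^sup>2 * \<kappa>\<eta> * K) * t1\<^sup>2 * real p / (real T)\<^sup>2"
    using K0 T0 t1_ge by (intro divide_left_mono power_mono mult_pos_pos zero_less_power) auto
  ultimately show "phi T \<le> A * \<kappa>\<eta>\<^sup>2 * (real p / (real n * real T))
      + (\<bar>R0\<bar> + Lf\<^sup>2 * \<kappa>\<eta> * K) * t1\<^sup>2 * (real p / (real T)\<^sup>2)"
    using gap_rate[of T] by simp
qed

end

end

text \<open>The order of the quantifiers records what each constant may depend on: \<open>C1\<close>
  precedes the spectral data, \<gamma>, \<open>t1\<close> and the bound on the initial errors,
  \<open>C3\<close> precedes \<open>t1\<close>, and all three precede \<open>n\<close>,
  \<open>p\<close>, the graph and the probability space.\<close>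

theorem theorem10:
  fixes Lf \<nu> \<sigma>0 \<sigma>1 \<tau>0 \<sigma>2 \<kappa>\<eta> \<kappa>\<delta> d3 :: real
  assumes "0 < Lf" and "0 < \<nu>" and "0 < \<kappa>\<delta>" and "1 < d3"
    and "8 / \<nu> < \<kappa>\<eta>" and "\<kappa>\<eta> \<le> 8 * d3 / \<nu>"
  shows "\<exists>C1::real. \<forall>(r::real) (s::real) (\<gamma>::real) (R0::real).
    \<exists>C3::real. \<forall>t1::real. \<exists>C2::real.
    \<forall>(n::nat) (p::nat) (E :: (nat \<times> nat) set) (a :: nat \<Rightarrow> nat \<Rightarrow> real)
      (D :: nat \<Rightarrow> 'z measure) (F :: nat \<Rightarrow> (nat \<Rightarrow>\<^sub>0 real) \<Rightarrow> 'z \<Rightarrow> real)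
      (M :: 'w measure) (u :: nat \<Rightarrow> nat \<Rightarrow> 'w \<Rightarrow> (nat \<Rightarrow>\<^sub>0 real)) (\<xi> :: nat \<Rightarrow> nat \<Rightarrow> 'w \<Rightarrow> 'z)
      (x0 :: nat \<Rightarrow> (nat \<Rightarrow>\<^sub>0 real)) (\<eta> :: nat \<Rightarrow> real) (\<delta> :: nat \<Rightarrow> nat \<Rightarrow> real).
    let L = laplacian n a;
        f = global_obj n D F;
        fstar = min_value p f;
        x = (\<lambda>k \<omega>. zo_iter p n a F \<gamma> \<eta> \<delta> x0 (\<lambda>i l. u i l \<omega>) (\<lambda>i l. \<xi> i l \<omega>) k)
    in
      1 \<le> n \<and> 1 \<le> p \<and>
      weighted_graph n E a \<and> connected_graph n E \<and>
      rho2 L = r \<and> rho (L * L) = s \<and>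
      stochastic_functions p n D F \<and>
      minimizers p f \<noteq> {} \<and> bdd_below (f ` euclid p) \<and>
      (\<forall>i<n. AE z in D i. smooth p Lf (\<lambda>y. F i y z)) \<and>
      bounded_variance p n D F \<sigma>0 \<sigma>1 \<and>
      bounded_dissimilarity p n D F \<tau>0 \<sigma>2 \<and>
      polyak_lojasiewicz p \<nu> f \<and>
      random_draws M p n D u \<xi> \<and>
      (\<forall>i<n. x0 i \<in> euclid p) \<and>
      consensus_error n x0 \<le> R0 \<and> f (average n x0) - fstar \<le> R0 \<and>
      0 < \<gamma> \<and> \<gamma> < d1 r s \<and>
      d2_hat p Lf \<sigma>0 \<tau>0 \<kappa>\<eta> r s \<gamma> < t1 \<and>
      (\<forall>k. \<eta> k = \<kappa>\<eta> / (real k + t1)) \<and>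
      (\<forall>i<n. \<forall>k. 0 < \<delta> i k \<and> \<delta> i k \<le> \<kappa>\<delta> * sqrt (p * \<eta> k) / sqrt (n + p))
      \<longrightarrow>
      (\<forall>T\<ge>1::nat.
        integrable M (\<lambda>\<omega>. consensus_error n (x T \<omega>)) \<and>
        (\<integral>\<omega>. consensus_error n (x T \<omega>) \<partial>M) \<le> C3 * (p / (real T)\<^sup>2) \<and>
        integrable M (\<lambda>\<omega>. f (average n (x T \<omega>)) - fstar) \<and>
        (\<integral>\<omega>. f (average n (x T \<omega>)) - fstar \<partial>M) \<le> C1 * (p / (n * T)) + C2 * (p / (real T)\<^sup>2))"
proof -
  let ?N = "noise_const Lf \<sigma>0 \<sigma>1 \<sigma>2 \<kappa>\<delta>" and ?A = "gap_const Lf \<sigma>0 \<sigma>1 \<sigma>2 \<kappa>\<delta>"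
  define K where "K r \<gamma> R0 = (let q = \<gamma> * r; e = 2 + 1 / q in
    consensus_const q (e * (32 * (1 + \<sigma>0\<^sup>2) * (1 + \<tau>0\<^sup>2) * Lf * lyapunov_const Lf \<nu> e ?N ?A R0 + ?N) * (\<kappa>\<eta> + 1)\<^sup>2) R0)"
    for r \<gamma> R0
  show ?thesis
    unfolding Let_def
  \<comment> \<open>The witnesses stay schematic and are read off the final bounds. For this,
    \<open>K\<close> is defined as a function of \<open>r\<close>, \<gamma> and \<open>R0\<close>,
    the quantities that are fixed when \<open>C3\<close> is chosen.\<close>
  proof (rule exI, (rule allI)+, rule exI, rule allI, rule exI, intro allI impI, elim conjE)
    fix r s \<gamma> R0 t1 :: real and n p :: nat and E a D and F :: "nat \<Rightarrow> (nat \<Rightarrow>\<^sub>0 real) \<Rightarrow> 'z \<Rightarrow> real"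
      and M :: "'w measure" and u :: "nat \<Rightarrow> nat \<Rightarrow> 'w \<Rightarrow> (nat \<Rightarrow>\<^sub>0 real)" and \<xi> :: "nat \<Rightarrow> nat \<Rightarrow> 'w \<Rightarrow> 'z"
      and x0 :: "nat \<Rightarrow> (nat \<Rightarrow>\<^sub>0 real)" and \<eta> \<delta> and T :: nat
    let ?f = "global_obj n D F"
    let ?x = "\<lambda>k \<omega>. zo_iter p n a F \<gamma> \<eta> \<delta> x0 (\<lambda>i l. u i l \<omega>) (\<lambda>i l. \<xi> i l \<omega>) k"
    assume n: "1 \<le> n" and p: "1 \<le> p" and wg: "weighted_graph n E a" and conn: "connected_graph n E"
      and r: "rho2 (laplacian n a) = r" and s: "rho (laplacian n a * laplacian n a) = s"
      and sf: "stochastic_functions p n D F" and "minimizers p ?f \<noteq> {}" and bdd: "bdd_below (?f ` euclid p)"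
      and sm: "\<forall>i<n. AE z in D i. smooth p Lf (\<lambda>y. F i y z)"
      and bv: "bounded_variance p n D F \<sigma>0 \<sigma>1" and bd: "bounded_dissimilarity p n D F \<tau>0 \<sigma>2"
      and PL: "polyak_lojasiewicz p \<nu> ?f" and draws: "random_draws M p n D u \<xi>"
      and x0: "\<forall>i<n. x0 i \<in> euclid p"
      and init: "consensus_error n x0 \<le> R0" "?f (average n x0) - min_value p ?f \<le> R0"
      and gam: "0 < \<gamma>" "\<gamma> < d1 r s" and t1: "d2_hat p Lf \<sigma>0 \<tau>0 \<kappa>\<eta> r s \<gamma> < t1"
      and eta: "\<forall>k. \<eta> k = \<kappa>\<eta> / (real k + t1)"
      and del: "\<forall>i<n. \<forall>k. 0 < \<delta> i k \<and> \<delta> i k \<le> \<kappa>\<delta> * sqrt (p * \<eta> k) / sqrt (n + p)"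
      and T: "1 \<le> T"
    have "n \<noteq> 1"
    proof
      assume "n = 1"
      then have "s = 0" using rho_laplacian_single[of E a] wg s by simp
      then show False using gam by (simp add: d1_def)
    qed
    have dl: "\<forall>i<n. \<forall>k. \<delta> i k \<le> \<kappa>\<delta> * sqrt (p * \<eta> k) / sqrt (n + p)"
      using del by blast
    interpret zo_network n p a D F M u \<xi> x0 \<eta> \<delta> \<gamma> Lf \<sigma>0 \<sigma>1 E \<tau>0 \<sigma>2
      by unfold_locales (use n \<open>n \<noteq> 1\<close> p assms wg conn sf bdd sm bv bd draws x0 gam del in auto)
    note rates = final_rates[OF assms(2,5) r[symmetric] s[symmetric] refl refl gam t1 eta[rule_format] dl PL init T]
    have "(\<integral>\<omega>. consensus_error n (x T \<omega>) \<partial>M) \<le> K r \<gamma> R0 * (p / (real T)\<^sup>2)"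
      using rates(1) by (simp add: K_def Let_def v_def)
    moreover have "(\<integral>\<omega>. ?f (average n (x T \<omega>)) - min_value p ?f \<partial>M)
        \<le> ?A * \<kappa>\<eta>\<^sup>2 * (p / (n * T)) + (\<bar>R0\<bar> + Lf\<^sup>2 * \<kappa>\<eta> * K r \<gamma> R0) * t1\<^sup>2 * (p / (real T)\<^sup>2)"
      using rates(2) by (simp add: K_def Let_def phi_def xb_def)
    ultimately show "integrable M (\<lambda>\<omega>. consensus_error n (?x T \<omega>)) \<and>
        (\<integral>\<omega>. consensus_error n (?x T \<omega>) \<partial>M) \<le> K r \<gamma> R0 * (p / (real T)\<^sup>2) \<and>
        integrable M (\<lambda>\<omega>. ?f (average n (?x T \<omega>)) - min_value p ?f) \<and>
        (\<integral>\<omega>. ?f (average n (?x T \<omega>)) - min_value p ?f \<partial>M)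
          \<le> ?A * \<kappa>\<eta>\<^sup>2 * (p / (n * T)) + (\<bar>R0\<bar> + Lf\<^sup>2 * \<kappa>\<eta> * K r \<gamma> R0) * t1\<^sup>2 * (p / (real T)\<^sup>2)"
      using integrable_V[of T] integrable_gap[of T] by (simp only: x_def xb_def simp_thms)
  qed
qed

end
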